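(* Let $(M,F)$ be a connected Finsler manifold of dimension $n\geq 3$ whose mean Landsberg tensor $P_i\,dx^i$ vanishes or, more generally, satisfies $$g^{ij}\left(P_{i|j|0}-2P_iP_{j|0}+P_{i|0\cdot j|0}\right)=0$$ on $TM\setminus\mathbf{0}$. If $\mathrm{Ric}=\rho F^2$ on $TM\setminus\mathbf{0}$ for some smooth function $\rho\colon M\to\mathbb{R}$, then $\rho$ is constant.
   Context: Notation. $M$ is a smooth manifold of dimension $n$, $(x^i)$ are local coordinates on $M$ and $(x^i,y^i)$ the induced natural coordinates on $TM$; $\partial_i=\partial/\partial x^i$, $\dot\partial_i=\partial/\partial y^i$; the Einstein summation convention is used. "$r$-homogeneous" means positively homogeneous of degree $r$ in $y$. A Finsler metric on $M$ is a positive smooth $1$-homogeneous function $F$ on $TM\setminus\mathbf{0}$ (slit tangent bundle) such that $g_{ij}(x,y)=\frac12\frac{\partial^2F^2}{\partial y^i\partial y^j}(x,y)$ is positive definite at every $(x,y)\in TM\setminus\mathbf{0}$. $(g^{ij})$ is the inverse matrix. An anisotropic tensor has components in natural coordinates that are smooth functions of $(x,y)\in TM\setminus\mathbf{0}$ and that transform as those of a tensor on $M$. An index after a dot denotes vertical derivative: $f_{\cdot j}=\dot\partial_jf$, $\theta_{i\cdot j}=\dot\partial_j\theta_i$, etc. Spray coefficients: $G^i=\frac14 g^{ic}\left(\partial_a g_{cb}+\partial_b g_{ac}-\partial_c g_{ab}\right)y^ay^b$. Horizontal frame: $\delta_i=\partial_i-G^a_{\cdot i}\dot\partial_a$. Chern–Rund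 Christoffel symbols: $\Gamma^i_{jk}=\frac12g^{il}(\delta_jg_{lk}+\delta_kg_{lj}-\delta_lg_{jk})$. The associated covariant derivative of anisotropic tensors is denoted by a vertical bar: $f_{|j}=\delta_jf$, $\theta_{i|j}=\delta_j\theta_i-\Gamma^k_{ji}\theta_k$, and similarly for other tensor types; $_{|0}$ denotes contraction of the new index with $y$: $f_{|0}=y^j\delta_jf$, $\theta_{i|0}=\theta_{i|j}y^j$, $T_{ij|0}=T_{ij|k}y^k$, etc. Successive subscripts denote derivatives applied from left to right: $P_{i|j|0}=(P_{i|j})_{|0}$ and $P_{i|0\cdot j|0}=\big(\dot\partial_j(P_{i|0})\big)_{|0}$, where the last $_{|0}$ acts on the $2$-covariant anisotropic tensor with components $\dot\partial_j(P_{i|0})$. Mean Landsberg tensor: $P_i=G^a_{\cdot a\cdot i}-\Gamma^a_{ai}$. (The metric is called weakly Landsberg when $P_i=0$.) Ricci scalar ($2$-homogeneous): $\mathrm{Ric}=2\frac{\partial G^i}{\partial x^i}-y^j\frac{\partial^2G^i}{\partial x^j\partial y^i}+2G^j\frac{\partial^2G^i}{\partial y^j\partial y^i}-\frac{\partial G^i}{\partial y^j}\frac{\partial G^j}{\partial y^i}$. *)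

theory Defs
  imports "HOL-Analysis.Analysis"
begin

section \<open>Smooth functions on open subsets of Euclidean spaces\<close>

text \<open>Only meant for open \<open>S\<close>. Requiring total differentiability together with \<open>C\<^sup>k\<close>
  directional derivatives in every fixed direction is the usual notion of \<open>C\<^sup>k\<^sup>+\<^sup>1\<close> in finite
  dimension.\<close>

primrec Ck_on :: "nat \<Rightarrow> 'a::euclidean_space set \<Rightarrow> ('a \<Rightarrow> 'b::real_normed_vector) \<Rightarrow> bool" where
  "Ck_on 0 S f \<longleftrightarrow> continuous_on S f"
| "Ck_on (Suc k) S f \<longleftrightarrow>
     (\<forall>x\<in>S. f differentiable (at x)) \<and>
     (\<forall>v. Ck_on k S (\<lambda>x. frechet_derivative f (at x) v))"

definition smooth_on :: "'a::euclidean_space set \<Rightarrow> ('a \<Rightarrow> 'b::real_normed_vector) \<Rightarrow> bool" where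
  "smooth_on S f \<longleftrightarrow> (\<forall>k. Ck_on k S f)"


section \<open>Smooth manifolds and their tangent bundles\<close>

type_synonym ('m, 'n) chart = "'m set \<times> ('m \<Rightarrow> real^'n)"

abbreviation chart_dom :: "('m, 'n) chart \<Rightarrow> 'm set" where
  "chart_dom c \<equiv> fst c"

abbreviation chart_map :: "('m, 'n) chart \<Rightarrow> 'm \<Rightarrow> real^'n" where
  "chart_map c \<equiv> snd c"

definition chart_image :: "('m, 'n) chart \<Rightarrow> (real^'n) set" where
  "chart_image c = chart_map c ` chart_dom c"

definition chart_inv :: "('m, 'n) chart \<Rightarrow> real^'n \<Rightarrow> 'm" where
  "chart_inv c = the_inv_into (chart_dom c) (chart_map c)"

definition is_chart :: "'m topology \<Rightarrow> ('m, 'n::finite) chart \<Rightarrow> bool" where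
  "is_chart X c \<longleftrightarrow>
     openin X (chart_dom c) \<and> open (chart_image c) \<and>
     homeomorphic_map (subtopology X (chart_dom c)) (top_of_set (chart_image c)) (chart_map c)"

definition transition :: "('m, 'n) chart \<Rightarrow> ('m, 'n) chart \<Rightarrow> real^'n \<Rightarrow> real^'n" where
  "transition c d = chart_map d \<circ> chart_inv c"

text \<open>The smooth structure is given by a (not necessarily maximal) atlas \<open>A\<close>; the dimension is
  \<open>CARD('n)\<close>.\<close>

definition smooth_manifold :: "'m topology \<Rightarrow> ('m, 'n::finite) chart set \<Rightarrow> bool" where
  "smooth_manifold X A \<longleftrightarrow>
     Hausdorff_space X \<and> second_countable X \<and>
     (\<forall>c\<in>A. is_chart X c) \<and>
     (\<Union>c\<in>A. chart_dom c) = topspace X \<and>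
     (\<forall>c\<in>A. \<forall>d\<in>A.
        smooth_on (chart_map c ` (chart_dom c \<inter> chart_dom d)) (transition c d))"

definition smooth_scalar :: "('m, 'n::finite) chart set \<Rightarrow> ('m \<Rightarrow> real) \<Rightarrow> bool" where
  "smooth_scalar A f \<longleftrightarrow> (\<forall>c\<in>A. smooth_on (chart_image c) (f \<circ> chart_inv c))"

text \<open>A tangent vector at \<open>p\<close> is a family of components, one vector of \<open>\<real>\<^sup>n\<close> for each chart around
  \<open>p\<close>, related by the Jacobians of the coordinate changes. Entries at all other indices are set
  to \<open>0\<close>, so that the zero vector is \<open>\<lambda>_. 0\<close> and equality of functions is equality of vectors.\<close>

type_synonym ('m, 'n) tvec = "('m, 'n) chart \<Rightarrow> real^'n"

definition charts_at :: "('m, 'n) chart set \<Rightarrow> 'm \<Rightarrow> ('m, 'n) chart set" where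
  "charts_at A p = {c \<in> A. p \<in> chart_dom c}"

definition tangent_space :: "('m, 'n::finite) chart set \<Rightarrow> 'm \<Rightarrow> ('m, 'n) tvec set" where
  "tangent_space A p = {v.
     (\<forall>c\<in>charts_at A p. \<forall>d\<in>charts_at A p.
        v d = frechet_derivative (transition c d) (at (chart_map c p)) (v c)) \<and>
     (\<forall>c. c \<notin> charts_at A p \<longrightarrow> v c = 0)}"

definition slit_tangent_bundle ::
    "'m topology \<Rightarrow> ('m, 'n::finite) chart set \<Rightarrow> ('m \<times> ('m, 'n) tvec) set" where
  "slit_tangent_bundle X A =
     {(p, v). p \<in> topspace X \<and> v \<in> tangent_space A p \<and> v \<noteq> (\<lambda>_. 0)}"

text \<open>The point \<open>(x, y)\<close> stands for the element of the tangent bundle with natural coordinates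
  \<open>(x\<^sup>i, y\<^sup>i)\<close> induced by the chart \<open>c\<close>.\<close>

definition of_natural_coords ::
    "('m, 'n::finite) chart set \<Rightarrow> ('m, 'n) chart \<Rightarrow> (real^'n) \<times> (real^'n) \<Rightarrow> 'm \<times> ('m, 'n) tvec"
  where
  "of_natural_coords A c = (\<lambda>(x, y).
     (chart_inv c x,
      \<lambda>d. if d \<in> charts_at A (chart_inv c x)
           then frechet_derivative (transition c d) (at x) y else 0))"

definition slit_coords :: "('m, 'n::finite) chart \<Rightarrow> ((real^'n) \<times> (real^'n)) set" where
  "slit_coords c = chart_image c \<times> (UNIV - {0})"

definition in_coords ::
    "('m, 'n::finite) chart set \<Rightarrow> ('m, 'n) chart \<Rightarrow> ('m \<times> ('m, 'n) tvec \<Rightarrow> real)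
     \<Rightarrow> (real^'n) \<times> (real^'n) \<Rightarrow> real" where
  "in_coords A c F = F \<circ> of_natural_coords A c"


section \<open>Local expressions in natural coordinates\<close>

text \<open>Components of anisotropic tensors are functions of \<open>(x, y)\<close>. Throughout, \<open>L\<close> is the
  Finsler metric in natural coordinates.\<close>

type_synonym 'n cfun = "(real^'n) \<times> (real^'n) \<Rightarrow> real"

definition dx :: "'n \<Rightarrow> 'n::finite cfun \<Rightarrow> 'n cfun" where
  "dx i f z = frechet_derivative f (at z) (axis i 1, 0)"

definition dy :: "'n \<Rightarrow> 'n::finite cfun \<Rightarrow> 'n cfun" where
  "dy i f z = frechet_derivative f (at z) (0, axis i 1)"

definition fund :: "'n::finite cfun \<Rightarrow> 'n \<Rightarrow> 'n \<Rightarrow> 'n cfun" where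
  "fund L i j z = 1/2 * dy i (dy j (\<lambda>w. (L w)\<^sup>2)) z"

definition fund_inv :: "'n::finite cfun \<Rightarrow> 'n \<Rightarrow> 'n \<Rightarrow> 'n cfun" where
  "fund_inv L i j z = matrix_inv (\<chi> a b. fund L a b z) $ i $ j"

definition spray :: "'n::finite cfun \<Rightarrow> 'n \<Rightarrow> 'n cfun" where
  "spray L i z = 1/4 * (\<Sum>c\<in>UNIV. \<Sum>a\<in>UNIV. \<Sum>b\<in>UNIV. fund_inv L i c z *
     (dx a (fund L c b) z + dx b (fund L a c) z - dx c (fund L a b) z) *
     snd z $ a * snd z $ b)"

definition hor :: "'n::finite cfun \<Rightarrow> 'n \<Rightarrow> 'n cfun \<Rightarrow> 'n cfun" where
  "hor L i f z = dx i f z - (\<Sum>a\<in>UNIV. dy i (spray L a) z * dy a f z)"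

text \<open>\<open>chern L i j k\<close> is \<open>\<Gamma>\<^sup>i\<close> with lower indices \<open>j, k\<close>.\<close>

definition chern :: "'n::finite cfun \<Rightarrow> 'n \<Rightarrow> 'n \<Rightarrow> 'n \<Rightarrow> 'n cfun" where
  "chern L i j k z = 1/2 * (\<Sum>l\<in>UNIV. fund_inv L i l z *
     (hor L j (fund L l k) z + hor L k (fund L l j) z - hor L l (fund L j k) z))"

text \<open>Covariant derivatives of 1- and 2-covariant anisotropic tensors; the last index is the
  new one.\<close>

definition cov1 :: "'n::finite cfun \<Rightarrow> ('n \<Rightarrow> 'n cfun) \<Rightarrow> 'n \<Rightarrow> 'n \<Rightarrow> 'n cfun" where
  "cov1 L \<theta> i j z = hor L j (\<theta> i) z - (\<Sum>k\<in>UNIV. chern L k j i z * \<theta> k z)"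

definition cov2 :: "'n::finite cfun \<Rightarrow> ('n \<Rightarrow> 'n \<Rightarrow> 'n cfun) \<Rightarrow> 'n \<Rightarrow> 'n \<Rightarrow> 'n \<Rightarrow> 'n cfun" where
  "cov2 L T i j k z = hor L k (T i j) z
     - (\<Sum>l\<in>UNIV. chern L l k i z * T l j z) - (\<Sum>l\<in>UNIV. chern L l k j z * T i l z)"

text \<open>The operation \<open>|0\<close>: contraction of the new index with \<open>y\<close>.\<close>

definition cov1_0 :: "'n::finite cfun \<Rightarrow> ('n \<Rightarrow> 'n cfun) \<Rightarrow> 'n \<Rightarrow> 'n cfun" where
  "cov1_0 L \<theta> i z = (\<Sum>j\<in>UNIV. cov1 L \<theta> i j z * snd z $ j)"

definition cov2_0 :: "'n::finite cfun \<Rightarrow> ('n \<Rightarrow> 'n \<Rightarrow> 'n cfun) \<Rightarrow> 'n \<Rightarrow> 'n \<Rightarrow> 'n cfun" where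
  "cov2_0 L T i j z = (\<Sum>k\<in>UNIV. cov2 L T i j k z * snd z $ k)"

definition mean_landsberg :: "'n::finite cfun \<Rightarrow> 'n \<Rightarrow> 'n cfun" where
  "mean_landsberg L i z =
     (\<Sum>a\<in>UNIV. dy i (dy a (spray L a)) z) - (\<Sum>a\<in>UNIV. chern L a a i z)"

definition ricci :: "'n::finite cfun \<Rightarrow> 'n cfun" where
  "ricci L z =
     2 * (\<Sum>i\<in>UNIV. dx i (spray L i) z)
     - (\<Sum>i\<in>UNIV. \<Sum>j\<in>UNIV. snd z $ j * dx j (dy i (spray L i)) z)
     + 2 * (\<Sum>i\<in>UNIV. \<Sum>j\<in>UNIV. spray L j z * dy j (dy i (spray L i)) z)
     - (\<Sum>i\<in>UNIV. \<Sum>j\<in>UNIV. dy j (spray L i) z * dy i (spray L j) z)"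

text \<open>\<open>g\<^sup>i\<^sup>j (P\<^sub>i\<^sub>|\<^sub>j\<^sub>|\<^sub>0 - 2 P\<^sub>i P\<^sub>j\<^sub>|\<^sub>0 + P\<^sub>i\<^sub>|\<^sub>0\<^sub>\<cdot>\<^sub>j\<^sub>|\<^sub>0)\<close>\<close>

definition mean_landsberg_expr :: "'n::finite cfun \<Rightarrow> 'n cfun" where
  "mean_landsberg_expr L z = (let P = mean_landsberg L in
     \<Sum>i\<in>UNIV. \<Sum>j\<in>UNIV. fund_inv L i j z *
       (cov2_0 L (cov1 L P) i j z
        - 2 * P i z * cov1_0 L P j z
        + cov2_0 L (\<lambda>i j. dy j (cov1_0 L P i)) i j z))"


section \<open>Finsler metrics\<close>

definition finsler_metric ::
    "'m topology \<Rightarrow> ('m, 'n::finite) chart set \<Rightarrow> ('m \<times> ('m, 'n) tvec \<Rightarrow> real) \<Rightarrow> bool" where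
  "finsler_metric X A F \<longleftrightarrow>
     (\<forall>u\<in>slit_tangent_bundle X A. F u > 0) \<and>
     (\<forall>c\<in>A. smooth_on (slit_coords c) (in_coords A c F)) \<and>
     (\<forall>(p, v)\<in>slit_tangent_bundle X A. \<forall>t>0. F (p, \<lambda>c. t *\<^sub>R v c) = t * F (p, v)) \<and>
     (\<forall>c\<in>A. \<forall>z\<in>slit_coords c. \<forall>w. w \<noteq> 0 \<longrightarrow>
        (\<Sum>i\<in>UNIV. \<Sum>j\<in>UNIV. fund (in_coords A c F) i j z * w $ i * w $ j) > 0)"

end

theory Submission
  imports Defs
begin

text \<open>Work in one chart and write \<open>E = F\<^sup>2\<close>, \<open>y\<^sub>k = g\<^sub>k\<^sub>a y\<^sup>a\<close>, \<open>S = y\<^sup>i \<partial>\<^sub>i - 2 G\<^sup>i \<partial>/\<partial>y\<^sup>i\<close>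
for the geodesic vector field, \<open>\<nabla> = |\<^sub>0\<close> for the covariant derivative along it, \<open>R\<^sup>i\<^sub>k\<close> for the Jacobi
endomorphism (\<open>Ric = R\<^sup>i\<^sub>i\<close>) and \<open>V = \<nabla>R\<close>. On every slit tangent space use the density \<open>\<mu> = |det g|\<close> and
the corresponding divergence \<open>Div W = \<mu>\<^sup>-\<^sup>1 \<partial>(\<mu> W\<^sup>a)/\<partial>y\<^sup>a\<close>. With respect to this density the fields
\<open>g\<^sup>a\<^sup>b\<close> (for fixed \<open>b\<close>) are divergence free, because the Cartan tensor is symmetric.

Two identities hold for every Finsler metric. The first is a contracted Bianchi identity: with
\<open>T = \<nabla>\<nabla>P + R P\<close>, the Jacobi operator applied to the mean Landsberg tensor,
\<open>Div V\<^sub>k + 2 T\<^sub>k + \<nabla>(Ric\<^sub>\<cdot>\<^sub>k) - Ric\<^sub>|\<^sub>k = 0\<close>  (\<open>weighted_identity\<close>).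
It follows from the Bianchi identity of the spray and from \<open>P = \<nabla>I\<close>, where \<open>I\<^sub>k = (1/2) (ln \<mu>)\<^sub>\<cdot>\<^sub>k\<close> is the
mean Cartan tensor.
The second says that the expression in the hypothesis is a vertical divergence,
\<open>g\<^sup>i\<^sup>j (P\<^sub>i\<^sub>|\<^sub>j\<^sub>|\<^sub>0 - 2 P\<^sub>i P\<^sub>j\<^sub>|\<^sub>0 + P\<^sub>i\<^sub>|\<^sub>0\<^sub>\<cdot>\<^sub>j\<^sub>|\<^sub>0) = g\<^sup>i\<^sup>j T\<^sub>i\<^sub>\<cdot>\<^sub>j\<close>  (\<open>jacobi_P_divergence\<close>).
If it vanishes then \<open>T\<^sub>k = Div (y\<^sub>k T\<^sup>#)\<close>, since \<open>y\<^sub>k\<^sub>\<cdot>\<^sub>a = g\<^sub>k\<^sub>a\<close>.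

For \<open>Ric = \<rho> E\<close> the two identities combine to \<open>Div Z\<^sub>k = E \<rho>\<^sub>k - 2 (y\<^sup>j \<rho>\<^sub>j) y\<^sub>k\<close> with
\<open>Z\<^sub>k = V\<^sub>k + 2 y\<^sub>k T\<^sup>#\<close> tangent to the level sets of \<open>E\<close>, and a direct computation gives
\<open>Div Y\<^sub>k = (2 - n) \<rho>\<^sub>k\<close> for \<open>Y\<^sub>k\<^sup>a = 2 y\<^sub>k g\<^sup>a\<^sup>b \<rho>\<^sub>b - \<rho>\<^sub>k y\<^sup>a\<close>, whose derivative of \<open>E\<close> is
\<open>Y\<^sub>k E = - 2 Div Z\<^sub>k\<close>. Let \<open>\<phi>\<close> be a nonnegative bump function supported in \<open>[1, 2]\<close>. The divergence of
\<open>2 \<phi>'(E) Z\<^sub>k + \<phi>(E) Y\<^sub>k\<close> is \<open>(2 - n) \<rho>\<^sub>k \<phi>(E)\<close>. Its integral over the tangent space against \<open>\<mu>\<close>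
vanishes, while \<open>\<phi>(E) \<mu>\<close> has positive integral; hence \<open>\<rho>\<^sub>k = 0\<close> when \<open>n \<ge> 3\<close> (\<open>dx_\<rho>_0\<close>, \<open>local_schur\<close>).
So \<open>\<rho>\<close> is locally constant, and constant because \<open>M\<close> is connected.\<close>

section \<open>Calculus of smooth functions on open sets\<close>

lemma Ck_on_cong:
  assumes "open S" "\<And>x. x \<in> S \<Longrightarrow> f x = g x"
  shows "Ck_on k S f \<longleftrightarrow> Ck_on k S g"
  using assms(2)
proof (induction k arbitrary: f g)
  case 0
  then show ?case by (simp cong: continuous_on_cong)
next
  case (Suc k)
  have fr: "f differentiable (at x) \<longleftrightarrow> g differentiable (at x)"
    "f differentiable (at x) \<Longrightarrow> frechet_derivative f (at x) = frechet_derivative g (at x)"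
    if "x \<in> S" for x
  proof -
    show "f differentiable (at x) \<longleftrightarrow> g differentiable (at x)"
      unfolding differentiable_def
      using that Suc.prems assms(1) has_derivative_transform_within_open[of _ _ x UNIV S] by metis
    show "frechet_derivative f (at x) = frechet_derivative g (at x)" if "f differentiable (at x)"
      by (rule frechet_derivative_transform_within_open[OF that assms(1) \<open>x \<in> S\<close>])
        (use Suc.prems in auto)
  qed
  show ?case
  proof (cases "\<forall>x\<in>S. f differentiable (at x)")
    case True
    then have "Ck_on k S (\<lambda>x. frechet_derivative f (at x) v) \<longleftrightarrow>
        Ck_on k S (\<lambda>x. frechet_derivative g (at x) v)" for v
      by (intro Suc.IH) (use fr in auto)
    then show ?thesis using fr by auto
  next
    case False
    then show ?thesis using fr by auto
  qed
qed

lemma smooth_on_cong: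
  assumes "open S" "\<And>x. x \<in> S \<Longrightarrow> f x = g x"
  shows "smooth_on S f \<longleftrightarrow> smooth_on S g"
  using Ck_on_cong[OF assms] by (auto simp: smooth_on_def)

lemma Ck_on_Suc_imp: "Ck_on (Suc k) S f \<Longrightarrow> Ck_on k S f"
proof (induction k arbitrary: f)
  case 0
  then show ?case
    by (auto intro!: continuous_at_imp_continuous_on differentiable_imp_continuous_within)
qed auto

lemma smooth_on_differentiable: "smooth_on S f \<Longrightarrow> x \<in> S \<Longrightarrow> f differentiable (at x)"
  unfolding smooth_on_def by (meson Ck_on.simps(2))

lemma smooth_on_deriv: "smooth_on S f \<Longrightarrow> smooth_on S (\<lambda>x. frechet_derivative f (at x) v)"
  unfolding smooth_on_def using Ck_on.simps(2) by blast

lemma smooth_on_continuous_on: "smooth_on S f \<Longrightarrow> continuous_on S f"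
  unfolding smooth_on_def by (meson Ck_on.simps(1))

lemma frechet_derivative_eqI: "(f has_derivative f') (at x) \<Longrightarrow> frechet_derivative f (at x) v = f' v"
  using frechet_derivative_at by metis

lemma has_derivative_frechet:
  "f differentiable (at x) \<Longrightarrow> (f has_derivative frechet_derivative f (at x)) (at x)"
  by (simp add: frechet_derivative_works)

lemma fderiv_add:
  assumes "f differentiable (at x)" "g differentiable (at x)"
  shows "frechet_derivative (\<lambda>x. f x + g x) (at x) v =
    frechet_derivative f (at x) v + frechet_derivative g (at x) v"
  by (rule frechet_derivative_eqI[OF has_derivative_add[OF assms[THEN has_derivative_frechet]]])

lemma fderiv_diff:
  assumes "f differentiable (at x)" "g differentiable (at x)"
  shows "frechet_derivative (\<lambda>x. f x - g x) (at x) v =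
    frechet_derivative f (at x) v - frechet_derivative g (at x) v"
  by (rule frechet_derivative_eqI[OF has_derivative_diff[OF assms[THEN has_derivative_frechet]]])

lemma fderiv_minus:
  assumes "f differentiable (at x)"
  shows "frechet_derivative (\<lambda>x. - f x) (at x) v = - frechet_derivative f (at x) v"
  by (rule frechet_derivative_eqI[OF has_derivative_minus[OF assms[THEN has_derivative_frechet]]])

lemma fderiv_mult:
  fixes f g :: "'a::real_normed_vector \<Rightarrow> real"
  assumes "f differentiable (at x)" "g differentiable (at x)"
  shows "frechet_derivative (\<lambda>x. f x * g x) (at x) v =
    frechet_derivative f (at x) v * g x + f x * frechet_derivative g (at x) v"
  using frechet_derivative_eqI[OF has_derivative_mult[OF assms[THEN has_derivative_frechet]], of v]
  by simp

lemma fderiv_sum: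
  assumes "\<And>i. i \<in> I \<Longrightarrow> f i differentiable (at x)"
  shows "frechet_derivative (\<lambda>x. \<Sum>i\<in>I. f i x) (at x) v = (\<Sum>i\<in>I. frechet_derivative (f i) (at x) v)"
  by (rule frechet_derivative_eqI[OF has_derivative_sum]) (rule has_derivative_frechet[OF assms])

lemma fderiv_inverse:
  fixes f :: "'a::real_normed_vector \<Rightarrow> real"
  assumes "f differentiable (at x)" "f x \<noteq> 0"
  shows "frechet_derivative (\<lambda>x. inverse (f x)) (at x) v =
    - (inverse (f x) * inverse (f x) * frechet_derivative f (at x) v)"
  using frechet_derivative_eqI[OF Deriv.has_derivative_inverse[OF assms(2) has_derivative_frechet[OF assms(1)]], of v]
  by (simp add: ac_simps)

lemma fderiv_ln:
  fixes f :: "'a::real_normed_vector \<Rightarrow> real"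
  assumes "f differentiable (at x)" "f x > 0"
  shows "frechet_derivative (\<lambda>x. ln (f x)) (at x) v = inverse (f x) * frechet_derivative f (at x) v"
  using frechet_derivative_eqI[OF has_derivative_ln[OF assms(2) has_derivative_frechet[OF assms(1)]], of v]
  by (simp add: field_simps)

lemma fderiv_exp:
  fixes f :: "'a::real_normed_vector \<Rightarrow> real"
  assumes "f differentiable (at x)"
  shows "frechet_derivative (\<lambda>x. exp (f x)) (at x) v = exp (f x) * frechet_derivative f (at x) v"
  using frechet_derivative_eqI[OF has_derivative_exp[OF has_derivative_frechet[OF assms(1)]], of v]
  by (simp add: field_simps)

lemma fderiv_bounded_linear:
  assumes "bounded_linear f"
  shows "frechet_derivative f (at x) v = f v"
  using assms by (intro frechet_derivative_eqI) (rule bounded_linear_imp_has_derivative)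

lemma fderiv_linear: "f differentiable (at x) \<Longrightarrow> linear (frechet_derivative f (at x))"
  by (rule linear_frechet_derivative)

lemma Ck_on_const: "Ck_on k S (\<lambda>x. c)"
  by (induction k arbitrary: c) auto

lemma smooth_on_const: "smooth_on S (\<lambda>x. c)"
  by (simp add: smooth_on_def Ck_on_const)

lemma smooth_on_bounded_linear:
  assumes "bounded_linear f"
  shows "smooth_on S f"
  unfolding smooth_on_def
proof
  fix k show "Ck_on k S f"
    using assms
    by (cases k) (auto simp: fderiv_bounded_linear Ck_on_const linear_continuous_on
        intro: bounded_linear_imp_differentiable)
qed

lemma Ck_on_add:
  assumes "open S" shows "Ck_on k S f \<Longrightarrow> Ck_on k S g \<Longrightarrow> Ck_on k S (\<lambda>x. f x + g x)"
proof (induction k arbitrary: f g)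
  case (Suc k)
  then have "Ck_on k S (\<lambda>x. frechet_derivative (\<lambda>x. f x + g x) (at x) v)" for v
    by (subst Ck_on_cong[OF assms fderiv_add]) auto
  with Suc.prems show ?case by auto
qed (auto intro: continuous_intros)

lemma Ck_on_mult:
  fixes f g :: "'a::euclidean_space \<Rightarrow> real"
  assumes "open S" shows "Ck_on k S f \<Longrightarrow> Ck_on k S g \<Longrightarrow> Ck_on k S (\<lambda>x. f x * g x)"
proof (induction k arbitrary: f g)
  case (Suc k)
  then have "Ck_on k S (\<lambda>x. frechet_derivative (\<lambda>x. f x * g x) (at x) v)" for v
    by (subst Ck_on_cong[OF assms fderiv_mult])
      (auto intro!: Ck_on_add[OF assms] Suc.IH simp: Ck_on_Suc_imp)
  with Suc.prems show ?case by auto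
qed (auto intro: continuous_intros)

lemma Ck_on_inverse:
  fixes f :: "'a::euclidean_space \<Rightarrow> real"
  assumes "open S" "\<And>x. x \<in> S \<Longrightarrow> f x \<noteq> 0"
  shows "Ck_on k S f \<Longrightarrow> Ck_on k S (\<lambda>x. inverse (f x))"
proof (induction k)
  case (Suc k)
  have 1: "Ck_on k S (\<lambda>x. inverse (f x))" using Suc Ck_on_Suc_imp by auto
  have "Ck_on k S (\<lambda>x. (-1) * (inverse (f x) * inverse (f x) * frechet_derivative f (at x) v))" for v
    using Suc.prems 1 by (intro Ck_on_mult[OF assms(1)] Ck_on_const) auto
  then have "Ck_on k S (\<lambda>x. frechet_derivative (\<lambda>x. inverse (f x)) (at x) v)" for v
    using Suc.prems assms(2) by (subst Ck_on_cong[OF assms(1) fderiv_inverse]) auto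
  with Suc.prems assms show ?case by auto
qed (use assms in \<open>auto intro: continuous_intros\<close>)

lemma smooth_on_add:
  "open S \<Longrightarrow> smooth_on S f \<Longrightarrow> smooth_on S g \<Longrightarrow> smooth_on S (\<lambda>x. f x + g x)"
  by (auto simp: smooth_on_def Ck_on_add)

lemma smooth_on_mult:
  fixes f g :: "'a::euclidean_space \<Rightarrow> real"
  shows "open S \<Longrightarrow> smooth_on S f \<Longrightarrow> smooth_on S g \<Longrightarrow> smooth_on S (\<lambda>x. f x * g x)"
  by (auto simp: smooth_on_def Ck_on_mult)

lemma smooth_on_inverse:
  fixes f :: "'a::euclidean_space \<Rightarrow> real"
  shows "open S \<Longrightarrow> smooth_on S f \<Longrightarrow> (\<And>x. x \<in> S \<Longrightarrow> f x \<noteq> 0) \<Longrightarrow> smooth_on S (\<lambda>x. inverse (f x))"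
  by (auto simp: smooth_on_def Ck_on_inverse)

lemma smooth_on_minus:
  fixes f :: "'a::euclidean_space \<Rightarrow> real"
  shows "open S \<Longrightarrow> smooth_on S f \<Longrightarrow> smooth_on S (\<lambda>x. - f x)"
  using smooth_on_mult[OF _ smooth_on_const[of S "-1"]] by fastforce

lemma smooth_on_diff:
  fixes f :: "'a::euclidean_space \<Rightarrow> real"
  shows "open S \<Longrightarrow> smooth_on S f \<Longrightarrow> smooth_on S g \<Longrightarrow> smooth_on S (\<lambda>x. f x - g x)"
  using smooth_on_add[OF _ _ smooth_on_minus, of S f g] by fastforce

lemma smooth_on_power:
  fixes f :: "'a::euclidean_space \<Rightarrow> real"
  shows "open S \<Longrightarrow> smooth_on S f \<Longrightarrow> smooth_on S (\<lambda>x. f x ^ n)"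
  by (induction n) (auto intro: smooth_on_const smooth_on_mult)

lemma smooth_on_sum:
  "open S \<Longrightarrow> (\<And>i. i \<in> I \<Longrightarrow> smooth_on S (f i)) \<Longrightarrow> smooth_on S (\<lambda>x. \<Sum>i\<in>I. f i x)"
  by (induction I rule: infinite_finite_induct) (auto intro: smooth_on_const smooth_on_add)

lemma smooth_on_prod:
  fixes f :: "'i \<Rightarrow> 'a::euclidean_space \<Rightarrow> real"
  shows "open S \<Longrightarrow> (\<And>i. i \<in> I \<Longrightarrow> smooth_on S (f i)) \<Longrightarrow> smooth_on S (\<lambda>x. \<Prod>i\<in>I. f i x)"
  by (induction I rule: infinite_finite_induct) (auto intro: smooth_on_const smooth_on_mult)

lemma smooth_onI_deriv:
  assumes "open S" "\<And>x. x \<in> S \<Longrightarrow> f differentiable (at x)"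
    and "\<And>v. smooth_on S (\<lambda>x. frechet_derivative f (at x) v)"
  shows "smooth_on S f"
  unfolding smooth_on_def
proof
  fix k
  have "Ck_on (Suc k) S f" using assms by (auto simp: smooth_on_def)
  then show "Ck_on k S f" by (rule Ck_on_Suc_imp)
qed

lemma smooth_on_ln:
  fixes f :: "'a::euclidean_space \<Rightarrow> real"
  assumes "open S" "smooth_on S f" "\<And>x. x \<in> S \<Longrightarrow> f x > 0"
  shows "smooth_on S (\<lambda>x. ln (f x))"
proof (rule smooth_onI_deriv)
  note d = smooth_on_differentiable[OF assms(2)]
  show "(\<lambda>x. ln (f x)) differentiable (at x)" if "x \<in> S" for x
    using d[OF that] assms(3)[OF that]
    unfolding differentiable_def by (blast intro: has_derivative_ln)
  have "smooth_on S (\<lambda>x. inverse (f x) * frechet_derivative f (at x) v)" for v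
    using assms by (intro smooth_on_mult smooth_on_inverse smooth_on_deriv) force+
  then show "smooth_on S (\<lambda>x. frechet_derivative (\<lambda>x. ln (f x)) (at x) v)" for v
    by (subst smooth_on_cong[OF assms(1) fderiv_ln]) (use d assms in auto)
qed fact

lemma smooth_on_exp:
  fixes f :: "'a::euclidean_space \<Rightarrow> real"
  assumes "open S" "smooth_on S f"
  shows "smooth_on S (\<lambda>x. exp (f x))"
proof -
  note d = smooth_on_differentiable[OF assms(2)]
  have de: "(\<lambda>x. exp (f x)) differentiable (at x)" if "x \<in> S" for x
    using d[OF that] unfolding differentiable_def by (blast intro: has_derivative_exp)
  have "Ck_on k S (\<lambda>x. exp (f x))" for k
  proof (induction k)
    case 0
    show ?case using smooth_on_continuous_on[OF assms(2)] by (auto intro: continuous_intros)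
  next
    case (Suc k)
    have "Ck_on k S (\<lambda>x. exp (f x) * frechet_derivative f (at x) v)" for v
      using Suc smooth_on_deriv[OF assms(2)] by (intro Ck_on_mult[OF assms(1)]) (auto simp: smooth_on_def)
    then have "Ck_on k S (\<lambda>x. frechet_derivative (\<lambda>x. exp (f x)) (at x) v)" for v
      by (subst Ck_on_cong[OF assms(1) fderiv_exp]) (use d in auto)
    then show ?case using de by auto
  qed
  then show ?thesis by (simp add: smooth_on_def)
qed

text \<open>Mixed second derivatives commute: both are limits of the same second difference quotient,
  which equals, by the mean value theorem applied twice, either mixed derivative at a nearby point.\<close>

lemma second_difference_mvt:
  fixes f :: "'a::euclidean_space \<Rightarrow> real"
  assumes S: "open S" "smooth_on S f" and t: "t > 0"
    and para: "\<And>a b. 0 \<le> a \<Longrightarrow> a \<le> t \<Longrightarrow> 0 \<le> b \<Longrightarrow> b \<le> t \<Longrightarrow> z + a *\<^sub>R u + b *\<^sub>R v \<in> S"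
  shows "\<exists>a b. 0 \<le> a \<and> a \<le> t \<and> 0 \<le> b \<and> b \<le> t \<and>
    f (z + t *\<^sub>R u + t *\<^sub>R v) - f (z + t *\<^sub>R u) - f (z + t *\<^sub>R v) + f z =
    t * t * frechet_derivative (\<lambda>x. frechet_derivative f (at x) u) (at (z + a *\<^sub>R u + b *\<^sub>R v)) v"
proof -
  have lin: "((\<lambda>s. h (c + s *\<^sub>R w)) has_field_derivative frechet_derivative h (at (c + s *\<^sub>R w)) w) (at s)"
    if "smooth_on S h" "c + s *\<^sub>R w \<in> S" for h :: "'a \<Rightarrow> real" and c w s
  proof -
    have 1: "(h has_derivative frechet_derivative h (at (c + s *\<^sub>R w))) (at (c + s *\<^sub>R w))"
      using smooth_on_differentiable[OF that] by (simp add: frechet_derivative_works)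
    have "((\<lambda>s. h (c + s *\<^sub>R w)) has_derivative (\<lambda>r. frechet_derivative h (at (c + s *\<^sub>R w)) (r *\<^sub>R w))) (at s)"
      by (rule has_derivative_compose[of "\<lambda>s. c + s *\<^sub>R w" "\<lambda>r. r *\<^sub>R w" s UNIV h, OF _ 1])
        (auto intro!: derivative_eq_intros)
    moreover have "frechet_derivative h (at (c + s *\<^sub>R w)) (r *\<^sub>R w) = r * frechet_derivative h (at (c + s *\<^sub>R w)) w" for r
      using fderiv_linear[OF smooth_on_differentiable[OF that]] by (simp add: linear_cmul)
    ultimately show ?thesis by (simp add: has_field_derivative_def mult.commute[of _ "frechet_derivative h _ _"])
  qed
  let ?g = "\<lambda>s. f ((z + t *\<^sub>R v) + s *\<^sub>R u) - f (z + s *\<^sub>R u)"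
  let ?g' = "\<lambda>s. frechet_derivative f (at ((z + t *\<^sub>R v) + s *\<^sub>R u)) u - frechet_derivative f (at (z + s *\<^sub>R u)) u"
  have "(?g has_real_derivative ?g' s) (at s)" if "0 \<le> s" "s \<le> t" for s
    using para[of s t] para[of s 0] that t
    by (intro DERIV_diff lin S) (auto simp: algebra_simps)
  then obtain a where a: "0 < a" "a < t" "?g t - ?g 0 = (t - 0) * ?g' a"
    using MVT2[of 0 t ?g ?g'] t by blast
  let ?h = "\<lambda>s. frechet_derivative f (at ((z + a *\<^sub>R u) + s *\<^sub>R v)) u"
  let ?h' = "\<lambda>s. frechet_derivative (\<lambda>x. frechet_derivative f (at x) u) (at ((z + a *\<^sub>R u) + s *\<^sub>R v)) v"
  have "(?h has_real_derivative ?h' s) (at s)" if "0 \<le> s" "s \<le> t" for s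
    using para[of a s] that t a
    by (intro lin[where h = "\<lambda>x. frechet_derivative f (at x) u"] smooth_on_deriv S) auto
  then obtain b where b: "0 < b" "b < t" "?h t - ?h 0 = (t - 0) * ?h' b"
    using MVT2[of 0 t ?h ?h'] t by blast
  have "?g' a = ?h t - ?h 0" by (simp add: algebra_simps)
  with a b show ?thesis
    by (intro exI[of _ a] exI[of _ b]) (auto simp: algebra_simps)
qed

lemma fderiv_commute:
  fixes f :: "'a::euclidean_space \<Rightarrow> real"
  assumes S: "open S" "smooth_on S f" "z \<in> S"
  shows "frechet_derivative (\<lambda>x. frechet_derivative f (at x) u) (at z) v =
    frechet_derivative (\<lambda>x. frechet_derivative f (at x) v) (at z) u" (is "?A u v z = ?A v u z")
proof (rule ccontr)
  assume neq: "?A u v z \<noteq> ?A v u z"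
  define e where "e = \<bar>?A u v z - ?A v u z\<bar> / 2"
  have e: "e > 0" using neq by (simp add: e_def)
  have cont: "isCont (?A u v) z" for u v
    using smooth_on_continuous_on[OF smooth_on_deriv[OF smooth_on_deriv[OF S(2)]]] S
    by (simp add: continuous_on_eq_continuous_at)
  obtain r where r: "r > 0" "ball z r \<subseteq> S" using S open_contains_ball by blast
  have "\<forall>\<^sub>F x in nhds z. x \<in> S \<and> dist (?A u v x) (?A u v z) < e \<and> dist (?A v u x) (?A v u z) < e"
  proof (intro eventually_conj)
    show "\<forall>\<^sub>F x in nhds z. x \<in> S" using S by (intro eventually_nhds_in_open) auto
    have *: "\<forall>\<^sub>F x in nhds z. dist (?A u v x) (?A u v z) < e" for u v
      using tendstoD[OF cont[of u v, unfolded isCont_def] e] e by (simp add: eventually_nhds_conv_at)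
    show "\<forall>\<^sub>F x in nhds z. dist (?A u v x) (?A u v z) < e" "\<forall>\<^sub>F x in nhds z. dist (?A v u x) (?A v u z) < e"
      by (rule *)+
  qed
  then obtain d where d: "d > 0" "\<And>x. dist x z < d \<Longrightarrow> x \<in> S \<and> dist (?A u v x) (?A u v z) < e \<and> dist (?A v u x) (?A v u z) < e"
    unfolding eventually_nhds_metric by blast
  define t where "t = d / (2 * (norm u + norm v + 1))"
  have t: "t > 0" using d by (simp add: t_def add_nonneg_pos)
  have near: "dist (z + a *\<^sub>R u + b *\<^sub>R v) z < d" if "0 \<le> a" "a \<le> t" "0 \<le> b" "b \<le> t" for a b
  proof -
    have "dist (z + a *\<^sub>R u + b *\<^sub>R v) z = norm (a *\<^sub>R u + b *\<^sub>R v)" by (simp add: dist_norm)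
    also have "\<dots> \<le> a * norm u + b * norm v" using norm_triangle_ineq[of "a *\<^sub>R u" "b *\<^sub>R v"] that by simp
    also have "\<dots> \<le> t * norm u + t * norm v" using that by (intro add_mono mult_right_mono) auto
    also have "\<dots> < t * (2 * (norm u + norm v + 1))"
      using t by (simp add: algebra_simps) (smt (verit) mult_nonneg_nonneg norm_ge_zero)
    also have "\<dots> = d" by (simp add: t_def add_nonneg_pos) (smt (verit) norm_ge_zero)
    finally show ?thesis .
  qed
  obtain a b where ab: "0 \<le> a" "a \<le> t" "0 \<le> b" "b \<le> t"
    "f (z + t *\<^sub>R u + t *\<^sub>R v) - f (z + t *\<^sub>R u) - f (z + t *\<^sub>R v) + f z = t * t * ?A u v (z + a *\<^sub>R u + b *\<^sub>R v)"
    using second_difference_mvt[OF S(1,2) t, of z u v] near d(2) by blast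
  have near': "dist (z + a *\<^sub>R v + b *\<^sub>R u) z < d" if "0 \<le> a" "a \<le> t" "0 \<le> b" "b \<le> t" for a b
    using near[of b a] that by (simp add: algebra_simps)
  obtain a' b' where ab': "0 \<le> a'" "a' \<le> t" "0 \<le> b'" "b' \<le> t"
    "f (z + t *\<^sub>R v + t *\<^sub>R u) - f (z + t *\<^sub>R v) - f (z + t *\<^sub>R u) + f z = t * t * ?A v u (z + a' *\<^sub>R v + b' *\<^sub>R u)"
    using second_difference_mvt[OF S(1,2) t, of z v u] near' d(2) by blast
  have "t * t * ?A u v (z + a *\<^sub>R u + b *\<^sub>R v) = t * t * ?A v u (z + a' *\<^sub>R v + b' *\<^sub>R u)"
  proof -
    have c: "z + t *\<^sub>R v + t *\<^sub>R u = z + t *\<^sub>R u + t *\<^sub>R v" by (simp add: add_ac)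
    show ?thesis using ab(5) ab'(5) unfolding c by linarith
  qed
  then have "?A u v (z + a *\<^sub>R u + b *\<^sub>R v) = ?A v u (z + a' *\<^sub>R v + b' *\<^sub>R u)" using t by simp
  moreover have "dist (?A u v (z + a *\<^sub>R u + b *\<^sub>R v)) (?A u v z) < e" using d(2) near ab by blast
  moreover have "dist (?A v u (z + a' *\<^sub>R v + b' *\<^sub>R u)) (?A v u z) < e" using d(2) near' ab' by blast
  ultimately show False unfolding e_def dist_real_def by argo
qed

section \<open>The derivative of the determinant\<close>

lemma matrix_inv_mult:
  fixes A :: "real^'n^'n"
  assumes "det A \<noteq> 0"
  shows "A ** matrix_inv A = mat 1" and "matrix_inv A ** A = mat 1"
proof -
  have "\<exists>B. A ** B = mat 1 \<and> B ** A = mat 1"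
    using assms invertible_det_nz invertible_def by blast
  then have "A ** matrix_inv A = mat 1 \<and> matrix_inv A ** A = mat 1"
    unfolding matrix_inv_def by (rule someI_ex)
  then show "A ** matrix_inv A = mat 1" and "matrix_inv A ** A = mat 1" by auto
qed

text \<open>Row \<open>i\<close> of the new matrix is \<open>h\<close>, and \<open>h A\<^sup>-\<^sup>1\<close> lists the coefficients of \<open>h\<close> in terms of the rows of
\<open>A\<close>. By multilinearity only the coefficient of row \<open>i\<close> itself survives (Cramer's rule).\<close>

lemma det_replace_row:
  fixes A :: "real^'n^'n"
  assumes "det A \<noteq> 0"
  shows "det (\<chi> k l. if k = i then h l else A$k$l) = det A * (\<Sum>j\<in>UNIV. matrix_inv A $ j $ i * h j)"
proof -
  have "matrix_inv A ** A = mat 1"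
    by (rule matrix_inv_mult[OF assms])
  then have inv: "(\<Sum>k\<in>UNIV. matrix_inv A $ j $ k * A $ k $ l) = (if j = l then 1 else 0)" for j l
    by (auto simp: matrix_matrix_mult_def mat_def vec_eq_iff)
  define x where "x = (\<chi> k. \<Sum>j\<in>UNIV. h j * matrix_inv A $ j $ k)"
  have "(\<Sum>k\<in>UNIV. x $ k * A $ k $ l) = (\<Sum>j\<in>UNIV. h j * (\<Sum>k\<in>UNIV. matrix_inv A $ j $ k * A $ k $ l))" for l
    by (simp add: x_def sum_distrib_left sum_distrib_right mult.assoc) (rule sum.swap)
  then have "(\<Sum>k\<in>UNIV. x $ k * A $ k $ l) = h l" for l
    by (simp add: inv mult_delta_right)
  then have "(\<chi> k. if k = i then \<Sum>m\<in>UNIV. x $ m *s row m A else row k A) =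
      (\<chi> k l. if k = i then h l else A$k$l)"
    by (auto simp: vec_eq_iff row_def)
  with cramer_lemma_transpose[of i x A] show ?thesis
    by (simp add: x_def mult.commute)
qed

text \<open>Jacobi's formula \<open>d det a = det a \<cdot> tr (a\<^sup>-\<^sup>1 da)\<close>. The product rule replaces one row at a time by its
derivative, and each of the resulting determinants is known from \<open>det_replace_row\<close>.\<close>

lemma fderiv_det:
  fixes a :: "'n::finite \<Rightarrow> 'n \<Rightarrow> 'a::real_normed_vector \<Rightarrow> real"
  assumes d: "\<And>i j. a i j differentiable (at z)"
    and nz: "det (\<chi> i j. a i j z) \<noteq> 0"
  shows "(\<lambda>w. det (\<chi> i j. a i j w)) differentiable (at z)"
    and "frechet_derivative (\<lambda>w. det (\<chi> i j. a i j w)) (at z) v = det (\<chi> i j. a i j z) *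
      (\<Sum>i\<in>UNIV. \<Sum>j\<in>UNIV. matrix_inv (\<chi> i j. a i j z) $ i $ j * frechet_derivative (a j i) (at z) v)"
proof -
  let ?D = "\<lambda>i j. frechet_derivative (a i j) (at z)"
  let ?P = "{p. p permutes (UNIV :: 'n set)}"
  let ?A = "\<chi> i j. a i j z"
  have "((\<lambda>w. \<Sum>p\<in>?P. of_int (sign p) * (\<Prod>i\<in>UNIV. a i (p i) w)) has_derivative
     (\<lambda>v. \<Sum>p\<in>?P. of_int (sign p) * (\<Sum>i\<in>UNIV. ?D i (p i) v * (\<Prod>j\<in>UNIV - {i}. a j (p j) z)))) (at z)"
    by (intro has_derivative_sum has_derivative_mult_right has_derivative_prod has_derivative_frechet d)
  then have *: "((\<lambda>w. det (\<chi> i j. a i j w)) has_derivative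
     (\<lambda>v. \<Sum>p\<in>?P. of_int (sign p) * (\<Sum>i\<in>UNIV. ?D i (p i) v * (\<Prod>j\<in>UNIV - {i}. a j (p j) z)))) (at z)"
    by (simp add: det_def)
  then show "(\<lambda>w. det (\<chi> i j. a i j w)) differentiable (at z)" by (rule differentiableI)
  have "frechet_derivative (\<lambda>w. det (\<chi> i j. a i j w)) (at z) v =
     (\<Sum>p\<in>?P. of_int (sign p) * (\<Sum>i\<in>UNIV. ?D i (p i) v * (\<Prod>j\<in>UNIV - {i}. a j (p j) z)))"
    by (rule frechet_derivative_eqI[OF *])
  also have "\<dots> = (\<Sum>i\<in>UNIV. \<Sum>p\<in>?P. of_int (sign p) * (?D i (p i) v * (\<Prod>j\<in>UNIV - {i}. a j (p j) z)))"
    unfolding sum_distrib_left by (rule sum.swap)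
  also have "\<dots> = (\<Sum>i\<in>UNIV. det (\<chi> k l. if k = i then ?D i l v else ?A $ k $ l))"
  proof (rule sum.cong[OF refl])
    fix i
    show "(\<Sum>p\<in>?P. of_int (sign p) * (?D i (p i) v * (\<Prod>j\<in>UNIV - {i}. a j (p j) z))) =
       det (\<chi> k l. if k = i then ?D i l v else ?A $ k $ l)"
      unfolding det_def by (intro sum.cong refl) (subst prod.remove[of UNIV i], auto)
  qed
  also have "\<dots> = (\<Sum>i\<in>UNIV. det ?A * (\<Sum>j\<in>UNIV. matrix_inv ?A $ j $ i * ?D i j v))"
    by (intro sum.cong refl det_replace_row nz)
  also have "\<dots> = det ?A * (\<Sum>i\<in>UNIV. \<Sum>j\<in>UNIV. matrix_inv ?A $ i $ j * ?D j i v)"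
    unfolding sum_distrib_left by (rule sum.swap)
  finally show "frechet_derivative (\<lambda>w. det (\<chi> i j. a i j w)) (at z) v = det ?A *
      (\<Sum>i\<in>UNIV. \<Sum>j\<in>UNIV. matrix_inv ?A $ i $ j * ?D j i v)" .
qed

lemma smooth_on_det:
  fixes a :: "'n::finite \<Rightarrow> 'n \<Rightarrow> 'a::euclidean_space \<Rightarrow> real"
  assumes "open S" "\<And>i j. smooth_on S (a i j)"
  shows "smooth_on S (\<lambda>z. det (\<chi> i j. a i j z))"
  unfolding det_def
  by (simp, intro smooth_on_sum smooth_on_mult smooth_on_prod smooth_on_const assms)

text \<open>The entries of the inverse are quotients of determinants by Cramer's rule: entry \<open>(i, j)\<close> arises when
row \<open>j\<close> is replaced by the \<open>i\<close>-th unit vector.\<close>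

lemma smooth_on_matrix_inv:
  fixes a :: "'n::finite \<Rightarrow> 'n \<Rightarrow> 'a::euclidean_space \<Rightarrow> real"
  assumes S: "open S" "\<And>i j. smooth_on S (a i j)"
    and nz: "\<And>z. z \<in> S \<Longrightarrow> det (\<chi> i j. a i j z) \<noteq> 0"
  shows "smooth_on S (\<lambda>z. matrix_inv (\<chi> i j. a i j z) $ i $ j)"
proof -
  have eq: "matrix_inv (\<chi> i j. a i j z) $ i $ j =
    det (\<chi> k l. if k = j then (if l = i then 1 else 0) else a k l z) * inverse (det (\<chi> i j. a i j z))"
    if "z \<in> S" for z
  proof -
    have "det (\<chi> k l. if k = j then (if l = i then 1 else 0) else a k l z) =
      det (\<chi> i j. a i j z) * (\<Sum>m\<in>UNIV. matrix_inv (\<chi> i j. a i j z) $ m $ j * (if m = i then 1 else 0))"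
      using det_replace_row[OF nz[OF that], of j "\<lambda>l. if l = i then 1 else 0"]
      by (simp only: vec_lambda_beta)
    also have "(\<Sum>m\<in>UNIV. matrix_inv (\<chi> i j. a i j z) $ m $ j * (if m = i then 1 else 0)) =
        matrix_inv (\<chi> i j. a i j z) $ i $ j"
      by (subst sum.remove[of UNIV i]) auto
    finally show ?thesis using nz[OF that] by simp
  qed
  have "smooth_on S (\<lambda>z. if k = j then (if l = i then 1 else 0) else a k l z)" for k l
    using assms(2) by (cases "k = j") (auto intro: smooth_on_const)
  then have "smooth_on S (\<lambda>z. det (\<chi> k l. if k = j then (if l = i then 1 else 0) else a k l z) *
      inverse (det (\<chi> i j. a i j z)))"
    by (intro smooth_on_mult smooth_on_inverse smooth_on_det S nz)
  then show ?thesis by (subst smooth_on_cong[OF S(1) eq])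
qed


section \<open>Integrals of directional derivatives\<close>

lemma has_integral_on_support:
  fixes f :: "'a::euclidean_space \<Rightarrow> real"
  assumes "(f has_integral i) UNIV" and "\<And>x. x \<notin> B \<Longrightarrow> f x = 0"
  shows "(f has_integral i) B"
proof -
  have "(\<lambda>x. if x \<in> B then f x else 0) = f" using assms(2) by auto
  then show ?thesis using has_integral_restrict_UNIV[of B f i] assms(1) by simp
qed

lemma has_integral_translate:
  fixes f :: "'a::euclidean_space \<Rightarrow> real"
  assumes "(f has_integral i) UNIV" and supp: "\<And>x. x \<notin> cbox a b \<Longrightarrow> f x = 0"
  shows "((\<lambda>x. f (x + w)) has_integral i) UNIV"
proof -
  have "(f has_integral i) (cbox a b)"
    by (rule has_integral_on_support[OF assms])
  from has_integral_affinity[OF this, of 1 w]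
  have "((\<lambda>x. f (x + w)) has_integral i) ((\<lambda>x. x - w) ` cbox a b)" by simp
  then show ?thesis
  proof (rule has_integral_on_superset)
    fix x assume "x \<notin> (\<lambda>x. x - w) ` cbox a b"
    then have "x + w \<notin> cbox a b" by (metis add_diff_cancel image_eqI)
    then show "f (x + w) = 0" by (rule supp)
  qed auto
qed

text \<open>By translation invariance \<open>\<integral> f (x + t v) dx\<close> does not depend on \<open>t\<close>; its derivative at \<open>t = 0\<close> is the
integral of the directional derivative. All functions involved vanish outside a fixed box as long as
\<open>|t| \<le> 1\<close>, so that differentiation under the integral sign is legitimate.\<close>

lemma has_integral_directional_derivative_0:
  fixes f :: "'a::euclidean_space \<Rightarrow> real"
  assumes der: "\<And>x. (f has_derivative f' x) (at x)"
    and cont: "continuous_on UNIV (\<lambda>x. f' x v)"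
    and supp: "\<And>x. norm x > r \<Longrightarrow> f x = 0"
  shows "((\<lambda>x. f' x v) has_integral 0) UNIV"
proof -
  obtain c :: 'a where c: "cball 0 (\<bar>r\<bar> + norm v) \<subseteq> cbox (-c) c"
    using bounded_subset_cbox_symmetric[OF bounded_cball] by blast
  let ?B = "cbox (-c) c"
  have far: "norm x > \<bar>r\<bar> + norm v" if "x \<notin> ?B" for x
    using that c by (auto simp: subset_iff not_le[symmetric])
  have contf: "continuous_on A f" for A
    using der by (meson continuous_at_imp_continuous_on has_derivative_continuous)
  have supp_B: "f (x + t *\<^sub>R v) = 0" if "x \<notin> ?B" "\<bar>t\<bar> \<le> 1" for x t
  proof (rule supp)
    have "norm x \<le> norm (x + t *\<^sub>R v) + norm (t *\<^sub>R v)"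
      using norm_triangle_ineq4[of "x + t *\<^sub>R v" "t *\<^sub>R v"] by simp
    moreover have "norm (t *\<^sub>R v) \<le> norm v" using that(2) by (simp add: mult_left_le_one_le)
    ultimately show "r < norm (x + t *\<^sub>R v)" using far[OF that(1)] by linarith
  qed
  obtain i where i: "(f has_integral i) ?B"
    using integrable_continuous[OF contf] by blast
  have iU: "(f has_integral i) UNIV"
    using supp_B[of _ 0] by (intro has_integral_on_superset[OF i]) auto
  have const: "integral ?B (\<lambda>x. f (x + t *\<^sub>R v)) = i" if "\<bar>t\<bar> \<le> 1" for t
  proof -
    have "((\<lambda>x. f (x + t *\<^sub>R v)) has_integral i) UNIV"
      using has_integral_translate[OF iU, of "-c" c] supp_B[of _ 0] by simp
    then have "((\<lambda>x. f (x + t *\<^sub>R v)) has_integral i) ?B"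
      by (rule has_integral_on_support) (use supp_B that in auto)
    then show ?thesis by (rule integral_unique)
  qed
  have lin: "((\<lambda>t. f (x + t *\<^sub>R v)) has_field_derivative f' (x + t *\<^sub>R v) v) (at t within U)" for x t U
  proof -
    have "((\<lambda>t. f (x + t *\<^sub>R v)) has_derivative (\<lambda>s. f' (x + t *\<^sub>R v) (s *\<^sub>R v))) (at t within U)"
      by (rule has_derivative_compose[of "\<lambda>t. x + t *\<^sub>R v" "\<lambda>s. s *\<^sub>R v" t U f, OF _ der])
        (auto intro!: derivative_eq_intros)
    moreover have "linear (f' y)" for y using der has_derivative_linear by blast
    ultimately show ?thesis
      by (simp add: has_field_derivative_def linear_cmul mult.commute[of _ "f' _ _"])
  qed
  have "((\<lambda>t. integral ?B (\<lambda>x. f (x + t *\<^sub>R v))) has_field_derivative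
      integral ?B (\<lambda>x. f' (x + 0 *\<^sub>R v) v)) (at 0 within {-1..1})"
  proof (rule leibniz_rule_field_derivative)
    show "(\<lambda>x. f (x + t *\<^sub>R v)) integrable_on ?B" for t
      by (intro integrable_continuous continuous_on_compose2[OF contf[of UNIV]] continuous_intros) auto
    show "continuous_on ({-1..1} \<times> ?B) (\<lambda>(t, x). f' (x + t *\<^sub>R v) v)"
      unfolding split_beta
      by (intro continuous_on_compose2[OF cont] continuous_intros) auto
  qed (use lin in auto)
  then have 1: "((\<lambda>t. integral ?B (\<lambda>x. f (x + t *\<^sub>R v))) has_field_derivative
      integral ?B (\<lambda>x. f' x v)) (at 0)"
    by (simp add: at_within_Icc_at)
  have "((\<lambda>t. i) has_field_derivative integral ?B (\<lambda>x. f' x v)) (at 0)"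
    by (rule has_field_derivative_transform_within_open[OF 1, of "{-1<..<1}"]) (auto simp: const)
  then have "integral ?B (\<lambda>x. f' x v) = 0"
    using DERIV_unique DERIV_const by blast
  then have B0: "((\<lambda>x. f' x v) has_integral 0) ?B"
    using integrable_continuous[OF continuous_on_subset[OF cont]] by (metis integrable_integral subset_UNIV)
  show ?thesis
  proof (rule has_integral_on_superset[OF B0])
    fix x assume "x \<notin> ?B"
    then have zero: "f (x + t *\<^sub>R v) = 0" if "t \<in> {-1<..<1}" for t
      using supp_B[OF \<open>x \<notin> ?B\<close>, of t] that by (simp add: abs_le_iff)
    have "((\<lambda>t. 0) has_field_derivative f' (x + 0 *\<^sub>R v) v) (at 0)"
      by (rule has_field_derivative_transform_within_open[OF lin[of x 0 UNIV], of "{-1<..<1}" "\<lambda>_. 0"])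
        (simp_all only: zero open_greaterThanLessThan, simp)
    then have "f' (x + 0 *\<^sub>R v) v = 0" using DERIV_unique DERIV_const by blast
    then show "f' x v = 0" by simp
  qed auto
qed

section \<open>The calculus of a spray\<close>

text \<open>Here \<open>G\<close> is any family of spray coefficients, with nonlinear connection \<open>N\<^sup>a\<^sub>i = G\<^sup>a\<^sub>\<cdot>\<^sub>i\<close>: \<open>hder\<close> is the horizontal derivative
\<open>\<delta>\<^sub>i\<close> and \<open>sder\<close> is the vector field \<open>S = y\<^sup>i \<partial>\<^sub>i - 2 G\<^sup>i \<partial>/\<partial>y\<^sup>i\<close> whose trajectories are the lifted geodesics.\<close>

definition hder :: "('n \<Rightarrow> 'n::finite cfun) \<Rightarrow> 'n \<Rightarrow> 'n cfun \<Rightarrow> 'n cfun" where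
  "hder G i f z = dx i f z - (\<Sum>a\<in>UNIV. dy i (G a) z * dy a f z)"

definition sder :: "('n \<Rightarrow> 'n::finite cfun) \<Rightarrow> 'n cfun \<Rightarrow> 'n cfun" where
  "sder G f z = (\<Sum>i\<in>UNIV. snd z $ i * dx i f z) - 2 * (\<Sum>i\<in>UNIV. G i z * dy i f z)"

text \<open>The Jacobi endomorphism \<open>R\<^sup>i\<^sub>k\<close> (Riemann curvature of the spray). Its trace is the Ricci scalar.\<close>

definition jacobi :: "('n \<Rightarrow> 'n::finite cfun) \<Rightarrow> 'n \<Rightarrow> 'n \<Rightarrow> 'n cfun" where
  "jacobi G i k z = 2 * dx k (G i) z - sder G (dy k (G i)) z - (\<Sum>j\<in>UNIV. dy j (G i) z * dy k (G j) z)"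

text \<open>The dynamical covariant derivative \<open>\<nabla>\<close>, that is \<open>|\<^sub>0\<close>, of a 1-form and of a tensor of type \<open>(1, 1)\<close>.
It only involves the nonlinear connection, which is why it is the same for the Chern and the Berwald
connection.\<close>

definition dyn1 :: "('n \<Rightarrow> 'n::finite cfun) \<Rightarrow> ('n \<Rightarrow> 'n cfun) \<Rightarrow> 'n \<Rightarrow> 'n cfun" where
  "dyn1 G \<theta> k z = sder G (\<theta> k) z - (\<Sum>j\<in>UNIV. dy k (G j) z * \<theta> j z)"

definition dyn2 :: "('n \<Rightarrow> 'n::finite cfun) \<Rightarrow> ('n \<Rightarrow> 'n \<Rightarrow> 'n cfun) \<Rightarrow> 'n \<Rightarrow> 'n \<Rightarrow> 'n cfun" where
  "dyn2 G T i k z = sder G (T i k) z + (\<Sum>b\<in>UNIV. dy b (G i) z * T b k z) - (\<Sum>b\<in>UNIV. dy k (G b) z * T i b z)"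

lemma sum_axis_mult [simp]: "(\<Sum>i\<in>UNIV. axis k (1::real) $ i * f i) = f (k::'n::finite)"
proof -
  have "(\<Sum>i\<in>UNIV. axis k (1::real) $ i * f i) = (\<Sum>i\<in>UNIV. if i = k then f i else 0)"
    by (rule sum.cong) (auto simp: axis_def)
  then show ?thesis by simp
qed

lemma sum_axis_mult' [simp]: "(\<Sum>i\<in>UNIV. f i * axis k (1::real) $ i) = f (k::'n::finite)"
  using sum_axis_mult[of k f] by (simp add: mult.commute)

locale coordinate_calculus =
  fixes \<Omega> :: "((real^'n::finite) \<times> (real^'n)) set"
  assumes open_dom: "open \<Omega>"
begin

abbreviation sm :: "'n cfun \<Rightarrow> bool" where "sm f \<equiv> smooth_on \<Omega> f"

lemma sm_dx: "sm f \<Longrightarrow> sm (dx i f)"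
  using smooth_on_deriv[of \<Omega> f "(axis i 1, 0)"] by (simp add: dx_def[abs_def])
lemma sm_dy: "sm f \<Longrightarrow> sm (dy i f)"
  using smooth_on_deriv[of \<Omega> f "(0, axis i 1)"] by (simp add: dy_def[abs_def])
lemma sm_snd: "sm (\<lambda>z. snd z $ i)"
  by (rule smooth_on_bounded_linear) (intro bounded_linear_compose[OF bounded_linear_vec_nth bounded_linear_snd])
lemma sm_divide: "sm f \<Longrightarrow> sm (\<lambda>z. f z / c)"
  unfolding divide_inverse by (intro smooth_on_mult[OF open_dom] smooth_on_const)
lemma sm_sum: "(\<And>i. sm (f i)) \<Longrightarrow> sm (\<lambda>z. \<Sum>i\<in>UNIV. f i z)"
  by (rule smooth_on_sum[OF open_dom])

lemmas sm_rules = sm_dx sm_dy sm_snd sm_sum sm_divide smooth_on_const smooth_on_add[OF open_dom]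
  smooth_on_diff[OF open_dom] smooth_on_minus[OF open_dom] smooth_on_mult[OF open_dom]
  smooth_on_power[OF open_dom]

lemma dx_dy_add:
  assumes "sm f" "sm g" "z \<in> \<Omega>"
  shows "dx k (\<lambda>z. f z + g z) z = dx k f z + dx k g z" "dy k (\<lambda>z. f z + g z) z = dy k f z + dy k g z"
  unfolding dx_def dy_def
  by (rule fderiv_add[OF assms(1,2)[THEN smooth_on_differentiable, OF assms(3)]])+

lemma dx_dy_diff:
  assumes "sm f" "sm g" "z \<in> \<Omega>"
  shows "dx k (\<lambda>z. f z - g z) z = dx k f z - dx k g z" "dy k (\<lambda>z. f z - g z) z = dy k f z - dy k g z"
  unfolding dx_def dy_def
  by (rule fderiv_diff[OF assms(1,2)[THEN smooth_on_differentiable, OF assms(3)]])+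

lemma dx_dy_minus:
  assumes "sm f" "z \<in> \<Omega>"
  shows "dx k (\<lambda>z. - f z) z = - dx k f z" "dy k (\<lambda>z. - f z) z = - dy k f z"
  unfolding dx_def dy_def
  by (rule fderiv_minus[OF assms(1)[THEN smooth_on_differentiable, OF assms(2)]])+

lemma dx_dy_mult:
  assumes "sm f" "sm g" "z \<in> \<Omega>"
  shows "dx k (\<lambda>z. f z * g z) z = dx k f z * g z + f z * dx k g z"
    "dy k (\<lambda>z. f z * g z) z = dy k f z * g z + f z * dy k g z"
  unfolding dx_def dy_def
  by (rule fderiv_mult[OF assms(1,2)[THEN smooth_on_differentiable, OF assms(3)]])+

lemma dx_dy_divide:
  assumes "sm f" "z \<in> \<Omega>"
  shows "dx k (\<lambda>z. f z / c) z = dx k f z / c" "dy k (\<lambda>z. f z / c) z = dy k f z / c"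
  using dx_dy_mult[OF assms(1) smooth_on_const assms(2), of k "inverse c"]
  by (simp_all add: dx_def dy_def divide_inverse)

lemma dx_dy_sum:
  assumes "\<And>i. sm (f i)" "z \<in> \<Omega>"
  shows "dx k (\<lambda>z. \<Sum>i\<in>UNIV. f i z) z = (\<Sum>i\<in>UNIV. dx k (f i) z)"
    "dy k (\<lambda>z. \<Sum>i\<in>UNIV. f i z) z = (\<Sum>i\<in>UNIV. dy k (f i) z)"
  unfolding dx_def dy_def
  by (rule fderiv_sum[OF assms(1)[THEN smooth_on_differentiable, OF assms(2)]])+

lemma dx_dy_const: "dx k (\<lambda>z. c) z = 0" "dy k (\<lambda>z. c) z = 0"
  by (simp_all add: dx_def dy_def)

lemma dx_dy_snd: "dx k (\<lambda>z. snd z $ i) z = 0" "dy k (\<lambda>z. snd z $ i) z = axis k 1 $ i"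
proof -
  have b: "bounded_linear (\<lambda>z. snd z $ i)"
    by (intro bounded_linear_compose[OF bounded_linear_vec_nth bounded_linear_snd])
  show "dx k (\<lambda>z. snd z $ i) z = 0" "dy k (\<lambda>z. snd z $ i) z = axis k 1 $ i"
    by (simp_all add: dx_def dy_def fderiv_bounded_linear[OF b])
qed

lemmas leibniz = dx_dy_add dx_dy_diff dx_dy_minus dx_dy_mult dx_dy_divide dx_dy_sum dx_dy_const dx_dy_snd

lemma fderiv_cong:
  assumes "\<And>w. w \<in> \<Omega> \<Longrightarrow> f w = g w" "z \<in> \<Omega>"
  shows "frechet_derivative f (at z) v = frechet_derivative g (at z) v"
proof -
  have "(f has_derivative h) (at z) \<longleftrightarrow> (g has_derivative h) (at z)" for h
    using assms open_dom has_derivative_transform_within_open[of _ _ z UNIV \<Omega>] by metis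
  then show ?thesis by (simp add: frechet_derivative_def)
qed

lemma dx_cong: "(\<And>w. w \<in> \<Omega> \<Longrightarrow> f w = g w) \<Longrightarrow> z \<in> \<Omega> \<Longrightarrow> dx k f z = dx k g z"
  unfolding dx_def by (rule fderiv_cong)
lemma dy_cong: "(\<And>w. w \<in> \<Omega> \<Longrightarrow> f w = g w) \<Longrightarrow> z \<in> \<Omega> \<Longrightarrow> dy k f z = dy k g z"
  unfolding dy_def by (rule fderiv_cong)
lemma sder_cong: "(\<And>w. w \<in> \<Omega> \<Longrightarrow> f w = g w) \<Longrightarrow> z \<in> \<Omega> \<Longrightarrow> sder G f z = sder G g z"
  unfolding sder_def using dx_cong[of f g z] dy_cong[of f g z] by simp
lemma hder_cong: "(\<And>w. w \<in> \<Omega> \<Longrightarrow> f w = g w) \<Longrightarrow> z \<in> \<Omega> \<Longrightarrow> hder G k f z = hder G k g z"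
  unfolding hder_def using dx_cong[of f g z] dy_cong[of f g z] by simp
lemma sm_cong: "(\<And>w. w \<in> \<Omega> \<Longrightarrow> f w = g w) \<Longrightarrow> sm f \<longleftrightarrow> sm g"
  by (rule smooth_on_cong[OF open_dom])

lemma dy_dx_commute: "sm f \<Longrightarrow> z \<in> \<Omega> \<Longrightarrow> dy k (dx l f) z = dx l (dy k f) z"
  using fderiv_commute[OF open_dom, of f z] unfolding dx_def[abs_def] dy_def[abs_def] by auto
lemma dx_dx_commute: "sm f \<Longrightarrow> z \<in> \<Omega> \<Longrightarrow> dx k (dx l f) z = dx l (dx k f) z"
  using fderiv_commute[OF open_dom, of f z] unfolding dx_def[abs_def] dy_def[abs_def] by auto
lemma dy_dy_commute: "sm f \<Longrightarrow> z \<in> \<Omega> \<Longrightarrow> dy k (dy l f) z = dy l (dy k f) z"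
  using fderiv_commute[OF open_dom, of f z] unfolding dx_def[abs_def] dy_def[abs_def] by auto

end

locale spray_calculus = coordinate_calculus \<Omega> for \<Omega> :: "((real^'n::finite) \<times> (real^'n)) set" +
  fixes G :: "'n \<Rightarrow> 'n cfun"
  assumes smooth_spray: "\<And>i. sm (G i)"
begin

abbreviation N :: "'n \<Rightarrow> 'n \<Rightarrow> 'n cfun" where "N a i \<equiv> dy i (G a)"
abbreviation S :: "'n cfun \<Rightarrow> 'n cfun" where "S \<equiv> sder G"
abbreviation \<delta> :: "'n \<Rightarrow> 'n cfun \<Rightarrow> 'n cfun" where "\<delta> \<equiv> hder G"
abbreviation R :: "'n \<Rightarrow> 'n \<Rightarrow> 'n cfun" where "R \<equiv> jacobi G"

lemma sm_sder: "sm f \<Longrightarrow> sm (S f)"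
  unfolding sder_def[abs_def] by (intro sm_rules smooth_spray)
lemma sm_hder: "sm f \<Longrightarrow> sm (\<delta> i f)"
  unfolding hder_def[abs_def] by (intro sm_rules smooth_spray)
lemma sm_jacobi: "sm (R i k)"
  unfolding jacobi_def[abs_def] by (intro sm_rules sm_sder smooth_spray)
lemma sm_dyn1: "(\<And>i. sm (\<theta> i)) \<Longrightarrow> sm (dyn1 G \<theta> k)"
  unfolding dyn1_def[abs_def] by (intro sm_rules sm_sder smooth_spray)
lemma sm_dyn2: "(\<And>i j. sm (T i j)) \<Longrightarrow> sm (dyn2 G T i k)"
  unfolding dyn2_def[abs_def] by (intro sm_rules sm_sder smooth_spray)

lemmas smooth = sm_rules smooth_spray sm_sder sm_hder sm_jacobi sm_dyn1 sm_dyn2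

lemma sder_leibniz:
  assumes z: "z \<in> \<Omega>"
  shows "sm f \<Longrightarrow> sm g \<Longrightarrow> S (\<lambda>z. f z + g z) z = S f z + S g z"
    "sm f \<Longrightarrow> sm g \<Longrightarrow> S (\<lambda>z. f z - g z) z = S f z - S g z"
    "sm f \<Longrightarrow> S (\<lambda>z. - f z) z = - S f z"
    "sm f \<Longrightarrow> sm g \<Longrightarrow> S (\<lambda>z. f z * g z) z = S f z * g z + f z * S g z"
    "(\<And>i. sm (h i)) \<Longrightarrow> S (\<lambda>z. \<Sum>i\<in>UNIV. h i z) z = (\<Sum>i\<in>UNIV. S (h i) z)"
    "sm f \<Longrightarrow> S (\<lambda>z. f z / c) z = S f z / c"
    "S (\<lambda>z. c) z = 0"
    "S (\<lambda>z. snd z $ j) z = - 2 * G j z"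
proof -
  show "(\<And>i. sm (h i)) \<Longrightarrow> S (\<lambda>z. \<Sum>i\<in>UNIV. h i z) z = (\<Sum>i\<in>UNIV. S (h i) z)"
    by (simp add: sder_def leibniz z sum_subtractf sum_distrib_left)
      (intro arg_cong2[where f="(-)"] sum.swap)
  show "S (\<lambda>z. snd z $ j) z = - 2 * G j z"
    by (simp add: sder_def leibniz axis_def if_distrib cong: if_cong)
qed (simp_all add: sder_def leibniz z sum.distrib sum_subtractf sum_negf algebra_simps diff_divide_distrib sum_distrib_left sum_divide_distrib)

lemma hder_leibniz:
  assumes z: "z \<in> \<Omega>"
  shows "sm f \<Longrightarrow> sm g \<Longrightarrow> \<delta> k (\<lambda>z. f z + g z) z = \<delta> k f z + \<delta> k g z"
    "sm f \<Longrightarrow> sm g \<Longrightarrow> \<delta> k (\<lambda>z. f z - g z) z = \<delta> k f z - \<delta> k g z"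
    "sm f \<Longrightarrow> \<delta> k (\<lambda>z. - f z) z = - \<delta> k f z"
    "sm f \<Longrightarrow> sm g \<Longrightarrow> \<delta> k (\<lambda>z. f z * g z) z = \<delta> k f z * g z + f z * \<delta> k g z"
    "(\<And>i. sm (h i)) \<Longrightarrow> \<delta> k (\<lambda>z. \<Sum>i\<in>UNIV. h i z) z = (\<Sum>i\<in>UNIV. \<delta> k (h i) z)"
    "sm f \<Longrightarrow> \<delta> k (\<lambda>z. f z / c) z = \<delta> k f z / c"
    "\<delta> k (\<lambda>z. c) z = 0"
    "\<delta> k (\<lambda>z. snd z $ j) z = - N j k z"
proof -
  show "(\<And>i. sm (h i)) \<Longrightarrow> \<delta> k (\<lambda>z. \<Sum>i\<in>UNIV. h i z) z = (\<Sum>i\<in>UNIV. \<delta> k (h i) z)"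
    by (simp add: hder_def leibniz z sum_subtractf sum_distrib_left) (rule sum.swap)
  show "\<delta> k (\<lambda>z. snd z $ j) z = - N j k z"
    by (simp add: hder_def leibniz axis_def if_distrib cong: if_cong)
qed (simp_all add: hder_def leibniz z sum.distrib sum_subtractf sum_negf algebra_simps diff_divide_distrib sum_distrib_left sum_divide_distrib)

lemmas deriv_rules = leibniz sder_leibniz hder_leibniz

text \<open>The commutators of \<open>\<partial>/\<partial>y\<^sup>k\<close>, \<open>S\<close> and \<open>\<delta>\<^sub>k\<close>. The later curvature identities come from applying these
rules to suitable functions. The bracket of \<open>S\<close> and \<open>\<delta>\<^sub>k\<close>
produces the Jacobi endomorphism, that of \<open>\<delta>\<^sub>j\<close> and \<open>\<delta>\<^sub>k\<close> the curvature of the nonlinear connection.\<close>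

lemma dy_sder:
  assumes "sm f" "z \<in> \<Omega>"
  shows "dy k (S f) z = S (dy k f) z + \<delta> k f z - (\<Sum>a\<in>UNIV. N a k z * dy a f z)"
  unfolding sder_def[of G f, abs_def]
  using assms
  by (simp add: smooth leibniz dy_dx_commute dy_dy_commute[of f z k] sum.distrib sder_def hder_def
      algebra_simps)

lemma dx_sder:
  assumes "sm f" "z \<in> \<Omega>"
  shows "dx k (S f) z = S (dx k f) z - 2 * (\<Sum>a\<in>UNIV. dx k (G a) z * dy a f z)"
  unfolding sder_def[of G f, abs_def]
  using assms
  by (simp add: smooth leibniz dy_dx_commute dx_dx_commute[of f z k] sum.distrib sder_def hder_def
      algebra_simps)

lemma dy_hder:
  assumes "sm f" "z \<in> \<Omega>"
  shows "dy k (\<delta> l f) z = \<delta> l (dy k f) z - (\<Sum>a\<in>UNIV. dy k (N a l) z * dy a f z)"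
  unfolding hder_def[of G l f, abs_def]
  using assms
  by (simp add: smooth leibniz dy_dx_commute dy_dy_commute[of f z k] sum.distrib hder_def
      algebra_simps)

lemma sder_hder:
  assumes "sm f" "z \<in> \<Omega>"
  shows "S (\<delta> k f) z = \<delta> k (S f) z + (\<Sum>i\<in>UNIV. N i k z * \<delta> i f z) + (\<Sum>i\<in>UNIV. R i k z * dy i f z)"
proof -
  have 1: "S (\<delta> k f) z = S (dx k f) z - (\<Sum>a\<in>UNIV. S (N a k) z * dy a f z) - (\<Sum>a\<in>UNIV. N a k z * S (dy a f) z)"
    unfolding hder_def[of G k f, abs_def] using assms
    by (simp add: smooth deriv_rules sum.distrib)
  have sw: "(\<Sum>a\<in>UNIV. \<Sum>b\<in>UNIV. N a k z * N b a z * dy b f z) = (\<Sum>b\<in>UNIV. \<Sum>a\<in>UNIV. N a k z * N b a z * dy b f z)"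
    by (rule sum.swap)
  show ?thesis
    unfolding 1 hder_def[of G k "S f"] dx_sder[OF assms] dy_sder[OF assms] jacobi_def
    using sw by (simp add: sum.distrib sum_subtractf algebra_simps sum_distrib_left sum_distrib_right)
qed

lemma hder_hder:
  assumes "sm f" "z \<in> \<Omega>"
  shows "\<delta> j (\<delta> k f) z = \<delta> k (\<delta> j f) z - (\<Sum>c\<in>UNIV. (\<delta> j (N c k) z - \<delta> k (N c j) z) * dy c f z)"
proof -
  have 1: "\<delta> j (\<delta> k f) z = \<delta> j (dx k f) z - (\<Sum>a\<in>UNIV. \<delta> j (N a k) z * dy a f z) - (\<Sum>a\<in>UNIV. N a k z * \<delta> j (dy a f) z)" for j k
    unfolding hder_def[of G k f, abs_def] using assms
    by (simp add: smooth deriv_rules sum.distrib)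
  have sw: "(\<Sum>a\<in>UNIV. \<Sum>b\<in>UNIV. N a k z * (N b j z * dy a (dy b f) z)) = (\<Sum>a\<in>UNIV. \<Sum>b\<in>UNIV. N a j z * (N b k z * dy a (dy b f) z))"
    using assms by (subst sum.swap) (simp add: mult_ac dy_dy_commute[of f z])
  show ?thesis
    unfolding 1 
    using sw assms 
    apply (simp add: hder_def[of G _ "dx _ f"] hder_def[of G _ "dy _ f"] sum.distrib sum_subtractf algebra_simps sum_distrib_left sum_distrib_right
      dx_dx_commute[of f z j] dy_dx_commute dy_dy_commute[of f z])
    done
qed

end

section \<open>Curvature identities of a spray\<close>

context spray_calculus
begin

definition \<tau> :: "'n cfun" where "\<tau> z = (\<Sum>a\<in>UNIV. N a a z)"
definition Ric :: "'n cfun" where "Ric z = (\<Sum>a\<in>UNIV. R a a z)"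
definition divR :: "'n \<Rightarrow> 'n cfun" where "divR k z = (\<Sum>a\<in>UNIV. dy a (R a k) z)"
text \<open>Expanding \<open>\<nabla>\<close> and \<open>\<delta>\<^sub>k\<close>, this is \<open>S (\<tau>\<^sub>\<cdot>\<^sub>k) - \<partial>\<^sub>k \<tau>\<close>, the Euler--Lagrange expression of the function \<open>\<tau>\<close>.\<close>

definition euler_lagrange :: "'n \<Rightarrow> 'n cfun" where "euler_lagrange k z = dyn1 G (\<lambda>k. dy k \<tau>) k z - \<delta> k \<tau> z"
text \<open>The trace, over the upper and one lower index, of the curvature \<open>\<delta>\<^sub>i N\<^sup>j\<^sub>k - \<delta>\<^sub>k N\<^sup>j\<^sub>i\<close> of the nonlinear connection.\<close>

definition curvature_trace :: "'n \<Rightarrow> 'n cfun" where "curvature_trace k z = (\<Sum>i\<in>UNIV. \<delta> i (N i k) z) - \<delta> k \<tau> z"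

lemma sm_defs: "sm \<tau>" "sm Ric" "sm (divR k)" "sm (euler_lagrange k)" "sm (curvature_trace k)"
proof -
  show t: "sm \<tau>" unfolding \<tau>_def[abs_def] by (intro smooth)
  show "sm Ric" unfolding Ric_def[abs_def] by (intro smooth)
  show "sm (divR k)" unfolding divR_def[abs_def] by (intro smooth)
  show "sm (euler_lagrange k)" unfolding euler_lagrange_def[abs_def] by (intro smooth t)
  show "sm (curvature_trace k)" unfolding curvature_trace_def[abs_def] by (intro smooth t)
qed

lemma dy_\<tau>: "z \<in> \<Omega> \<Longrightarrow> dy k \<tau> z = (\<Sum>a\<in>UNIV. dy a (N a k) z)"
  unfolding \<tau>_def[abs_def] by (simp add: leibniz smooth dy_dy_commute[OF smooth_spray, of _ k])

lemma sder_dy_\<tau>: "z \<in> \<Omega> \<Longrightarrow> S (dy k \<tau>) z = (\<Sum>a\<in>UNIV. S (dy a (N a k)) z)"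
  using sder_cong[OF dy_\<tau>] by (simp add: deriv_rules smooth)

lemma divR_eq:
  assumes z: "z \<in> \<Omega>"
  shows "divR k z = 2 * dx k \<tau> z - S (dy k \<tau>) z - (\<Sum>i\<in>UNIV. \<delta> i (N i k) z) - (\<Sum>j\<in>UNIV. dy j \<tau> z * N j k z)"
proof -
  have 1: "dx k \<tau> z = (\<Sum>a\<in>UNIV. dx k (N a a) z)"
    unfolding \<tau>_def[abs_def] using z by (simp add: leibniz smooth)
  have sw: "(\<Sum>i\<in>UNIV. \<Sum>a\<in>UNIV. N a i z * dy a (N i k) z) = (\<Sum>i\<in>UNIV. \<Sum>a\<in>UNIV. N i a z * dy i (N a k) z)"
    by (rule sum.swap)
  have sw2: "(\<Sum>i\<in>UNIV. \<Sum>a\<in>UNIV. dy a (N a i) z * N i k z) = (\<Sum>i\<in>UNIV. \<Sum>a\<in>UNIV. dy i (N i a) z * N a k z)"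
    by (rule sum.swap)
  show ?thesis
    unfolding divR_def jacobi_def[abs_def] 1 sder_dy_\<tau>[OF z] dy_\<tau>[OF z]
    using z sw sw2
    by (simp add: leibniz smooth dy_dx_commute dy_sder sum.distrib sum_subtractf sum_distrib_left sum_distrib_right algebra_simps)
qed

lemma dy_Ric:
  assumes z: "z \<in> \<Omega>"
  shows "dy k Ric z = 2 * (\<Sum>i\<in>UNIV. \<delta> i (N i k) z) - S (dy k \<tau>) z - \<delta> k \<tau> z + (\<Sum>a\<in>UNIV. N a k z * dy a \<tau> z)"
proof -
  have 1: "\<delta> k \<tau> z = (\<Sum>a\<in>UNIV. \<delta> k (N a a) z)" "S (dy k \<tau>) z = (\<Sum>a\<in>UNIV. S (dy k (N a a)) z)"
     "dy i \<tau> z = (\<Sum>a\<in>UNIV. dy i (N a a) z)" for i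
  proof -
    show "S (dy k \<tau>) z = (\<Sum>a\<in>UNIV. S (dy k (N a a)) z)"
      using sder_cong[of "dy k \<tau>" "\<lambda>z. \<Sum>a\<in>UNIV. dy k (N a a) z"] z
      unfolding \<tau>_def[abs_def] by (simp add: deriv_rules smooth)
  qed (use z in \<open>simp_all add: \<tau>_def[abs_def] deriv_rules smooth\<close>)
  have sw: "(\<Sum>i\<in>UNIV. \<Sum>a\<in>UNIV. dy k (N i a) z * N a i z) = (\<Sum>i\<in>UNIV. \<Sum>a\<in>UNIV. N i a z * dy k (N a i) z)"
    by (subst sum.swap) (simp add: mult.commute)
  have sw2: "(\<Sum>i\<in>UNIV. \<Sum>a\<in>UNIV. N a k z * dy a (N i i) z) = (\<Sum>i\<in>UNIV. \<Sum>a\<in>UNIV. N i k z * dy i (N a a) z)"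
    by (rule sum.swap)
  have 2: "\<delta> i (N i k) z = dx i (N i k) z - (\<Sum>a\<in>UNIV. N a i z * dy k (N i a) z)" for i
    using z by (simp add: hder_def dy_dy_commute[OF smooth_spray, of _ _ k])
  have 3: "dy k (dx i (G i)) z = dx i (N i k) z" for i using z by (simp add: dy_dx_commute smooth)
  show ?thesis
    unfolding Ric_def[abs_def] jacobi_def[abs_def] 1 2
    using z sw sw2 
    by (simp add: leibniz smooth 3 dy_sder sum.distrib sum_subtractf sum_distrib_left sum_distrib_right algebra_simps)
qed

text \<open>This exchanges the trace of the curvature for the vertical divergence of \<open>R\<close>, the vertical
gradient of \<open>Ric\<close> and the Euler--Lagrange expression, the last of which a metric expresses through the
mean Landsberg tensor.\<close>

lemma curvature_trace_eq: "z \<in> \<Omega> \<Longrightarrow> curvature_trace k z = divR k z + dy k Ric z + 2 * euler_lagrange k z"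
  unfolding curvature_trace_def euler_lagrange_def dyn1_def divR_eq dy_Ric
  by (simp add: hder_def[of G k \<tau>] algebra_simps)

lemma jacobi_eq:
  "z \<in> \<Omega> \<Longrightarrow> R i k z = 2 * \<delta> k (G i) z + (\<Sum>a\<in>UNIV. N i a z * N a k z) - S (N i k) z"
  by (simp add: jacobi_def hder_def algebra_simps)

text \<open>The trace of the Bianchi identity of the nonlinear connection, contracted with \<open>y\<close>. Inserting the
formula \<open>R\<^sup>i\<^sub>k = 2 \<delta>\<^sub>k G\<^sup>i + N\<^sup>i\<^sub>a N\<^sup>a\<^sub>k - S N\<^sup>i\<^sub>k\<close> and commuting \<open>\<delta>\<close> past \<open>S\<close> and \<open>\<delta>\<close>, every remaining term
cancels against another one after renaming two summation indices.\<close>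

lemma spray_bianchi:
  assumes z: "z \<in> \<Omega>"
  shows "dyn1 G curvature_trace k z + (\<Sum>a\<in>UNIV. \<delta> a (R a k) z) + (\<Sum>b\<in>UNIV. dy b \<tau> z * R b k z)
    - (\<Sum>a\<in>UNIV. \<Sum>b\<in>UNIV. dy a (N b k) z * R a b z) - \<delta> k Ric z = 0"
proof -
  have dR: "\<delta> j (R i l) z = 2 * \<delta> j (\<delta> l (G i)) z + (\<Sum>a\<in>UNIV. \<delta> j (N i a) z * N a l z + N i a z * \<delta> j (N a l) z)
     - S (\<delta> j (N i l)) z + (\<Sum>m\<in>UNIV. N m j z * \<delta> m (N i l) z) + (\<Sum>m\<in>UNIV. R m j z * dy m (N i l) z)" for i j l
  proof -
    have "\<delta> j (R i l) z = \<delta> j (\<lambda>z. 2 * \<delta> l (G i) z + (\<Sum>a\<in>UNIV. N i a z * N a l z) - S (N i l) z) z"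
      by (rule hder_cong[OF jacobi_eq z])
    then show ?thesis using z sder_hder[of "N i l" z j]
      by (simp add: deriv_rules smooth)
  qed
  have dRic: "\<delta> k Ric z = (\<Sum>a\<in>UNIV. \<delta> k (R a a) z)"
    unfolding Ric_def[abs_def] using z by (simp add: deriv_rules smooth)
  have d\<tau>: "\<delta> j \<tau> w = (\<Sum>a\<in>UNIV. \<delta> j (N a a) w)" "dy j \<tau> w = (\<Sum>a\<in>UNIV. dy j (N a a) w)" if "w \<in> \<Omega>" for j w
    unfolding \<tau>_def[abs_def] using that by (simp_all add: deriv_rules smooth)
  have SK: "S (curvature_trace k) z = (\<Sum>i\<in>UNIV. S (\<delta> i (N i k)) z) - (\<Sum>i\<in>UNIV. S (\<delta> k (N i i)) z)"
  proof -
    have "S (curvature_trace k) z = S (\<lambda>z. (\<Sum>i\<in>UNIV. \<delta> i (N i k) z) - (\<Sum>a\<in>UNIV. \<delta> k (N a a) z)) z"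
      by (rule sder_cong[OF _ z]) (simp add: curvature_trace_def d\<tau>)
    then show ?thesis using z by (simp add: deriv_rules smooth)
  qed
  \<comment> \<open>The double sums that cancel differ only in the names of their indices.\<close>
  have s1: "(\<Sum>a\<in>UNIV. \<Sum>i\<in>UNIV. N i a z * \<delta> i (N a k) z) = (\<Sum>a\<in>UNIV. \<Sum>i\<in>UNIV. N a i z * \<delta> a (N i k) z)"
    by (rule sum.swap)
  have s7: "(\<Sum>a\<in>UNIV. \<Sum>b\<in>UNIV. \<delta> k (N a b) z * N b a z) = (\<Sum>a\<in>UNIV. \<Sum>b\<in>UNIV. N a b z * \<delta> k (N b a) z)"
    by (subst sum.swap) (simp add: mult.commute)
  have s11: "(\<Sum>j\<in>UNIV. \<Sum>i\<in>UNIV. N j k z * \<delta> i (N i j) z) = (\<Sum>a\<in>UNIV. \<Sum>b\<in>UNIV. \<delta> a (N a b) z * N b k z)"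
    by (subst sum.swap) (simp add: mult.commute)
  have s9: "(\<Sum>j\<in>UNIV. \<Sum>a\<in>UNIV. N j k z * \<delta> j (N a a) z) = (\<Sum>a\<in>UNIV. \<Sum>i\<in>UNIV. N i k z * \<delta> i (N a a) z)"
    by (rule sum.swap)
  have s10: "(\<Sum>b\<in>UNIV. \<Sum>a\<in>UNIV. dy b (N a a) z * R b k z) = (\<Sum>a\<in>UNIV. \<Sum>i\<in>UNIV. R i k z * dy i (N a a) z)"
    by (subst sum.swap) (simp add: mult.commute)
  have s6: "(\<Sum>a\<in>UNIV. \<Sum>b\<in>UNIV. dy a (N b k) z * R a b z) = (\<Sum>a\<in>UNIV. \<Sum>i\<in>UNIV. R i a z * dy i (N a k) z)"
    by (subst sum.swap) (simp add: mult.commute)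
  have c: "(\<Sum>a\<in>UNIV. \<delta> a (\<delta> k (G a)) z) = (\<Sum>a\<in>UNIV. \<delta> k (\<delta> a (G a)) z)
     - (\<Sum>a\<in>UNIV. \<Sum>i\<in>UNIV. N a i z * \<delta> a (N i k) z) + (\<Sum>a\<in>UNIV. \<Sum>b\<in>UNIV. N a b z * \<delta> k (N b a) z)"
    using z by (simp add: hder_hder[OF smooth_spray, of z _ k] sum_subtractf sum.distrib algebra_simps)
  have A: "(\<Sum>a\<in>UNIV. \<delta> a (R a k) z) = 2 * (\<Sum>a\<in>UNIV. \<delta> k (\<delta> a (G a)) z) + 2 * (\<Sum>a\<in>UNIV. \<Sum>b\<in>UNIV. N a b z * \<delta> k (N b a) z)
     + (\<Sum>a\<in>UNIV. \<Sum>b\<in>UNIV. \<delta> a (N a b) z * N b k z) - (\<Sum>i\<in>UNIV. S (\<delta> i (N i k)) z)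
     + (\<Sum>a\<in>UNIV. \<Sum>i\<in>UNIV. R i a z * dy i (N a k) z)"
    unfolding dR using s1 c by (simp add: sum.distrib sum_subtractf sum_distrib_left[symmetric])
  have B: "\<delta> k Ric z = 2 * (\<Sum>a\<in>UNIV. \<delta> k (\<delta> a (G a)) z) + 2 * (\<Sum>a\<in>UNIV. \<Sum>b\<in>UNIV. N a b z * \<delta> k (N b a) z)
     - (\<Sum>i\<in>UNIV. S (\<delta> k (N i i)) z) + (\<Sum>a\<in>UNIV. \<Sum>i\<in>UNIV. N i k z * \<delta> i (N a a) z)
     + (\<Sum>a\<in>UNIV. \<Sum>i\<in>UNIV. R i k z * dy i (N a a) z)"
    unfolding dRic dR using s7 by (simp add: sum.distrib sum_subtractf sum_distrib_left[symmetric])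
  have C: "dyn1 G curvature_trace k z = (\<Sum>i\<in>UNIV. S (\<delta> i (N i k)) z) - (\<Sum>i\<in>UNIV. S (\<delta> k (N i i)) z)
     - (\<Sum>a\<in>UNIV. \<Sum>b\<in>UNIV. \<delta> a (N a b) z * N b k z) + (\<Sum>a\<in>UNIV. \<Sum>i\<in>UNIV. N i k z * \<delta> i (N a a) z)"
    unfolding dyn1_def SK s11[symmetric] s9[symmetric]
    by (simp add: curvature_trace_def d\<tau> z sum_distrib_left right_diff_distrib sum_subtractf)
  show ?thesis
    unfolding A B C s6 d\<tau>(2)[OF z] sum_distrib_right s10 by simp
qed

text \<open>The commutator of \<open>\<partial>/\<partial>y\<^sup>a\<close> with \<open>\<nabla>\<close>, traced: it produces exactly the Berwald covariant divergence of
\<open>R\<close> that occurs in \<open>spray_bianchi\<close>.\<close>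

lemma div_dyn_jacobi:
  assumes z: "z \<in> \<Omega>"
  shows "(\<Sum>a\<in>UNIV. dy a (dyn2 G R a k) z) = dyn1 G divR k z + (\<Sum>a\<in>UNIV. \<delta> a (R a k) z)
    + (\<Sum>b\<in>UNIV. dy b \<tau> z * R b k z) - (\<Sum>a\<in>UNIV. \<Sum>b\<in>UNIV. dy a (N b k) z * R a b z)"
proof -
  have 1: "S (divR k) z = (\<Sum>a\<in>UNIV. S (dy a (R a k)) z)"
    unfolding divR_def[abs_def] using z by (simp add: deriv_rules smooth)
  have s1: "(\<Sum>a\<in>UNIV. \<Sum>b\<in>UNIV. N b a z * dy b (R a k) z) = (\<Sum>a\<in>UNIV. \<Sum>b\<in>UNIV. N a b z * dy a (R b k) z)"
    by (rule sum.swap)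
  have s2: "(\<Sum>a\<in>UNIV. \<Sum>b\<in>UNIV. dy b (N b a) z * R a k z) = (\<Sum>a\<in>UNIV. \<Sum>b\<in>UNIV. dy a (N a b) z * R b k z)"
    by (rule sum.swap)
  have s3: "(\<Sum>a\<in>UNIV. \<Sum>b\<in>UNIV. N a k z * dy b (R b a) z) = (\<Sum>a\<in>UNIV. \<Sum>b\<in>UNIV. N b k z * dy a (R a b) z)"
    by (rule sum.swap)
  show ?thesis
    unfolding dyn2_def[abs_def] dyn1_def 1 dy_\<tau>[OF z]
    using z s1 s2 s3
    by (simp add: leibniz smooth dy_sder divR_def sum.distrib sum_subtractf sum_distrib_left sum_distrib_right algebra_simps)
qed

text \<open>Eliminating the horizontal divergence of \<open>R\<close> between the two preceding lemmas leaves only the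
vertical divergence of \<open>\<nabla>R\<close>, which integration over a fibre can handle.\<close>

lemma spray_identity:
  assumes z: "z \<in> \<Omega>"
  shows "(\<Sum>a\<in>UNIV. dy a (dyn2 G R a k) z) + 2 * dyn1 G euler_lagrange k z + dyn1 G (\<lambda>k. dy k Ric) k z - \<delta> k Ric z = 0"
proof -
  have "dyn1 G curvature_trace k z = dyn1 G divR k z + dyn1 G (\<lambda>k. dy k Ric) k z + 2 * dyn1 G euler_lagrange k z"
  proof -
    have "S (curvature_trace k) z = S (\<lambda>z. divR k z + dy k Ric z + 2 * euler_lagrange k z) z"
      by (rule sder_cong[OF curvature_trace_eq z])
    then show ?thesis
      using z sm_defs by (simp add: dyn1_def deriv_rules smooth curvature_trace_eq algebra_simps sum.distrib sum_distrib_left)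
  qed
  with spray_bianchi[OF z, of k] div_dyn_jacobi[OF z, of k] show ?thesis by linarith
qed

end

section \<open>The metric of a Finsler structure in one chart\<close>

locale local_finsler =
  fixes U :: "(real^'n::finite) set" and L :: "'n cfun"
  assumes open_U: "open U"
    and smooth_L: "smooth_on (U \<times> (UNIV - {0})) L"
    and homogeneous: "\<And>x y t. x \<in> U \<Longrightarrow> y \<noteq> 0 \<Longrightarrow> t > 0 \<Longrightarrow> L (x, t *\<^sub>R y) = t * L (x, y)"
    and posdef: "\<And>z w. z \<in> U \<times> (UNIV - {0}) \<Longrightarrow> w \<noteq> 0 \<Longrightarrow>
      (\<Sum>i\<in>UNIV. \<Sum>j\<in>UNIV. fund L i j z * w $ i * w $ j) > 0"
begin

abbreviation \<Omega> :: "((real^'n) \<times> (real^'n)) set" where "\<Omega> \<equiv> U \<times> (UNIV - {0})"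

sublocale coordinate_calculus \<Omega>
  by standard (auto intro: open_Times open_U)

definition E :: "'n cfun" where "E z = (L z)\<^sup>2"

abbreviation g :: "'n \<Rightarrow> 'n \<Rightarrow> 'n cfun" where "g \<equiv> fund L"
abbreviation h :: "'n \<Rightarrow> 'n \<Rightarrow> 'n cfun" where "h \<equiv> fund_inv L"

lemma sm_E: "sm E"
  unfolding E_def[abs_def] by (intro sm_rules smooth_L)

lemma fund_eq: "g i j z = 1/2 * dy i (dy j E) z"
  by (simp add: fund_def E_def[abs_def])

lemma dy_dy_E: "dy i (dy j E) z = 2 * g i j z"
  by (simp add: fund_eq)

lemma sm_fund: "sm (g i j)"
  unfolding fund_eq[abs_def] by (intro sm_rules sm_E)

lemma fund_sym: "z \<in> \<Omega> \<Longrightarrow> g i j z = g j i z"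
  by (simp add: fund_eq dy_dy_commute[OF sm_E, of z i])

lemma dy_fund_sym: "z \<in> \<Omega> \<Longrightarrow> dy k (g i j) z = dy i (g k j) z"
  unfolding fund_eq[abs_def] by (simp add: leibniz sm_rules sm_E dy_dy_commute[of "dy j E" z k])

lemma det_fund: "z \<in> \<Omega> \<Longrightarrow> det (\<chi> i j. g i j z) \<noteq> 0"
proof -
  assume z: "z \<in> \<Omega>"
  have "w = 0" if "(\<chi> i j. g i j z) *v w = 0" for w
  proof (rule ccontr)
    assume "w \<noteq> 0"
    moreover have "(\<Sum>i\<in>UNIV. \<Sum>j\<in>UNIV. g i j z * w $ i * w $ j) = (\<Sum>i\<in>UNIV. w $ i * ((\<chi> i j. g i j z) *v w) $ i)"
      by (simp add: matrix_vector_mult_def sum_distrib_left mult_ac)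
    ultimately show False using posdef[OF z, of w] that by simp
  qed
  then show ?thesis
    using invertible_det_nz invertible_left_inverse matrix_left_invertible_ker by blast
qed

lemma sm_fund_inv: "sm (h i j)"
  unfolding fund_inv_def[abs_def] by (intro smooth_on_matrix_inv open_dom sm_fund det_fund)

lemma fund_inv_fund:
  assumes "z \<in> \<Omega>"
  shows "(\<Sum>j\<in>UNIV. h i j z * g j k z) = (if i = k then 1 else 0)"
  using matrix_inv_mult(2)[OF det_fund[OF assms]]
  by (simp add: matrix_matrix_mult_def vec_eq_iff mat_def fund_inv_def)

lemma fund_fund_inv:
  assumes "z \<in> \<Omega>"
  shows "(\<Sum>j\<in>UNIV. g i j z * h j k z) = (if i = k then 1 else 0)"
  using matrix_inv_mult(1)[OF det_fund[OF assms]]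
  by (simp add: matrix_matrix_mult_def vec_eq_iff mat_def fund_inv_def)

lemma raise_lower:
  assumes z: "z \<in> \<Omega>"
  shows "(\<Sum>j\<in>UNIV. h i j z * (\<Sum>k\<in>UNIV. g j k z * u k)) = u i"
    and "(\<Sum>j\<in>UNIV. g i j z * (\<Sum>k\<in>UNIV. h j k z * u k)) = u i"
proof -
  have *: "(\<Sum>j\<in>UNIV. a i j * (\<Sum>k\<in>UNIV. b j k * u k)) = u i"
    if "\<And>k. (\<Sum>j\<in>UNIV. a i j * b j k) = (if i = k then 1 else (0::real))" for a b :: "'n \<Rightarrow> 'n \<Rightarrow> real"
  proof -
    have "(\<Sum>j\<in>UNIV. a i j * (\<Sum>k\<in>UNIV. b j k * u k)) = (\<Sum>k\<in>UNIV. (\<Sum>j\<in>UNIV. a i j * b j k) * u k)"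
      unfolding sum_distrib_left sum_distrib_right mult.assoc by (rule sum.swap)
    also have "\<dots> = (\<Sum>k\<in>UNIV. if k = i then u k else 0)" by (rule sum.cong) (auto simp: that)
    finally show ?thesis by simp
  qed
  show "(\<Sum>j\<in>UNIV. h i j z * (\<Sum>k\<in>UNIV. g j k z * u k)) = u i"
    "(\<Sum>j\<in>UNIV. g i j z * (\<Sum>k\<in>UNIV. h j k z * u k)) = u i"
    by (intro * fund_inv_fund fund_fund_inv z)+
qed

lemma fund_inv_sym: 
  assumes z: "z \<in> \<Omega>" shows "h i j z = h j i z"
proof -
  have "(\<Sum>l\<in>UNIV. g k l z * h j l z) = (\<Sum>l\<in>UNIV. h j l z * g l k z)" for k
    by (rule sum.cong) (auto simp: fund_sym[OF z, of k] mult.commute)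
  then have "(\<Sum>k\<in>UNIV. h i k z * (\<Sum>l\<in>UNIV. g k l z * h j l z)) = (\<Sum>k\<in>UNIV. if k = j then h i k z else 0)"
    by (intro sum.cong) (auto simp: fund_inv_fund[OF z])
  then show ?thesis using raise_lower(1)[OF z, of i "\<lambda>l. h j l z"] by simp
qed

lemma fund_cancel:
  assumes z: "z \<in> \<Omega>" and "\<And>c. (\<Sum>i\<in>UNIV. g c i z * u i) = (\<Sum>i\<in>UNIV. g c i z * v i)"
  shows "u i = v i"
  using raise_lower(1)[OF z, of i u] raise_lower(1)[OF z, of i v] assms(2) by simp

section \<open>Homogeneity\<close>

definition eul :: "'n cfun \<Rightarrow> 'n cfun" where "eul f z = (\<Sum>b\<in>UNIV. snd z $ b * dy b f z)"

lemma eul_eq: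
  assumes "sm f" "(x, y) \<in> \<Omega>"
  shows "eul f (x, y) = frechet_derivative f (at (x, y)) (0, y)"
proof -
  interpret linear "frechet_derivative f (at (x, y))"
    by (rule linear_frechet_derivative[OF smooth_on_differentiable[OF assms]])
  have y: "(0, y) = (\<Sum>b\<in>UNIV. y $ b *\<^sub>R (0 :: real^'n, axis b 1))"
    by (simp add: prod_eq_iff fst_sum snd_sum)
      (simp add: vec_eq_iff axis_def if_distrib cong: if_cong)
  have "frechet_derivative f (at (x, y)) (0, y) =
      (\<Sum>b\<in>UNIV. y $ b * frechet_derivative f (at (x, y)) (0, axis b 1))"
    by (subst y) (simp only: sum scale real_scaleR_def)
  then show ?thesis by (simp add: eul_def dy_def)
qed

text \<open>Euler's theorem, by differentiating \<open>t \<mapsto> f (x, t y)\<close> at \<open>t = 1\<close>.\<close>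

lemma eul_homogeneous:
  assumes "sm f" "z \<in> \<Omega>"
    and hom: "\<And>x y t. (x, y) \<in> \<Omega> \<Longrightarrow> t > 0 \<Longrightarrow> f (x, t *\<^sub>R y) = t ^ r * f (x, y)"
  shows "eul f z = r * f z"
proof -
  obtain x y where z: "z = (x, y)" by fastforce
  have 1: "(f has_derivative frechet_derivative f (at (x, y))) (at (x, 1 *\<^sub>R y))"
    using smooth_on_differentiable[OF assms(1,2)] by (simp add: z frechet_derivative_works)
  have "((\<lambda>t. f (x, t *\<^sub>R y)) has_derivative (\<lambda>s. frechet_derivative f (at (x, y)) (0, s *\<^sub>R y))) (at 1)"
    by (rule has_derivative_compose[of "\<lambda>t. (x, t *\<^sub>R y)" "\<lambda>s. (0, s *\<^sub>R y)" 1 UNIV f, OF _ 1])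
      (auto intro!: derivative_eq_intros)
  then have "((\<lambda>t. t ^ r * f (x, y)) has_derivative (\<lambda>s. frechet_derivative f (at (x, y)) (0, s *\<^sub>R y))) (at 1)"
    by (rule has_derivative_transform_within_open[of _ _ _ _ "{0<..}"]) (use assms(2) z hom in auto)
  moreover have "((\<lambda>t. t ^ r * f (x, y)) has_derivative (\<lambda>s. s * (r * f (x, y)))) (at 1)"
    by (auto intro!: derivative_eq_intros)
  ultimately have "(\<lambda>s. frechet_derivative f (at (x, y)) (0, s *\<^sub>R y)) = (\<lambda>s. s * (r * f (x, y)))"
    by (rule has_derivative_unique)
  from fun_cong[OF this, of 1] show ?thesis using eul_eq[OF assms(1)] assms(2) z by simp
qed

lemma eul_rules:
  assumes z: "z \<in> \<Omega>"
  shows "sm f \<Longrightarrow> sm k \<Longrightarrow> eul (\<lambda>z. f z + k z) z = eul f z + eul k z"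
    "sm f \<Longrightarrow> sm k \<Longrightarrow> eul (\<lambda>z. f z - k z) z = eul f z - eul k z"
    "sm f \<Longrightarrow> sm k \<Longrightarrow> eul (\<lambda>z. f z * k z) z = eul f z * k z + f z * eul k z"
    "(\<And>i. sm (u i)) \<Longrightarrow> eul (\<lambda>z. \<Sum>i\<in>UNIV. u i z) z = (\<Sum>i\<in>UNIV. eul (u i) z)"
    "sm f \<Longrightarrow> eul (\<lambda>z. f z / c) z = eul f z / c"
    "eul (\<lambda>z. c) z = 0"
    "eul (\<lambda>z. snd z $ j) z = snd z $ j"
    "sm f \<Longrightarrow> eul (dx k' f) z = dx k' (eul f) z"
    "sm f \<Longrightarrow> eul (dy k' f) z = dy k' (eul f) z - dy k' f z"
proof -
  show "(\<And>i. sm (u i)) \<Longrightarrow> eul (\<lambda>z. \<Sum>i\<in>UNIV. u i z) z = (\<Sum>i\<in>UNIV. eul (u i) z)"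
    by (simp add: eul_def leibniz z sum_distrib_left) (rule sum.swap)
  show "eul (\<lambda>z. snd z $ j) z = snd z $ j"
    by (simp add: eul_def leibniz axis_def if_distrib cong: if_cong)
  show "sm f \<Longrightarrow> eul (dx k' f) z = dx k' (eul f) z"
    unfolding eul_def[of f, abs_def] by (simp add: eul_def leibniz sm_rules dy_dx_commute z)
  show "sm f \<Longrightarrow> eul (dy k' f) z = dy k' (eul f) z - dy k' f z"
    unfolding eul_def[of f, abs_def] by (simp add: eul_def leibniz sm_rules dy_dy_commute[of f z k'] z sum.distrib)
qed (simp_all add: eul_def leibniz z sum.distrib sum_subtractf sum_negf algebra_simps sum_distrib_left sum_divide_distrib)

lemma eul_cong: "(\<And>w. w \<in> \<Omega> \<Longrightarrow> f w = k w) \<Longrightarrow> z \<in> \<Omega> \<Longrightarrow> eul f z = eul k z"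
  unfolding eul_def using dy_cong[of f k z] by simp

lemma eul_E: "z \<in> \<Omega> \<Longrightarrow> eul E z = 2 * E z"
  using eul_homogeneous[OF sm_E, of z 2] homogeneous
  by (auto simp: E_def power_mult_distrib)

lemma eul_dy_E: "z \<in> \<Omega> \<Longrightarrow> eul (dy k E) z = dy k E z"
  using dy_cong[of "eul E" "\<lambda>z. 2 * E z" z k] eul_E by (simp add: eul_rules sm_E leibniz sm_rules)

lemma eul_fund: "z \<in> \<Omega> \<Longrightarrow> eul (g i j) z = 0"
  using dy_cong[of "eul (dy j E)" "dy j E" z i] eul_dy_E
  by (simp add: fund_eq[abs_def] eul_rules sm_E sm_rules)

lemma fund_y: "z \<in> \<Omega> \<Longrightarrow> (\<Sum>b\<in>UNIV. g c b z * snd z $ b) = 1/2 * dy c E z"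
  using eul_dy_E[of z c] by (simp add: eul_def dy_dy_E fund_sym[of z c] sum_distrib_left mult_ac)

lemma fund_inv_dy_E: "z \<in> \<Omega> \<Longrightarrow> (\<Sum>b\<in>UNIV. h c b z * dy b E z) = 2 * snd z $ c"
  using raise_lower(1)[of z c "\<lambda>b. snd z $ b"] by (simp add: fund_y sum_divide_distrib[symmetric])

lemma fund_y_y: "z \<in> \<Omega> \<Longrightarrow> (\<Sum>a\<in>UNIV. snd z $ a * (\<Sum>b\<in>UNIV. g a b z * snd z $ b)) = E z"
  using eul_E[of z] by (simp add: fund_y eul_def sum_divide_distrib[symmetric])

lemma E_pos:
  assumes z: "z \<in> \<Omega>" shows "E z > 0"
proof -
  have "(\<Sum>i\<in>UNIV. \<Sum>j\<in>UNIV. g i j z * snd z $ i * snd z $ j) = E z"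
    unfolding fund_y_y[OF z, symmetric] by (simp add: sum_distrib_left mult_ac)
  moreover have "snd z \<noteq> 0" using z by auto
  ultimately show ?thesis using posdef[OF z, of "snd z"] by simp
qed

section \<open>The spray\<close>

text \<open>Homogeneity turns the Christoffel symbols contracted with \<open>y y\<close> into derivatives of \<open>E\<close>, because
\<open>g\<^sub>c\<^sub>b y\<^sup>b = E\<^sub>\<cdot>\<^sub>c / 2\<close> and \<open>g\<^sub>a\<^sub>b y\<^sup>a y\<^sup>b = E\<close>.\<close>

lemma spray_eq:
  assumes z: "z \<in> \<Omega>"
  shows "spray L i z = 1/4 * (\<Sum>c\<in>UNIV. h i c z * ((\<Sum>a\<in>UNIV. snd z $ a * dx a (dy c E) z) - dx c E z))"
proof -
  have 1: "(\<Sum>b\<in>UNIV. dx a (g c b) z * snd z $ b) = 1/2 * dx a (dy c E) z" for a c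
    using dx_cong[of "\<lambda>z. \<Sum>b\<in>UNIV. g c b z * snd z $ b" "\<lambda>z. 1/2 * dy c E z" z a] fund_y z
    by (simp add: leibniz sm_rules sm_fund sm_E)
  have one: "(\<Sum>a\<in>UNIV. dx b (g a c) z * snd z $ a) = 1/2 * dx b (dy c E) z" for b c
  proof -
    have "dx b (g a c) z = dx b (g c a) z" for a by (rule dx_cong[OF fund_sym z])
    then show ?thesis using 1[of b c] by simp
  qed
  have 2: "(\<Sum>a\<in>UNIV. snd z $ a * (\<Sum>b\<in>UNIV. dx c (g a b) z * snd z $ b)) = dx c E z" for c
    using dx_cong[of "\<lambda>z. \<Sum>a\<in>UNIV. snd z $ a * (\<Sum>b\<in>UNIV. g a b z * snd z $ b)" E z c] fund_y_y z
    by (simp add: leibniz sm_rules sm_fund sm_E)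
  have "(\<Sum>a\<in>UNIV. \<Sum>b\<in>UNIV. h i c z * (dx a (g c b) z + dx b (g a c) z - dx c (g a b) z) * snd z $ a * snd z $ b)
      = h i c z * ((\<Sum>a\<in>UNIV. snd z $ a * dx a (dy c E) z) - dx c E z)" for c
  proof -
    have sw: "(\<Sum>a\<in>UNIV. \<Sum>b\<in>UNIV. dx b (g a c) z * snd z $ a * snd z $ b) = (\<Sum>b\<in>UNIV. (\<Sum>a\<in>UNIV. dx b (g a c) z * snd z $ a) * snd z $ b)"
      unfolding sum_distrib_right by (rule sum.swap)
    have "(\<Sum>a\<in>UNIV. \<Sum>b\<in>UNIV. h i c z * (dx a (g c b) z + dx b (g a c) z - dx c (g a b) z) * snd z $ a * snd z $ b)
      = h i c z * ((\<Sum>a\<in>UNIV. (\<Sum>b\<in>UNIV. dx a (g c b) z * snd z $ b) * snd z $ a)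
       + (\<Sum>a\<in>UNIV. \<Sum>b\<in>UNIV. dx b (g a c) z * snd z $ a * snd z $ b)
       - (\<Sum>a\<in>UNIV. snd z $ a * (\<Sum>b\<in>UNIV. dx c (g a b) z * snd z $ b)))"
      by (simp add: sum_distrib_left sum_distrib_right sum.distrib sum_subtractf algebra_simps)
    then show ?thesis unfolding sw 2 unfolding 1 one
      by (simp add: sum_distrib_left[symmetric] sum_divide_distrib[symmetric] mult.commute)
  qed
  then show ?thesis by (simp add: spray_def)
qed

lemma fund_spray: "z \<in> \<Omega> \<Longrightarrow>
    4 * (\<Sum>i\<in>UNIV. g c i z * spray L i z) = (\<Sum>a\<in>UNIV. snd z $ a * dx a (dy c E) z) - dx c E z"
  using raise_lower(2)[of z c "\<lambda>c. (\<Sum>a\<in>UNIV. snd z $ a * dx a (dy c E) z) - dx c E z"]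
  by (simp add: spray_eq sum_divide_distrib[symmetric])

lemma sm_spray: "sm (spray L i)"
  by (subst sm_cong[OF spray_eq]) (assumption, intro sm_rules sm_fund_inv sm_E)

sublocale spray_calculus \<Omega> "spray L"
  by standard (rule sm_spray)

abbreviation G :: "'n \<Rightarrow> 'n cfun" where "G \<equiv> spray L"

lemma hor_eq: "hor L = \<delta>"
  by (intro ext) (simp add: hor_def hder_def)

text \<open>The covector \<open>4 g\<^sub>c\<^sub>i G\<^sup>i\<close> is 2-homogeneous by \<open>fund_spray\<close>, and \<open>g\<close> is 0-homogeneous and invertible.\<close>

lemma eul_spray:
  assumes z: "z \<in> \<Omega>"
  shows "eul (G i) z = 2 * G i z"
proof -
  let ?A = "\<lambda>c z. (\<Sum>a\<in>UNIV. snd z $ a * dx a (dy c E) z) - dx c E z"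
  have "(\<Sum>i\<in>UNIV. g c i z * eul (G i) z) = (\<Sum>i\<in>UNIV. g c i z * (2 * G i z))" for c
  proof -
    have 1: "dx a (eul (dy c E)) z = dx a (dy c E) z" for a
      by (rule dx_cong[OF eul_dy_E z])
    have 2: "dx c (eul E) z = 2 * dx c E z"
      using dx_cong[OF eul_E z] z by (simp add: leibniz sm_rules sm_E)
    have "eul (?A c) z = 2 * ?A c z"
      using z by (simp add: eul_rules sm_rules sm_E 1 2 sum.distrib sum_distrib_left sum_negf algebra_simps)
    moreover have "eul (?A c) z = eul (\<lambda>z. 4 * (\<Sum>i\<in>UNIV. g c i z * G i z)) z"
      by (rule eul_cong) (use fund_spray z in auto)
    moreover have "\<dots> = 4 * (\<Sum>i\<in>UNIV. g c i z * eul (G i) z)"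
      using z by (simp add: eul_rules smooth sm_fund eul_fund)
    ultimately show ?thesis
      using fund_spray[OF z, of c] by (simp add: sum_distrib_left[symmetric] mult.left_commute)
  qed
  then show ?thesis by (rule fund_cancel[OF z])
qed

lemma N_y: "z \<in> \<Omega> \<Longrightarrow> (\<Sum>k\<in>UNIV. N i k z * snd z $ k) = 2 * G i z"
  using eul_spray[of z i] by (simp add: eul_def mult.commute)

lemma hder_y: "z \<in> \<Omega> \<Longrightarrow> (\<Sum>k\<in>UNIV. snd z $ k * \<delta> k f z) = S f z"
proof -
  assume z: "z \<in> \<Omega>"
  have "(\<Sum>k\<in>UNIV. \<Sum>a\<in>UNIV. snd z $ k * (N a k z * dy a f z)) = (\<Sum>a\<in>UNIV. 2 * G a z * dy a f z)"
    unfolding N_y[OF z, symmetric] sum_distrib_right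
    by (subst sum.swap) (simp add: mult_ac)
  then show ?thesis
    by (simp add: hder_def sder_def right_diff_distrib sum_subtractf sum_distrib_left mult_ac)
qed

end

context local_finsler
begin

section \<open>Horizontal constancy of the metric\<close>

lemmas smooth_fin = smooth sm_E sm_fund sm_fund_inv

text \<open>The Euler--Lagrange equation of the energy \<open>E\<close>. It determines \<open>G\<close>, and everything about the
compatibility of the nonlinear connection with the metric follows from it by differentiation: first
that \<open>E\<close> is constant along \<open>S\<close>, then that \<open>\<delta>\<^sub>k E = 0\<close>, finally \<open>\<nabla>g = 0\<close>.\<close>

lemma sder_dy_E_dx: "z \<in> \<Omega> \<Longrightarrow> S (dy c E) z = dx c E z"
  using fund_spray[of z c]
  by (simp add: sder_def dy_dy_E fund_sym[of z c] sum_distrib_left mult_ac)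

text \<open>Contracting the Euler--Lagrange equation with \<open>y\<close> gives \<open>2 S E = S E\<close>.\<close>

lemma sder_E: "z \<in> \<Omega> \<Longrightarrow> S E z = 0"
proof -
  assume z: "z \<in> \<Omega>"
  have "S (\<lambda>z. \<Sum>c\<in>UNIV. snd z $ c * dy c E z) z = S (\<lambda>z. 2 * E z) z"
    by (rule sder_cong[OF _ z]) (use eul_E in \<open>simp add: eul_def\<close>)
  then have "(\<Sum>c\<in>UNIV. - (2 * G c z * dy c E z) + snd z $ c * dx c E z) = 2 * S E z"
    using z by (simp add: deriv_rules smooth_fin sder_dy_E_dx)
  moreover have "(\<Sum>c\<in>UNIV. - (2 * G c z * dy c E z) + snd z $ c * dx c E z) = S E z"
    by (simp add: sum.distrib sum_negf sum_subtractf sder_def sum_distrib_left mult_ac)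
  ultimately show ?thesis by simp
qed

lemma hder_E: "z \<in> \<Omega> \<Longrightarrow> \<delta> k E z = 0"
  using dy_cong[of "S E" "\<lambda>z. 0" z k] sder_E dy_sder[OF sm_E, of z k]
  by (simp add: leibniz sder_dy_E_dx) (simp add: hder_def)

lemma sder_dy_E: "z \<in> \<Omega> \<Longrightarrow> S (dy k E) z = (\<Sum>a\<in>UNIV. N a k z * dy a E z)"
  using hder_E[of z k] by (simp add: sder_dy_E_dx hder_def)

lemma hder_dy_E: "z \<in> \<Omega> \<Longrightarrow> \<delta> l (dy k E) z = (\<Sum>a\<in>UNIV. dy k (N a l) z * dy a E z)"
  using dy_cong[of "\<delta> l E" "\<lambda>z. 0" z k] hder_E dy_hder[OF sm_E, of z k l] by (simp add: leibniz)

lemma sder_fund: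
  "z \<in> \<Omega> \<Longrightarrow> S (g l k) z = (\<Sum>a\<in>UNIV. N a l z * g a k z) + (\<Sum>a\<in>UNIV. N a k z * g l a z)"
proof -
  assume z: "z \<in> \<Omega>"
  have "S (dy l (dy k E)) z = (\<Sum>a\<in>UNIV. N a l z * dy a (dy k E) z) + (\<Sum>a\<in>UNIV. N a k z * dy l (dy a E) z)"
    using dy_cong[of "S (dy k E)" "\<lambda>z. \<Sum>a\<in>UNIV. N a k z * dy a E z" z l] sder_dy_E dy_sder[OF sm_dy[OF sm_E] z, of l k] z
    by (simp add: leibniz smooth_fin hder_dy_E sum.distrib dy_dy_commute[OF smooth_spray, of z l k])
  moreover have "S (g l k) z = S (dy l (dy k E)) z / 2"
    unfolding fund_eq[abs_def] using z by (simp add: deriv_rules smooth_fin)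
  ultimately show ?thesis by (simp add: dy_dy_E sum_distrib_left[symmetric] mult.left_commute)
qed

text \<open>\<open>y\<^sub>a G\<^sup>a\<^sub>\<cdot>\<^sub>l\<^sub>\<cdot>\<^sub>k\<^sub>\<cdot>\<^sub>m\<close>, which is a constant multiple of the Landsberg tensor. In this form its total symmetry
is evident.\<close>

definition Lan :: "'n \<Rightarrow> 'n \<Rightarrow> 'n \<Rightarrow> 'n cfun" where
  "Lan l k m z = 1/2 * (\<Sum>a\<in>UNIV. dy m (dy k (N a l)) z * dy a E z)"

lemma Lan_sym: "z \<in> \<Omega> \<Longrightarrow> Lan l k m z = Lan k l m z" "z \<in> \<Omega> \<Longrightarrow> Lan l k m z = Lan l m k z"
proof -
  assume z: "z \<in> \<Omega>"
  have "dy m (dy k (N a l)) z = dy m (dy l (N a k)) z" for a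
    by (rule dy_cong[OF _ z]) (rule dy_dy_commute[OF smooth_spray])
  then show "Lan l k m z = Lan k l m z" by (simp add: Lan_def)
  show "Lan l k m z = Lan l m k z" using z by (simp add: Lan_def dy_dy_commute[of "N _ l" z m] smooth)
qed

text \<open>The Berwald derivative of the metric is the tensor \<open>Lan\<close>, by differentiating \<open>\<delta>\<^sub>l E = 0\<close> twice in \<open>y\<close>.\<close>

lemma hder_fund:
  "z \<in> \<Omega> \<Longrightarrow> \<delta> l (g k m) z = Lan l k m z + (\<Sum>a\<in>UNIV. dy k (N a l) z * g a m z) + (\<Sum>a\<in>UNIV. dy m (N a l) z * g k a z)"
proof -
  assume z: "z \<in> \<Omega>"
  have "\<delta> l (dy m (dy k E)) z = (\<Sum>a\<in>UNIV. dy m (dy k (N a l)) z * dy a E z)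
      + (\<Sum>a\<in>UNIV. dy k (N a l) z * dy m (dy a E) z) + (\<Sum>a\<in>UNIV. dy m (N a l) z * dy a (dy k E) z)"
    using dy_cong[of "\<delta> l (dy k E)" "\<lambda>z. \<Sum>a\<in>UNIV. dy k (N a l) z * dy a E z" z m] hder_dy_E dy_hder[OF sm_dy[OF sm_E] z, of m l k] z
    by (simp add: leibniz smooth_fin sum.distrib)
  moreover have "\<delta> l (g m k) z = \<delta> l (dy m (dy k E)) z / 2"
    unfolding fund_eq[abs_def] using z by (simp add: deriv_rules smooth_fin)
  moreover have "\<delta> l (g m k) z = \<delta> l (g k m) z" by (rule hder_cong[OF fund_sym z])
  ultimately show ?thesis 
    by (simp add: dy_dy_E Lan_def sum_distrib_left[symmetric] mult.left_commute fund_sym[OF z, of m] fund_sym[OF z, of _ k])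
qed

section \<open>The Jacobi endomorphism\<close>

text \<open>Apply the bracket of \<open>S\<close> and \<open>\<delta>\<^sub>k\<close> to \<open>E\<close>, which both annihilate.\<close>

lemma jacobi_dy_E: "z \<in> \<Omega> \<Longrightarrow> (\<Sum>i\<in>UNIV. R i k z * dy i E z) = 0"
  using sder_hder[OF sm_E, of z k] sder_cong[of "\<delta> k E" "\<lambda>z. 0" z "spray L"]
    hder_cong[of "S E" "\<lambda>z. 0" z "spray L" k] sder_E
  by (simp add: hder_E deriv_rules)

lemma dy_jacobi:
  "z \<in> \<Omega> \<Longrightarrow> dy l (R i k) z = 2 * \<delta> k (N i l) z - \<delta> l (N i k) z - S (dy l (N i k)) z
     + (\<Sum>c\<in>UNIV. N c l z * dy c (N i k) z) + (\<Sum>c\<in>UNIV. N c k z * dy c (N i l) z) - (\<Sum>c\<in>UNIV. N i c z * dy l (N c k) z)"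
proof -
  assume z: "z \<in> \<Omega>"
  have c: "dy l (N i c) z = dy c (N i l) z" for c by (rule dy_dy_commute[OF smooth_spray z])
  have h: "dx k (N i l) z = \<delta> k (N i l) z + (\<Sum>c\<in>UNIV. N c k z * dy c (N i l) z)"
    by (simp add: hder_def)
  show ?thesis unfolding jacobi_def[abs_def] using z h
    by (simp add: leibniz smooth dy_dx_commute dy_sder c sum.distrib algebra_simps)
qed

lemma dy_jacobi_antisym:
  assumes z: "z \<in> \<Omega>"
  shows "dy l (R i k) z - dy k (R i l) z = 3 * (\<delta> k (N i l) z - \<delta> l (N i k) z)"
proof -
  have c: "dy l (N i k) w = dy k (N i l) w" if "w \<in> \<Omega>" for i w by (rule dy_dy_commute[OF smooth_spray that])
  have "S (dy l (N i k)) z = S (dy k (N i l)) z" by (rule sder_cong[OF c z])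
  then show ?thesis using c[OF z] unfolding dy_jacobi[OF z] by simp
qed

lemma curvature_dy_E:
  assumes z: "z \<in> \<Omega>"
  shows "(\<Sum>c\<in>UNIV. (\<delta> j (N c k) z - \<delta> k (N c j) z) * dy c E z) = 0"
proof -
  have "\<delta> j (\<delta> k E) z = 0" for j k
    using hder_cong[of "\<delta> k E" "\<lambda>z. 0" z "spray L" j] hder_E z by (simp add: deriv_rules)
  then show ?thesis using hder_hder[OF sm_E z, of j k] by simp
qed

text \<open>Differentiating \<open>R\<^sup>i\<^sub>k E\<^sub>\<cdot>\<^sub>i = 0\<close> in \<open>y\<^sup>l\<close>, the part antisymmetric in \<open>k, l\<close> contains \<open>R\<^sup>i\<^sub>k\<^sub>\<cdot>\<^sub>l - R\<^sup>i\<^sub>l\<^sub>\<cdot>\<^sub>k\<close>, three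
times the curvature of the nonlinear connection, and this annihilates \<open>E\<close> as well.\<close>

lemma jacobi_sym:
  assumes z: "z \<in> \<Omega>"
  shows "(\<Sum>i\<in>UNIV. g l i z * R i k z) = (\<Sum>i\<in>UNIV. g k i z * R i l z)"
proof -
  have 1: "(\<Sum>i\<in>UNIV. dy l (R i k) z * dy i E z) + 2 * (\<Sum>i\<in>UNIV. g l i z * R i k z) = 0" for l k
    using dy_cong[of "\<lambda>z. \<Sum>i\<in>UNIV. R i k z * dy i E z" "\<lambda>z. 0" z l] jacobi_dy_E z
    by (simp add: leibniz smooth_fin sum.distrib dy_dy_E sum_distrib_left mult_ac)
  have "(\<Sum>i\<in>UNIV. dy l (R i k) z * dy i E z) - (\<Sum>i\<in>UNIV. dy k (R i l) z * dy i E z) =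
     3 * (\<Sum>c\<in>UNIV. (\<delta> k (N c l) z - \<delta> l (N c k) z) * dy c E z)"
    unfolding sum_subtractf[symmetric] left_diff_distrib[symmetric] dy_jacobi_antisym[OF z]
    by (simp add: sum_distrib_left left_diff_distrib right_diff_distrib mult_ac)
  then show ?thesis using 1[of l k] 1[of k l] curvature_dy_E[OF z, of k l] by simp
qed

lemma jacobi_y:
  assumes z: "z \<in> \<Omega>"
  shows "(\<Sum>k\<in>UNIV. R i k z * snd z $ k) = 0"
proof -
  have "S (\<lambda>z. \<Sum>k\<in>UNIV. N i k z * snd z $ k) z = S (\<lambda>z. 2 * G i z) z"
    by (rule sder_cong[OF N_y z])
  then have 1: "(\<Sum>k\<in>UNIV. S (N i k) z * snd z $ k) - 2 * (\<Sum>k\<in>UNIV. G k z * N i k z) = 2 * S (G i) z"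
    using z by (simp add: deriv_rules smooth sum.distrib sum_negf sum_subtractf sum_distrib_left mult_ac)
  have 2: "(\<Sum>k\<in>UNIV. (\<Sum>j\<in>UNIV. N i j z * N j k z) * snd z $ k) = 2 * (\<Sum>k\<in>UNIV. G k z * N i k z)"
  proof -
    have "(\<Sum>k\<in>UNIV. (\<Sum>j\<in>UNIV. N i j z * N j k z) * snd z $ k) = (\<Sum>j\<in>UNIV. N i j z * (\<Sum>k\<in>UNIV. N j k z * snd z $ k))"
      unfolding sum_distrib_left sum_distrib_right mult.assoc by (rule sum.swap)
    then show ?thesis unfolding N_y[OF z] by (simp add: sum_distrib_left mult_ac)
  qed
  have "(\<Sum>k\<in>UNIV. R i k z * snd z $ k) = 2 * (\<Sum>k\<in>UNIV. snd z $ k * dx k (G i) z)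
     - (\<Sum>k\<in>UNIV. S (N i k) z * snd z $ k) - (\<Sum>k\<in>UNIV. (\<Sum>j\<in>UNIV. N i j z * N j k z) * snd z $ k)"
    by (simp add: jacobi_def left_diff_distrib right_diff_distrib sum_subtractf sum_distrib_left mult_ac)
  then show ?thesis using 1 2 by (simp add: sder_def[of _ "G i"])
qed

section \<open>The Chern connection\<close>

lemma chern_eq: "chern L i j k z = 1/2 * (\<Sum>l\<in>UNIV. h i l z *
     (\<delta> j (g l k) z + \<delta> k (g l j) z - \<delta> l (g j k) z))"
  by (simp add: chern_def hor_eq)

text \<open>The Chern and the Berwald connection differ by the Landsberg tensor.\<close>

lemma chern_berwald:
  assumes z: "z \<in> \<Omega>"
  shows "chern L i j k z = dy k (N i j) z + 1/2 * (\<Sum>l\<in>UNIV. h i l z * Lan l j k z)"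
proof -
  have c: "dy l (N i k) z = dy k (N i l) z" for i k l by (rule dy_dy_commute[OF smooth_spray z])
  have "\<delta> j (g l k) z + \<delta> k (g l j) z - \<delta> l (g j k) z = Lan l j k z + 2 * (\<Sum>a\<in>UNIV. g l a z * dy k (N a j) z)" for l
  proof -
    have L: "Lan j l k z = Lan l j k z" "Lan k l j z = Lan l j k z"
      using Lan_sym(1)[OF z, of j l k] Lan_sym(1)[OF z, of k l j] Lan_sym(2)[OF z, of l k j] by auto
    have c1: "dy l (N a j) z = dy j (N a l) z" "dy l (N a k) z = dy k (N a l) z" "dy j (N a k) z = dy k (N a j) z" for a
      by (rule c)+
    have g1: "(\<Sum>a\<in>UNIV. dy k (N a l) z * g a j z) = (\<Sum>a\<in>UNIV. dy k (N a l) z * g j a z)"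
      by (intro sum.cong refl arg_cong2[where f="(*)"] fund_sym z)
    show ?thesis unfolding hder_fund[OF z] L c1 g1 by (simp add: mult.commute)
  qed
  then have "chern L i j k z = 1/2 * (\<Sum>l\<in>UNIV. h i l z * (Lan l j k z + 2 * (\<Sum>a\<in>UNIV. g l a z * dy k (N a j) z)))"
    by (simp add: chern_eq)
  also have "\<dots> = 1/2 * (\<Sum>l\<in>UNIV. h i l z * Lan l j k z) + (\<Sum>l\<in>UNIV. h i l z * (\<Sum>a\<in>UNIV. g l a z * dy k (N a j) z))"
    by (simp add: distrib_left sum.distrib mult.left_commute[of _ 2] sum_distrib_left[symmetric])
  finally show ?thesis unfolding raise_lower[OF z] by simp
qed

lemma eul_N: "z \<in> \<Omega> \<Longrightarrow> eul (N a l) z = N a l z"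
  using dy_cong[of "eul (G a)" "\<lambda>z. 2 * G a z" z l] eul_spray by (simp add: eul_rules smooth leibniz)

lemma Lan_y:
  assumes z: "z \<in> \<Omega>"
  shows "(\<Sum>k\<in>UNIV. Lan l j k z * snd z $ k) = 0"
proof -
  have e1: "eul (N a l) w = N a l w" if "w \<in> \<Omega>" for a w l
    by (rule eul_N[OF that])
  have e2: "eul (dy j (N a l)) z = 0" for a
    using dy_cong[of "eul (N a l)" "N a l" z j] e1 z by (simp add: eul_rules smooth leibniz)
  have "(\<Sum>k\<in>UNIV. Lan l j k z * snd z $ k) = 1/2 * (\<Sum>a\<in>UNIV. eul (dy j (N a l)) z * dy a E z)"
    unfolding Lan_def eul_def sum_distrib_left sum_distrib_right
    by (subst sum.swap) (simp add: mult_ac)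
  then show ?thesis by (simp add: e2)
qed

lemma chern_y:
  assumes z: "z \<in> \<Omega>"
  shows "(\<Sum>k\<in>UNIV. chern L l k i z * snd z $ k) = N l i z"
    and "(\<Sum>k\<in>UNIV. chern L l i k z * snd z $ k) = N l i z"
proof -
  have e1: "eul (N a l) z = N a l z" for a l
    by (rule eul_N[OF z])
  have c: "dy l (N i k) z = dy k (N i l) z" for i k l by (rule dy_dy_commute[OF smooth_spray z])
  have s: "(\<Sum>k\<in>UNIV. 1/2 * (\<Sum>m\<in>UNIV. h l m z * Lan m i k z) * snd z $ k) = 1/2 * (\<Sum>m\<in>UNIV. h l m z * (\<Sum>k\<in>UNIV. Lan m i k z * snd z $ k))"
    unfolding sum_distrib_left sum_distrib_right mult.assoc by (rule sum.swap)
  have "(\<Sum>k\<in>UNIV. chern L l i k z * snd z $ k) = eul (N l i) z + (\<Sum>k\<in>UNIV. 1/2 * (\<Sum>m\<in>UNIV. h l m z * Lan m i k z) * snd z $ k)"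
    unfolding chern_berwald[OF z] distrib_right sum.distrib by (simp add: eul_def mult.commute)
  then show 1: "(\<Sum>k\<in>UNIV. chern L l i k z * snd z $ k) = N l i z"
    unfolding s Lan_y[OF z] e1 by simp
  have "chern L l k i z = chern L l i k z" for k
  proof -
    have "dy i (N l k) z = dy k (N l i) z" by (rule c)
    then show ?thesis unfolding chern_berwald[OF z] using Lan_sym(2)[OF z, of _ k i] by simp
  qed
  then show "(\<Sum>k\<in>UNIV. chern L l k i z * snd z $ k) = N l i z" using 1 by simp
qed

lemma sm_chern: "sm (chern L i j k)"
  unfolding chern_eq[abs_def] by (simp add: smooth_fin)

lemma cov1_0_eq: "z \<in> \<Omega> \<Longrightarrow> cov1_0 L \<theta> i z = dyn1 G \<theta> i z"
proof -
  assume z: "z \<in> \<Omega>"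
  have "(\<Sum>j\<in>UNIV. (\<Sum>k\<in>UNIV. chern L k j i z * \<theta> k z) * snd z $ j) = (\<Sum>k\<in>UNIV. N k i z * \<theta> k z)"
    unfolding chern_y(1)[OF z, symmetric] sum_distrib_right by (subst sum.swap) (simp add: mult_ac)
  then show ?thesis using hder_y[OF z, of "\<theta> i"]
    by (simp add: cov1_0_def cov1_def hor_eq right_diff_distrib left_diff_distrib sum_subtractf dyn1_def mult.commute)
qed

definition dyn02 :: "('n \<Rightarrow> 'n \<Rightarrow> 'n cfun) \<Rightarrow> 'n \<Rightarrow> 'n \<Rightarrow> 'n cfun" where
  "dyn02 T i j z = S (T i j) z - (\<Sum>l\<in>UNIV. N l i z * T l j z) - (\<Sum>l\<in>UNIV. N l j z * T i l z)"

lemma cov2_0_eq: "z \<in> \<Omega> \<Longrightarrow> cov2_0 L T i j z = dyn02 T i j z"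
proof -
  assume z: "z \<in> \<Omega>"
  have "(\<Sum>k\<in>UNIV. (\<Sum>l\<in>UNIV. chern L l k i z * u l) * snd z $ k) = (\<Sum>l\<in>UNIV. N l i z * u l)" for u i
    unfolding chern_y(1)[OF z, symmetric] sum_distrib_right by (subst sum.swap) (simp add: mult_ac)
  then show ?thesis using hder_y[OF z, of "T i j"]
    by (simp add: cov2_0_def cov2_def hor_eq right_diff_distrib left_diff_distrib sum_subtractf dyn02_def mult.commute)
qed

section \<open>Derivatives of the inverse metric\<close>

text \<open>\<open>d(g\<^sup>-\<^sup>1) = - g\<^sup>-\<^sup>1 dg g\<^sup>-\<^sup>1\<close>, for an arbitrary direction so that it serves \<open>S\<close> and \<open>\<partial>/\<partial>y\<close> alike.\<close>

lemma fderiv_fund_inv: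
  assumes z: "z \<in> \<Omega>"
  shows "frechet_derivative (h i d) (at z) v =
    - (\<Sum>b\<in>UNIV. \<Sum>c\<in>UNIV. h i b z * frechet_derivative (g b c) (at z) v * h c d z)"
proof -
  let ?D = "\<lambda>f. frechet_derivative f (at z) v"
  have d: "h i j differentiable (at z)" "g i j differentiable (at z)" for i j
    using smooth_on_differentiable sm_fund_inv sm_fund z by blast+
  have 1: "(\<Sum>b\<in>UNIV. ?D (h i b) * g b c z) = - (\<Sum>b\<in>UNIV. h i b z * ?D (g b c))" for c
  proof -
    have "?D (\<lambda>z. \<Sum>b\<in>UNIV. h i b z * g b c z) = ?D (\<lambda>z. if i = c then 1 else 0)"
      by (rule fderiv_cong[OF fund_inv_fund z])
    moreover have "?D (\<lambda>z. \<Sum>b\<in>UNIV. h i b z * g b c z) = (\<Sum>b\<in>UNIV. ?D (\<lambda>z. h i b z * g b c z))"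
      using d by (intro fderiv_sum) (auto intro!: derivative_intros)
    ultimately show ?thesis by (simp add: fderiv_mult d sum.distrib)
  qed
  have "?D (h i d) = (\<Sum>b\<in>UNIV. ?D (h i b) * (\<Sum>c\<in>UNIV. g b c z * h c d z))"
    by (simp add: fund_fund_inv[OF z] mult_delta_right)
  also have "\<dots> = (\<Sum>c\<in>UNIV. (\<Sum>b\<in>UNIV. ?D (h i b) * g b c z) * h c d z)"
    unfolding sum_distrib_left sum_distrib_right mult.assoc by (rule sum.swap)
  also have "\<dots> = - (\<Sum>c\<in>UNIV. \<Sum>b\<in>UNIV. h i b z * ?D (g b c) * h c d z)"
    unfolding 1 by (simp add: sum_negf sum_distrib_right)
  also have "\<dots> = - (\<Sum>b\<in>UNIV. \<Sum>c\<in>UNIV. h i b z * ?D (g b c) * h c d z)"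
    by (subst sum.swap) simp
  finally show ?thesis .
qed

end

context coordinate_calculus
begin

lemma fderiv_components:
  assumes "sm f" "z \<in> \<Omega>"
  shows "frechet_derivative f (at z) (v, w) = (\<Sum>i\<in>UNIV. v $ i * dx i f z) + (\<Sum>i\<in>UNIV. w $ i * dy i f z)"
proof -
  interpret linear "frechet_derivative f (at z)"
    by (rule linear_frechet_derivative[OF smooth_on_differentiable[OF assms]])
  have "(v, w) = (\<Sum>i\<in>UNIV. v $ i *\<^sub>R (axis i 1, 0 :: real^'n)) + (\<Sum>i\<in>UNIV. w $ i *\<^sub>R (0 :: real^'n, axis i 1))"
    by (simp add: prod_eq_iff fst_sum snd_sum)
      (simp add: vec_eq_iff axis_def if_distrib cong: if_cong)
  then show ?thesis by (simp only: add sum scale real_scaleR_def dx_def dy_def)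
qed

end

context spray_calculus
begin

lemma sder_eq_fderiv:
  "sm f \<Longrightarrow> z \<in> \<Omega> \<Longrightarrow> S f z = frechet_derivative f (at z) (snd z, \<chi> i. - 2 * G i z)"
  by (simp add: fderiv_components sder_def sum_negf sum_distrib_left mult.assoc)

lemma hder_eq_fderiv:
  "sm f \<Longrightarrow> z \<in> \<Omega> \<Longrightarrow> \<delta> k f z = frechet_derivative f (at z) (axis k 1, \<chi> a. - N a k z)"
  by (simp add: fderiv_components hder_def sum_negf)

end

context local_finsler
begin

section \<open>The volume density and the mean Landsberg tensor\<close>

text \<open>\<open>\<sigma> = ln |det g| / 2\<close>; the square avoids a discussion of the sign of the determinant. Its vertical
gradient is the mean Cartan tensor \<open>I\<close>.\<close>

definition \<sigma> :: "'n cfun" where "\<sigma> z = ln ((det (\<chi> i j. g i j z))\<^sup>2) / 4"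

lemma sm_\<sigma>: "sm \<sigma>"
  unfolding \<sigma>_def[abs_def]
  by (intro sm_divide smooth_on_ln smooth_on_power smooth_on_det open_dom sm_fund)
    (simp add: det_fund)

lemma fderiv_\<sigma>:
  assumes z: "z \<in> \<Omega>"
  shows "frechet_derivative \<sigma> (at z) v =
    1/2 * (\<Sum>i\<in>UNIV. \<Sum>j\<in>UNIV. h i j z * frechet_derivative (g j i) (at z) v)"
proof -
  let ?d = "\<lambda>z. det (\<chi> i j. g i j z)"
  have nz: "?d z \<noteq> 0" by (rule det_fund[OF z])
  have d: "g i j differentiable (at z)" for i j
    by (rule smooth_on_differentiable[OF sm_fund z])
  have dd: "?d differentiable (at z)" 
    by (rule smooth_on_differentiable[OF smooth_on_det[OF open_dom sm_fund] z])
  have d2: "(\<lambda>z. ?d z * ?d z) differentiable (at z)" by (rule differentiable_mult[OF dd dd])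
  have pos: "?d z * ?d z > 0" using nz by (metis not_real_square_gt_zero)
  have "(\<lambda>z. ln (?d z * ?d z)) differentiable (at z)"
    using has_derivative_ln[OF pos has_derivative_frechet[OF d2]] by (rule differentiableI)
  then have "frechet_derivative \<sigma> (at z) v = 1/4 * frechet_derivative (\<lambda>z. ln (?d z * ?d z)) (at z) v"
    using fderiv_mult[of "\<lambda>z. 1/4" z "\<lambda>z. ln (?d z * ?d z)" v]
    by (simp add: \<sigma>_def[abs_def] power2_eq_square)
  also have "\<dots> = 1/4 * (inverse (?d z * ?d z) * (2 * ?d z * frechet_derivative ?d (at z) v))"
    by (simp add: fderiv_ln[OF d2 pos] fderiv_mult[OF dd dd])
  also have "\<dots> = 1/2 * (\<Sum>i\<in>UNIV. \<Sum>j\<in>UNIV. h i j z * frechet_derivative (g j i) (at z) v)"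
    using nz by (simp add: fderiv_det(2)[OF d nz] fund_inv_def field_simps)
  finally show ?thesis .
qed

lemma dy_\<sigma>: "z \<in> \<Omega> \<Longrightarrow> dy k \<sigma> z = 1/2 * (\<Sum>i\<in>UNIV. \<Sum>j\<in>UNIV. h i j z * dy k (g j i) z)"
  by (simp add: dy_def fderiv_\<sigma>)

lemma hder_\<sigma>: "z \<in> \<Omega> \<Longrightarrow> \<delta> k \<sigma> z = 1/2 * (\<Sum>i\<in>UNIV. \<Sum>j\<in>UNIV. h i j z * \<delta> k (g j i) z)"
  by (simp add: hder_eq_fderiv sm_\<sigma> sm_fund fderiv_\<sigma>)

text \<open>Half the trace of \<open>\<nabla>g = 0\<close>.\<close>

lemma sder_\<sigma>: "z \<in> \<Omega> \<Longrightarrow> S \<sigma> z = \<tau> z"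
proof -
  assume z: "z \<in> \<Omega>"
  have 1: "(\<Sum>i\<in>UNIV. \<Sum>j\<in>UNIV. h i j z * (\<Sum>a\<in>UNIV. N a i z * g j a z)) = \<tau> z"
    using raise_lower(1)[OF z] by (simp add: \<tau>_def mult.commute[of _ "g _ _ z"])
  have "(\<Sum>i\<in>UNIV. \<Sum>j\<in>UNIV. h i j z * (\<Sum>a\<in>UNIV. N a j z * g a i z)) =
      (\<Sum>i\<in>UNIV. \<Sum>j\<in>UNIV. h i j z * (\<Sum>a\<in>UNIV. N a i z * g j a z))"
    by (subst sum.swap) (intro sum.cong refl arg_cong2[where f = "(*)"] fund_sym fund_inv_sym z)
  moreover have "S \<sigma> z = 1/2 * (\<Sum>i\<in>UNIV. \<Sum>j\<in>UNIV. h i j z * S (g j i) z)"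
    by (simp add: sder_eq_fderiv sm_\<sigma> sm_fund z fderiv_\<sigma>)
  ultimately show ?thesis using 1
    by (simp add: sder_fund[OF z] distrib_left sum.distrib)
qed

text \<open>This is \<open>\<nabla>g\<^sup>-\<^sup>1 = 0\<close>.\<close>

lemma sder_fund_inv:
  assumes z: "z \<in> \<Omega>"
  shows "S (h i d) z = - (\<Sum>b\<in>UNIV. h i b z * N d b z) - (\<Sum>c\<in>UNIV. N i c z * h c d z)"
proof -
  have "S (h i d) z = - (\<Sum>b\<in>UNIV. \<Sum>c\<in>UNIV. h i b z * S (g b c) z * h c d z)"
    by (simp add: sder_eq_fderiv sm_fund sm_fund_inv z fderiv_fund_inv)
  also have "(\<Sum>b\<in>UNIV. \<Sum>c\<in>UNIV. h i b z * S (g b c) z * h c d z) =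
      (\<Sum>b\<in>UNIV. \<Sum>c\<in>UNIV. h i b z * (\<Sum>a\<in>UNIV. N a b z * g a c z) * h c d z) +
      (\<Sum>b\<in>UNIV. \<Sum>c\<in>UNIV. h i b z * (\<Sum>a\<in>UNIV. N a c z * g b a z) * h c d z)"
    by (simp add: sder_fund[OF z] distrib_left distrib_right sum.distrib)
  also have "(\<Sum>b\<in>UNIV. \<Sum>c\<in>UNIV. h i b z * (\<Sum>a\<in>UNIV. N a b z * g a c z) * h c d z) = (\<Sum>b\<in>UNIV. h i b z * N d b z)"
  proof (rule sum.cong[OF refl])
    fix b
    have "(\<Sum>c\<in>UNIV. (\<Sum>a\<in>UNIV. N a b z * g a c z) * h c d z) = (\<Sum>a\<in>UNIV. N a b z * (\<Sum>c\<in>UNIV. g a c z * h c d z))"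
      unfolding sum_distrib_left sum_distrib_right mult.assoc by (rule sum.swap)
    then show "(\<Sum>c\<in>UNIV. h i b z * (\<Sum>a\<in>UNIV. N a b z * g a c z) * h c d z) = h i b z * N d b z"
      by (simp add: fund_fund_inv[OF z] mult_delta_right sum_distrib_left[symmetric] mult.assoc)
  qed
  also have "(\<Sum>b\<in>UNIV. \<Sum>c\<in>UNIV. h i b z * (\<Sum>a\<in>UNIV. N a c z * g b a z) * h c d z) = (\<Sum>c\<in>UNIV. N i c z * h c d z)"
  proof (subst sum.swap, rule sum.cong[OF refl])
    fix c
    show "(\<Sum>b\<in>UNIV. h i b z * (\<Sum>a\<in>UNIV. N a c z * g b a z) * h c d z) = N i c z * h c d z"
      using raise_lower(1)[OF z, of i "\<lambda>a. N a c z"]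
      by (simp add: sum_distrib_right[symmetric] mult.commute[of _ "g _ _ z"])
  qed
  finally show ?thesis by simp
qed

text \<open>The columns of \<open>g\<^sup>-\<^sup>1\<close> are divergence free for the density \<open>|det g|\<close>; this rests on the symmetry of
\<open>g\<^sub>b\<^sub>a\<^sub>\<cdot>\<^sub>c\<close> in all three indices.\<close>

lemma dy_fund_inv_trace:
  assumes z: "z \<in> \<Omega>"
  shows "(\<Sum>a\<in>UNIV. dy a (h a d) z) = - 2 * (\<Sum>c\<in>UNIV. dy c \<sigma> z * h c d z)"
proof -
  have "dy c (g b a) z = dy a (g b c) z" for a b c
  proof -
    have "dy c (g b a) z = dy b (g c a) z" by (rule dy_fund_sym[OF z])
    also have "\<dots> = dy b (g a c) z" by (rule dy_cong[OF fund_sym z])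
    also have "\<dots> = dy a (g b c) z" by (rule dy_fund_sym[OF z])
    finally show ?thesis .
  qed
  then have "dy c \<sigma> z = 1/2 * (\<Sum>a\<in>UNIV. \<Sum>b\<in>UNIV. h a b z * dy a (g b c) z)" for c
    by (simp add: dy_\<sigma>[OF z])
  then have "(\<Sum>c\<in>UNIV. dy c \<sigma> z * h c d z) = 1/2 * (\<Sum>c\<in>UNIV. \<Sum>a\<in>UNIV. \<Sum>b\<in>UNIV. h a b z * dy a (g b c) z * h c d z)"
    by (simp add: sum_distrib_left sum_distrib_right mult.assoc)
  also have "(\<Sum>c\<in>UNIV. \<Sum>a\<in>UNIV. \<Sum>b\<in>UNIV. h a b z * dy a (g b c) z * h c d z) =
      (\<Sum>a\<in>UNIV. \<Sum>b\<in>UNIV. \<Sum>c\<in>UNIV. h a b z * dy a (g b c) z * h c d z)"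
    by (subst sum.swap) (intro sum.cong refl sum.swap)
  also have "\<dots> = (\<Sum>a\<in>UNIV. - dy a (h a d) z)"
    by (intro sum.cong refl) (simp add: dy_def fderiv_fund_inv[OF z])
  finally show ?thesis by (simp add: sum_negf)
qed

abbreviation P :: "'n \<Rightarrow> 'n cfun" where "P \<equiv> mean_landsberg L"

lemma dy_\<tau>_eq: "z \<in> \<Omega> \<Longrightarrow> dy k \<tau> z = (\<Sum>a\<in>UNIV. dy k (N a a) z)"
  unfolding \<tau>_def[abs_def] by (simp add: leibniz smooth)

lemma mean_landsberg_eq: "z \<in> \<Omega> \<Longrightarrow> P k z = dy k \<tau> z - \<delta> k \<sigma> z"
proof -
  assume z: "z \<in> \<Omega>"
  have "(\<Sum>a\<in>UNIV. \<Sum>l\<in>UNIV. h a l z * \<delta> a (g l k) z) = (\<Sum>a\<in>UNIV. \<Sum>l\<in>UNIV. h a l z * \<delta> l (g a k) z)"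
    by (subst sum.swap) (intro sum.cong refl arg_cong2[where f = "(*)"] fund_inv_sym z)
  then have "(\<Sum>a\<in>UNIV. chern L a a k z) = \<delta> k \<sigma> z"
    by (simp add: chern_eq hder_\<sigma>[OF z] sum_distrib_left[symmetric] sum_divide_distrib[symmetric]
        distrib_left right_diff_distrib sum.distrib sum_subtractf)
  then show ?thesis by (simp add: mean_landsberg_def dy_\<tau>_eq[OF z])
qed

lemma sm_P: "sm (P k)"
  by (subst sm_cong[OF mean_landsberg_eq], assumption) (simp add: smooth_fin sm_defs sm_\<sigma>)

text \<open>\<open>P = \<nabla>I\<close>: differentiate \<open>S \<sigma> = \<tau>\<close> in \<open>y\<^sup>k\<close>.\<close>

lemma mean_landsberg_dyn: "z \<in> \<Omega> \<Longrightarrow> P k z = dyn1 G (\<lambda>k. dy k \<sigma>) k z"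
proof -
  assume z: "z \<in> \<Omega>"
  have "dy k (S \<sigma>) z = dy k \<tau> z" by (rule dy_cong[OF sder_\<sigma> z])
  then show ?thesis using dy_sder[OF sm_\<sigma> z, of k] by (simp add: mean_landsberg_eq[OF z] dyn1_def)
qed

text \<open>The Jacobi operator applied to \<open>I\<close> is a quantity of the spray alone, because \<open>P\<^sub>k = \<tau>\<^sub>\<cdot>\<^sub>k - \<delta>\<^sub>k \<sigma>\<close>
and the bracket of \<open>S\<close> and \<open>\<delta>\<^sub>k\<close>, applied to \<open>\<sigma>\<close>, contributes \<open>R\<^sup>a\<^sub>k I\<^sub>a\<close>.\<close>

lemma dyn_mean_landsberg:
  assumes z: "z \<in> \<Omega>"
  shows "dyn1 G P k z + (\<Sum>a\<in>UNIV. R a k z * dy a \<sigma> z) = euler_lagrange k z"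
proof -
  have "S (P k) z = S (\<lambda>z. dy k \<tau> z - \<delta> k \<sigma> z) z"
    by (rule sder_cong[OF mean_landsberg_eq z])
  moreover have "\<delta> k (S \<sigma>) z = \<delta> k \<tau> z" by (rule hder_cong[OF sder_\<sigma> z])
  ultimately have "S (P k) z = S (dy k \<tau>) z - (\<delta> k \<tau> z + (\<Sum>i\<in>UNIV. N i k z * \<delta> i \<sigma> z) + (\<Sum>i\<in>UNIV. R i k z * dy i \<sigma> z))"
    using z by (simp add: deriv_rules smooth sm_defs sm_\<sigma> sder_hder)
  then show ?thesis
    by (simp add: dyn1_def euler_lagrange_def mean_landsberg_eq[OF z] right_diff_distrib sum_subtractf)
qed

definition jacobi_P :: "'n \<Rightarrow> 'n cfun" where
  "jacobi_P k z = dyn1 G (dyn1 G P) k z + (\<Sum>a\<in>UNIV. R a k z * P a z)"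

lemma sm_jacobi_P: "sm (jacobi_P k)"
  unfolding jacobi_P_def[abs_def] by (simp add: smooth sm_P)

text \<open>Obtained by applying \<open>\<nabla>\<close> to the previous identity and using \<open>P = \<nabla>I\<close> once more.\<close>

lemma jacobi_P_eq:
  assumes z: "z \<in> \<Omega>"
  shows "jacobi_P k z + (\<Sum>a\<in>UNIV. dyn2 G R a k z * dy a \<sigma> z) = dyn1 G euler_lagrange k z"
proof -
  have "S (euler_lagrange k) z = S (\<lambda>z. dyn1 G P k z + (\<Sum>a\<in>UNIV. R a k z * dy a \<sigma> z)) z"
    by (rule sder_cong[OF _ z]) (simp add: dyn_mean_landsberg)
  also have "\<dots> = S (dyn1 G P k) z + (\<Sum>a\<in>UNIV. S (R a k) z * dy a \<sigma> z) + (\<Sum>a\<in>UNIV. R a k z * S (dy a \<sigma>) z)"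
    using z by (simp add: deriv_rules smooth sm_P sm_\<sigma> sum.distrib)
  finally have 1: "S (euler_lagrange k) z = \<dots>" .
  have 2: "S (dy a \<sigma>) z = P a z + (\<Sum>b\<in>UNIV. N b a z * dy b \<sigma> z)" for a
    using mean_landsberg_dyn[OF z, of a] by (simp add: dyn1_def)
  have s1: "(\<Sum>a\<in>UNIV. \<Sum>b\<in>UNIV. R a k z * (N b a z * dy b \<sigma> z)) = (\<Sum>a\<in>UNIV. \<Sum>b\<in>UNIV. N a b z * R b k z * dy a \<sigma> z)"
    by (subst sum.swap) (simp add: mult_ac)
  have s2: "(\<Sum>j\<in>UNIV. N j k z * (\<Sum>a\<in>UNIV. R a j z * dy a \<sigma> z)) = (\<Sum>a\<in>UNIV. \<Sum>b\<in>UNIV. N b k z * R a b z * dy a \<sigma> z)"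
    unfolding sum_distrib_left by (subst sum.swap) (simp add: mult_ac)
  have 3: "(\<Sum>j\<in>UNIV. N j k z * euler_lagrange j z) = (\<Sum>j\<in>UNIV. N j k z * dyn1 G P j z) + (\<Sum>a\<in>UNIV. \<Sum>b\<in>UNIV. N b k z * R a b z * dy a \<sigma> z)"
    unfolding s2[symmetric] dyn_mean_landsberg[OF z, symmetric] by (simp add: distrib_left sum.distrib)
  have 4: "(\<Sum>a\<in>UNIV. dyn2 G R a k z * dy a \<sigma> z) = (\<Sum>a\<in>UNIV. S (R a k) z * dy a \<sigma> z)
      + (\<Sum>a\<in>UNIV. \<Sum>b\<in>UNIV. N a b z * R b k z * dy a \<sigma> z) - (\<Sum>a\<in>UNIV. \<Sum>b\<in>UNIV. N b k z * R a b z * dy a \<sigma> z)"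
    by (simp add: dyn2_def left_diff_distrib distrib_right sum.distrib sum_subtractf sum_distrib_right)
  show ?thesis
    unfolding 4 unfolding dyn1_def[of G euler_lagrange] 3 1 2 jacobi_P_def dyn1_def[of G "dyn1 G P"] distrib_left sum_distrib_left sum.distrib s1
    by (simp add: sum_distrib_left)
qed

text \<open>In this form the contracted Bianchi identity starts with the divergence of \<open>\<nabla>R\<close> for the density
\<open>|det g|\<close>: the Euler--Lagrange term of \<open>spray_identity\<close> supplies the missing \<open>2 I\<^sub>a (\<nabla>R)\<^sup>a\<^sub>k\<close>.\<close>

lemma weighted_identity:
  assumes z: "z \<in> \<Omega>"
  shows "(\<Sum>a\<in>UNIV. dy a (dyn2 G R a k) z) + 2 * (\<Sum>a\<in>UNIV. dyn2 G R a k z * dy a \<sigma> z) + 2 * jacobi_P k z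
    + dyn1 G (\<lambda>k. dy k Ric) k z - \<delta> k Ric z = 0"
  using spray_identity[OF z, of k] jacobi_P_eq[OF z, of k] by linarith

end

lemma sum_swap_pairs:
  "(\<Sum>i\<in>A. \<Sum>j\<in>B. \<Sum>k\<in>C. \<Sum>l\<in>D. f i j k l) = (\<Sum>k\<in>C. \<Sum>l\<in>D. \<Sum>i\<in>A. \<Sum>j\<in>B. f i j k l)"
proof -
  have "(\<Sum>i\<in>A. \<Sum>j\<in>B. \<Sum>k\<in>C. \<Sum>l\<in>D. f i j k l) = (\<Sum>i\<in>A. \<Sum>k\<in>C. \<Sum>l\<in>D. \<Sum>j\<in>B. f i j k l)"
    by (subst sum.swap[of _ C B], subst sum.swap[of _ D B], rule refl)
  also have "\<dots> = (\<Sum>k\<in>C. \<Sum>l\<in>D. \<Sum>i\<in>A. \<Sum>j\<in>B. f i j k l)"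
    by (subst sum.swap[of _ C A], subst sum.swap[of _ D A], rule refl)
  finally show ?thesis .
qed

context local_finsler
begin

section \<open>The mean Landsberg expression as a divergence\<close>

lemma dyn02_cong:
  assumes "\<And>i j w. w \<in> \<Omega> \<Longrightarrow> A i j w = B i j w" "z \<in> \<Omega>"
  shows "dyn02 A i j z = dyn02 B i j z"
proof -
  have "S (A i j) z = S (B i j) z" by (rule sder_cong[OF assms])
  then show ?thesis using assms by (simp add: dyn02_def)
qed

text \<open>Contraction with \<open>g\<^sup>i\<^sup>j\<close> commutes with \<open>\<nabla>\<close>.\<close>

lemma trace_dyn02:
  assumes z: "z \<in> \<Omega>" and sm: "\<And>i j. sm (A i j)"
  shows "(\<Sum>i\<in>UNIV. \<Sum>j\<in>UNIV. h i j z * dyn02 A i j z) = S (\<lambda>z. \<Sum>i\<in>UNIV. \<Sum>j\<in>UNIV. h i j z * A i j z) z"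
proof -
  have "S (\<lambda>z. \<Sum>i\<in>UNIV. \<Sum>j\<in>UNIV. h i j z * A i j z) z =
      (\<Sum>i\<in>UNIV. \<Sum>j\<in>UNIV. S (h i j) z * A i j z) + (\<Sum>i\<in>UNIV. \<Sum>j\<in>UNIV. h i j z * S (A i j) z)"
    using z by (simp add: deriv_rules smooth_fin sm sum.distrib)
  moreover have "(\<Sum>i\<in>UNIV. \<Sum>j\<in>UNIV. S (h i j) z * A i j z) =
      - (\<Sum>i\<in>UNIV. \<Sum>j\<in>UNIV. h i j z * (\<Sum>l\<in>UNIV. N l j z * A i l z))
      - (\<Sum>i\<in>UNIV. \<Sum>j\<in>UNIV. h i j z * (\<Sum>l\<in>UNIV. N l i z * A l j z))"
  proof -
    have 1: "(\<Sum>i\<in>UNIV. \<Sum>j\<in>UNIV. (\<Sum>b\<in>UNIV. h i b z * N j b z) * A i j z) = (\<Sum>i\<in>UNIV. \<Sum>j\<in>UNIV. h i j z * (\<Sum>l\<in>UNIV. N l j z * A i l z))"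
    proof (rule sum.cong[OF refl])
      fix i
      show "(\<Sum>j\<in>UNIV. (\<Sum>b\<in>UNIV. h i b z * N j b z) * A i j z) = (\<Sum>j\<in>UNIV. h i j z * (\<Sum>l\<in>UNIV. N l j z * A i l z))"
        unfolding sum_distrib_left sum_distrib_right mult.assoc by (rule sum.swap)
    qed
    have "(\<Sum>i\<in>UNIV. \<Sum>j\<in>UNIV. (\<Sum>c\<in>UNIV. N i c z * h c j z) * A i j z) = (\<Sum>j\<in>UNIV. \<Sum>i\<in>UNIV. (\<Sum>c\<in>UNIV. N i c z * h c j z) * A i j z)"
      by (rule sum.swap)
    also have "\<dots> = (\<Sum>j\<in>UNIV. \<Sum>i\<in>UNIV. h i j z * (\<Sum>l\<in>UNIV. N l i z * A l j z))"
    proof (rule sum.cong[OF refl])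
      fix j
      show "(\<Sum>i\<in>UNIV. (\<Sum>c\<in>UNIV. N i c z * h c j z) * A i j z) = (\<Sum>i\<in>UNIV. h i j z * (\<Sum>l\<in>UNIV. N l i z * A l j z))"
        unfolding sum_distrib_left sum_distrib_right by (subst sum.swap) (simp add: mult_ac)
    qed
    also have "\<dots> = (\<Sum>i\<in>UNIV. \<Sum>j\<in>UNIV. h i j z * (\<Sum>l\<in>UNIV. N l i z * A l j z))"
      by (rule sum.swap)
    finally show ?thesis using 1
      by (simp add: sder_fund_inv[OF z] left_diff_distrib sum_subtractf sum_negf)
  qed
  ultimately show ?thesis
    by (simp add: dyn02_def right_diff_distrib sum_subtractf)
qed

text \<open>The covariant derivative of \<open>P\<close> for the Berwald connection.\<close>

definition berwald_P :: "'n \<Rightarrow> 'n \<Rightarrow> 'n cfun" where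
  "berwald_P i j z = \<delta> j (P i) z - (\<Sum>k\<in>UNIV. dy j (N k i) z * P k z)"

abbreviation Q :: "'n \<Rightarrow> 'n cfun" where "Q \<equiv> dyn1 G P"

lemma sm_berwald_P: "sm (berwald_P i j)"
  unfolding berwald_P_def[abs_def] by (simp add: smooth sm_P)

lemma trace_Lan:
  assumes z: "z \<in> \<Omega>"
  shows "(\<Sum>i\<in>UNIV. \<Sum>j\<in>UNIV. h i j z * Lan k i j z) = - 2 * P k z"
proof -
  have "P k z = - 1/2 * (\<Sum>a\<in>UNIV. \<Sum>l\<in>UNIV. h a l z * Lan l a k z)"
    by (simp add: mean_landsberg_def chern_berwald[OF z] sum.distrib sum_divide_distrib[symmetric])
  moreover have "Lan l a k z = Lan k a l z" for a l
    using Lan_sym[OF z] by metis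
  ultimately show ?thesis by simp
qed

text \<open>Passing from the Chern to the Berwald connection costs, after contraction, the square of \<open>P\<close>; this
is what the term \<open>- 2 P\<^sub>i P\<^sub>j\<^sub>|\<^sub>0\<close> in the mean Landsberg expression compensates.\<close>

lemma trace_cov1:
  assumes z: "z \<in> \<Omega>"
  shows "(\<Sum>i\<in>UNIV. \<Sum>j\<in>UNIV. h i j z * cov1 L P i j z) =
    (\<Sum>i\<in>UNIV. \<Sum>j\<in>UNIV. h i j z * berwald_P i j z) + (\<Sum>i\<in>UNIV. \<Sum>j\<in>UNIV. h i j z * (P i z * P j z))"
proof -
  have 1: "cov1 L P i j z = berwald_P i j z - 1/2 * (\<Sum>k\<in>UNIV. \<Sum>l\<in>UNIV. h k l z * Lan l i j z * P k z)" for i j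
  proof -
    have "dy i (N k j) z = dy j (N k i) z" for k by (rule dy_dy_commute[OF smooth_spray z])
    moreover have "Lan l j i z = Lan l i j z" for l by (rule Lan_sym(2)[OF z])
    ultimately show ?thesis
      by (simp add: cov1_def hor_eq berwald_P_def chern_berwald[OF z] distrib_right sum.distrib sum_distrib_right sum_distrib_left)
  qed
  have "(\<Sum>i\<in>UNIV. \<Sum>j\<in>UNIV. h i j z * (\<Sum>k\<in>UNIV. \<Sum>l\<in>UNIV. h k l z * Lan l i j z * P k z)) =
     (\<Sum>k\<in>UNIV. \<Sum>l\<in>UNIV. \<Sum>i\<in>UNIV. \<Sum>j\<in>UNIV. h i j z * (h k l z * Lan l i j z * P k z))"
    unfolding sum_distrib_left by (rule sum_swap_pairs)
  also have "\<dots> = (\<Sum>k\<in>UNIV. \<Sum>l\<in>UNIV. h k l z * P k z * (\<Sum>i\<in>UNIV. \<Sum>j\<in>UNIV. h i j z * Lan l i j z))"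
    by (simp add: sum_distrib_left mult_ac)
  also have "\<dots> = - 2 * (\<Sum>k\<in>UNIV. \<Sum>l\<in>UNIV. h k l z * (P k z * P l z))"
    by (simp add: trace_Lan[OF z] sum_distrib_left mult_ac sum_negf)
  finally show ?thesis
    unfolding 1 right_diff_distrib sum_subtractf mult.left_commute[of _ "1/2"] sum_distrib_left[symmetric] by simp
qed

lemma dyn02_berwald_P:
  assumes z: "z \<in> \<Omega>"
  shows "dyn02 berwald_P i j z = \<delta> j (Q i) z - (\<Sum>l\<in>UNIV. dy j (N l i) z * Q l z) + (\<Sum>l\<in>UNIV. R l j z * dy l (P i) z)
    + (\<Sum>k\<in>UNIV. (\<delta> j (N k i) z - S (dy j (N k i)) z + (\<Sum>l\<in>UNIV. N l i z * dy j (N k l) z)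
        + (\<Sum>l\<in>UNIV. N l j z * dy l (N k i) z) - (\<Sum>l\<in>UNIV. dy j (N l i) z * N k l z)) * P k z)"
proof -
  have SP: "S (P k) z = Q k z + (\<Sum>l\<in>UNIV. N l k z * P l z)" for k
    by (simp add: dyn1_def)
  have dQ: "\<delta> j (Q i) z = \<delta> j (S (P i)) z - (\<Sum>l\<in>UNIV. \<delta> j (N l i) z * P l z) - (\<Sum>l\<in>UNIV. N l i z * \<delta> j (P l) z)"
    unfolding dyn1_def[abs_def] using z by (simp add: deriv_rules smooth sm_P sum.distrib)
  have SB: "S (berwald_P i j) z = \<delta> j (S (P i)) z + (\<Sum>l\<in>UNIV. N l j z * \<delta> l (P i) z) + (\<Sum>l\<in>UNIV. R l j z * dy l (P i) z)
      - (\<Sum>k\<in>UNIV. S (dy j (N k i)) z * P k z) - (\<Sum>k\<in>UNIV. dy j (N k i) z * S (P k) z)"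
    unfolding berwald_P_def[abs_def] using z by (simp add: deriv_rules smooth sm_P sum.distrib sder_hder)
  have s1: "(\<Sum>k\<in>UNIV. \<Sum>l\<in>UNIV. dy j (N k i) z * (N l k z * P l z)) = (\<Sum>k\<in>UNIV. \<Sum>l\<in>UNIV. dy j (N l i) z * N k l z * P k z)"
    by (subst sum.swap) (simp add: mult_ac)
  have s2: "(\<Sum>l\<in>UNIV. \<Sum>k\<in>UNIV. N l i z * (dy j (N k l) z * P k z)) = (\<Sum>k\<in>UNIV. \<Sum>l\<in>UNIV. N l i z * dy j (N k l) z * P k z)"
    by (subst sum.swap) (simp add: mult_ac)
  have s3: "(\<Sum>l\<in>UNIV. \<Sum>k\<in>UNIV. N l j z * (dy l (N k i) z * P k z)) = (\<Sum>k\<in>UNIV. \<Sum>l\<in>UNIV. N l j z * dy l (N k i) z * P k z)"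
    by (subst sum.swap) (simp add: mult_ac)
  show ?thesis
    unfolding dyn02_def SB SP dQ
    unfolding berwald_P_def right_diff_distrib distrib_left left_diff_distrib distrib_right sum.distrib sum_subtractf
      sum_distrib_left sum_distrib_right s1 s2 s3
    by simp
qed

lemma dy_jacobi_P:
  assumes z: "z \<in> \<Omega>"
  shows "dy j (jacobi_P i) z = dyn02 (\<lambda>i j. dy j (Q i)) i j z + \<delta> j (Q i) z - (\<Sum>l\<in>UNIV. dy j (N l i) z * Q l z)
    + (\<Sum>a\<in>UNIV. dy j (R a i) z * P a z) + (\<Sum>a\<in>UNIV. R a i z * dy j (P a) z)"
  unfolding jacobi_P_def[abs_def] dyn1_def[of G "dyn1 G P", abs_def] dyn02_def
  using z by (simp add: leibniz smooth sm_P dy_sder sum.distrib)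

text \<open>Before contraction the two sides differ by commutator terms. They cancel under \<open>g\<^sup>i\<^sup>j\<close>: the last one is
antisymmetric in \<open>i, j\<close>, and the first two agree because \<open>g\<^sup>i\<^sup>j R\<^sup>l\<^sub>j\<close> is symmetric in \<open>i, l\<close>.\<close>

lemma jacobi_P_divergence_pointwise:
  assumes z: "z \<in> \<Omega>"
  shows "dyn02 berwald_P i j z + dyn02 (\<lambda>i j. dy j (Q i)) i j z - dy j (jacobi_P i) z =
    (\<Sum>l\<in>UNIV. R l j z * dy l (P i) z) - (\<Sum>a\<in>UNIV. R a i z * dy j (P a) z)
    + 2 * (\<Sum>a\<in>UNIV. (\<delta> j (N a i) z - \<delta> i (N a j) z) * P a z)"
proof -
  have c: "dy c (N a j) z = dy j (N a c) z" for a c by (rule dy_dy_commute[OF smooth_spray z])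
  show ?thesis
    unfolding dyn02_berwald_P[OF z] dy_jacobi_P[OF z] dy_jacobi[OF z] c
    by (simp add: algebra_simps sum.distrib sum_subtractf sum_distrib_left)
qed

lemma jacobi_raised_sym:
  assumes z: "z \<in> \<Omega>"
  shows "(\<Sum>j\<in>UNIV. h i j z * R l j z) = (\<Sum>j\<in>UNIV. h l j z * R i j z)"
proof -
  define M where "M m j = (\<Sum>a\<in>UNIV. g m a z * R a j z)" for m j
  have M: "M m j = M j m" for m j unfolding M_def by (rule jacobi_sym[OF z])
  have R: "R l j z = (\<Sum>m\<in>UNIV. h l m z * M m j)" for l j
    using raise_lower(1)[OF z, of l "\<lambda>a. R a j z"] by (simp add: M_def)
  have "(\<Sum>j\<in>UNIV. h i j z * (\<Sum>m\<in>UNIV. h l m z * M m j)) = (\<Sum>m\<in>UNIV. h l m z * (\<Sum>j\<in>UNIV. h i j z * M j m))"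
    unfolding sum_distrib_left by (subst sum.swap) (simp add: mult_ac M)
  then show ?thesis by (simp only: R)
qed

text \<open>First the Chern derivatives are replaced by Berwald ones, using that \<open>\<nabla>\<close> of the scalar \<open>g\<^sup>i\<^sup>j P\<^sub>i P\<^sub>j\<close> is
twice \<open>g\<^sup>i\<^sup>j P\<^sub>i P\<^sub>j\<^sub>|\<^sub>0\<close>; then \<open>jacobi_P_divergence_pointwise\<close> applies.\<close>

lemma jacobi_P_divergence:
  assumes z: "z \<in> \<Omega>"
  shows "mean_landsberg_expr L z = (\<Sum>i\<in>UNIV. \<Sum>j\<in>UNIV. h i j z * dy j (jacobi_P i) z)"
proof -
  have PP: "dyn02 (\<lambda>i j z. P i z * P j z) i j z = Q i z * P j z + P i z * Q j z" for i j
    unfolding dyn02_def dyn1_def using z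
    by (simp add: deriv_rules sm_P algebra_simps sum_distrib_left)
  have swap2: "(\<Sum>i\<in>UNIV. \<Sum>j\<in>UNIV. h i j z * (P i z * Q j z)) = (\<Sum>i\<in>UNIV. \<Sum>j\<in>UNIV. h i j z * (Q i z * P j z))"
    by (subst sum.swap) (simp add: mult_ac fund_inv_sym[OF z, of _ i for i])
  have "mean_landsberg_expr L z = (\<Sum>i\<in>UNIV. \<Sum>j\<in>UNIV. h i j z * dyn02 (cov1 L P) i j z)
      - 2 * (\<Sum>i\<in>UNIV. \<Sum>j\<in>UNIV. h i j z * (P i z * Q j z))
      + (\<Sum>i\<in>UNIV. \<Sum>j\<in>UNIV. h i j z * dyn02 (\<lambda>i j. dy j (Q i)) i j z)"
  proof -
    have "dyn02 (\<lambda>i j. dy j (cov1_0 L P i)) i j z = dyn02 (\<lambda>i j. dy j (Q i)) i j z" for i j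
      by (rule dyn02_cong[OF _ z]) (rule dy_cong[OF cov1_0_eq])
    then show ?thesis
      by (simp add: mean_landsberg_expr_def Let_def cov2_0_eq[OF z] cov1_0_eq[OF z] distrib_left right_diff_distrib
        sum.distrib sum_subtractf sum_distrib_left mult_ac)
  qed
  also have "(\<Sum>i\<in>UNIV. \<Sum>j\<in>UNIV. h i j z * dyn02 (cov1 L P) i j z) =
      (\<Sum>i\<in>UNIV. \<Sum>j\<in>UNIV. h i j z * dyn02 berwald_P i j z) + 2 * (\<Sum>i\<in>UNIV. \<Sum>j\<in>UNIV. h i j z * (P i z * Q j z))"
  proof -
    have smc: "sm (cov1 L P i j)" for i j
      unfolding cov1_def[abs_def] hor_eq by (simp add: smooth sm_P sm_chern)
    have "(\<Sum>i\<in>UNIV. \<Sum>j\<in>UNIV. h i j z * dyn02 (cov1 L P) i j z) = S (\<lambda>z. \<Sum>i\<in>UNIV. \<Sum>j\<in>UNIV. h i j z * cov1 L P i j z) z"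
      by (rule trace_dyn02[OF z smc])
    also have "\<dots> = S (\<lambda>z. (\<Sum>i\<in>UNIV. \<Sum>j\<in>UNIV. h i j z * berwald_P i j z) + (\<Sum>i\<in>UNIV. \<Sum>j\<in>UNIV. h i j z * (P i z * P j z))) z"
      by (rule sder_cong[OF trace_cov1 z])
    also have "\<dots> = S (\<lambda>z. (\<Sum>i\<in>UNIV. \<Sum>j\<in>UNIV. h i j z * berwald_P i j z)) z + S (\<lambda>z. \<Sum>i\<in>UNIV. \<Sum>j\<in>UNIV. h i j z * (P i z * P j z)) z"
      using z by (simp only: sder_leibniz smooth_fin sm_P sm_berwald_P)
    also have "S (\<lambda>z. (\<Sum>i\<in>UNIV. \<Sum>j\<in>UNIV. h i j z * berwald_P i j z)) z = (\<Sum>i\<in>UNIV. \<Sum>j\<in>UNIV. h i j z * dyn02 berwald_P i j z)"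
      by (rule trace_dyn02[OF z sm_berwald_P, symmetric])
    also have "S (\<lambda>z. \<Sum>i\<in>UNIV. \<Sum>j\<in>UNIV. h i j z * (P i z * P j z)) z =
       (\<Sum>i\<in>UNIV. \<Sum>j\<in>UNIV. h i j z * dyn02 (\<lambda>i j z. P i z * P j z) i j z)"
      by (rule trace_dyn02[OF z, symmetric]) (simp add: smooth sm_P)
    finally show ?thesis using swap2 by (simp add: PP distrib_left sum.distrib)
  qed
  finally have e: "mean_landsberg_expr L z - (\<Sum>i\<in>UNIV. \<Sum>j\<in>UNIV. h i j z * dy j (jacobi_P i) z) =
     (\<Sum>i\<in>UNIV. \<Sum>j\<in>UNIV. h i j z * (dyn02 berwald_P i j z + dyn02 (\<lambda>i j. dy j (Q i)) i j z - dy j (jacobi_P i) z))"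
    by (simp add: distrib_left right_diff_distrib sum.distrib sum_subtractf)
  define C where "C i j = (\<Sum>a\<in>UNIV. (\<delta> j (N a i) z - \<delta> i (N a j) z) * P a z)" for i j
  have C: "C i j = - C j i" for i j
    unfolding C_def sum_negf[symmetric] by (rule sum.cong) (auto simp: algebra_simps)
  have "(\<Sum>i\<in>UNIV. \<Sum>j\<in>UNIV. h i j z * C i j) = (\<Sum>i\<in>UNIV. \<Sum>j\<in>UNIV. h j i z * C j i)"
    by (rule sum.swap)
  also have "\<dots> = (\<Sum>i\<in>UNIV. \<Sum>j\<in>UNIV. - (h i j z * C i j))"
  proof (intro sum.cong refl)
    fix i j show "h j i z * C j i = - (h i j z * C i j)"
      using C[of i j] fund_inv_sym[OF z, of i j] by simp
  qed
  finally have C0: "(\<Sum>i\<in>UNIV. \<Sum>j\<in>UNIV. h i j z * C i j) = 0"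
    by (simp add: sum_negf)
  have R1: "(\<Sum>i\<in>UNIV. \<Sum>j\<in>UNIV. h i j z * (\<Sum>l\<in>UNIV. R l j z * dy l (P i) z)) =
     (\<Sum>i\<in>UNIV. \<Sum>l\<in>UNIV. (\<Sum>j\<in>UNIV. h i j z * R l j z) * dy l (P i) z)"
    unfolding sum_distrib_left sum_distrib_right mult.assoc by (intro sum.cong refl sum.swap)
  have R2: "(\<Sum>i\<in>UNIV. \<Sum>j\<in>UNIV. h i j z * (\<Sum>a\<in>UNIV. R a i z * dy j (P a) z)) =
     (\<Sum>i\<in>UNIV. \<Sum>l\<in>UNIV. (\<Sum>j\<in>UNIV. h i j z * R l j z) * dy l (P i) z)"
  proof -
    have "(\<Sum>i\<in>UNIV. \<Sum>j\<in>UNIV. h i j z * (\<Sum>a\<in>UNIV. R a i z * dy j (P a) z)) =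
       (\<Sum>j\<in>UNIV. \<Sum>i\<in>UNIV. \<Sum>a\<in>UNIV. h j i z * R a i z * dy j (P a) z)"
      by (subst sum.swap) (simp add: sum_distrib_left mult_ac fund_inv_sym[OF z, of i j for i j])
    also have "\<dots> = (\<Sum>j\<in>UNIV. \<Sum>a\<in>UNIV. (\<Sum>i\<in>UNIV. h j i z * R a i z) * dy j (P a) z)"
      unfolding sum_distrib_right by (intro sum.cong refl sum.swap)
    also have "\<dots> = (\<Sum>a\<in>UNIV. \<Sum>j\<in>UNIV. (\<Sum>i\<in>UNIV. h a i z * R j i z) * dy j (P a) z)"
      by (subst sum.swap) (simp add: jacobi_raised_sym[OF z])
    finally show ?thesis .
  qed
  show ?thesis
    using e C0 unfolding jacobi_P_divergence_pointwise[OF z] C_def[symmetric]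
    by (simp add: distrib_left right_diff_distrib sum.distrib sum_subtractf R1 R2 mult.left_commute[of _ 2] sum_distrib_left[symmetric])
qed

end

section \<open>Pullback of functions on the base\<close>

lemma fderiv_fst:
  fixes r :: "'a::euclidean_space \<Rightarrow> real" and z :: "'a \<times> 'b::euclidean_space"
  assumes "r differentiable (at (fst z))"
  shows "(\<lambda>z. r (fst z)) differentiable (at z)"
    and "frechet_derivative (\<lambda>z. r (fst z)) (at z) (v, w) = frechet_derivative r (at (fst z)) v"
proof -
  have "((\<lambda>z. r (fst z)) has_derivative (\<lambda>u. frechet_derivative r (at (fst z)) (fst u))) (at z)"
    by (rule has_derivative_compose[of fst fst z UNIV r, OF _ has_derivative_frechet[OF assms]])
      (auto intro!: derivative_eq_intros)
  then show "(\<lambda>z. r (fst z)) differentiable (at z)"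
    and "frechet_derivative (\<lambda>z. r (fst z)) (at z) (v, w) = frechet_derivative r (at (fst z)) v"
    by (auto intro: differentiableI simp: frechet_derivative_eqI)
qed

lemma smooth_on_fst:
  fixes r :: "'a::euclidean_space \<Rightarrow> real" and V :: "'b::euclidean_space set"
  assumes "open U" "open V" "smooth_on U r"
  shows "smooth_on (U \<times> V) (\<lambda>z. r (fst z))"
proof -
  have op: "open (U \<times> V)" using assms by (simp add: open_Times)
  have "Ck_on k U r \<Longrightarrow> Ck_on k (U \<times> V) (\<lambda>z. r (fst z))" for k
  proof (induction k arbitrary: r)
    case 0
    then show ?case by (auto intro!: continuous_on_compose2[of U r] continuous_intros)
  next
    case (Suc k)
    have "Ck_on k (U \<times> V) (\<lambda>z. frechet_derivative (\<lambda>z. r (fst z)) (at z) u)" for u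
    proof -
      obtain v w where u: "u = (v, w)" by fastforce
      have "Ck_on k (U \<times> V) (\<lambda>z. frechet_derivative r (at (fst z)) v)"
        using Suc.prems by (intro Suc.IH) auto
      moreover have eq: "frechet_derivative (\<lambda>z. r (fst z)) (at z) u = frechet_derivative r (at (fst z)) v"
        if "z \<in> U \<times> V" for z
        unfolding u using Suc.prems that by (intro fderiv_fst(2)) auto
      ultimately show ?thesis by (subst Ck_on_cong[OF op eq])
    qed
    then show ?case using Suc.prems fderiv_fst(1) by fastforce
  qed
  then show ?thesis using assms(3) by (simp add: smooth_on_def)
qed


section \<open>Einstein metrics\<close>

context local_finsler
begin

lemma ricci_eq: "ricci L z = Ric z"
proof -
  have "Ric z = 2 * (\<Sum>i\<in>UNIV. dx i (G i) z) - (\<Sum>i\<in>UNIV. S (N i i) z) - (\<Sum>i\<in>UNIV. \<Sum>j\<in>UNIV. N i j z * N j i z)"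
    by (simp add: Ric_def jacobi_def sum_subtractf sum_distrib_left)
  then show ?thesis
    by (simp add: ricci_def sder_def sum_subtractf sum_distrib_left)
qed

definition \<mu> :: "'n cfun" where "\<mu> z = exp (2 * \<sigma> z)"

lemma sm_\<mu>: "sm \<mu>"
  unfolding \<mu>_def[abs_def] by (intro smooth_on_exp open_dom) (simp add: smooth sm_\<sigma>)

lemma dy_\<mu>: "z \<in> \<Omega> \<Longrightarrow> dy k \<mu> z = 2 * \<mu> z * dy k \<sigma> z"
proof -
  assume z: "z \<in> \<Omega>"
  have sm2: "sm (\<lambda>z. 2 * \<sigma> z)" by (simp add: smooth sm_\<sigma>)
  have "dy k \<mu> z = exp (2 * \<sigma> z) * dy k (\<lambda>z. 2 * \<sigma> z) z"
    unfolding dy_def \<mu>_def[abs_def] by (rule fderiv_exp[OF smooth_on_differentiable[OF sm2 z]])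
  then show ?thesis using z by (simp add: \<mu>_def leibniz sm_\<sigma> smooth)
qed

lemma eul_\<sigma>: "z \<in> \<Omega> \<Longrightarrow> eul \<sigma> z = 0"
proof -
  assume z: "z \<in> \<Omega>"
  have e: "eul f z = frechet_derivative f (at z) (0, snd z)" if "sm f" for f
    using eul_eq[OF that, of "fst z" "snd z"] z by simp
  show ?thesis by (simp add: e sm_\<sigma> fderiv_\<sigma>[OF z]) (simp add: e[symmetric] sm_fund eul_fund[OF z])
qed

lemma mu_divergence:
  assumes z: "z \<in> \<Omega>" and W: "\<And>a. sm (W a)"
  shows "(\<Sum>a\<in>UNIV. dy a (\<lambda>z. \<mu> z * W a z) z) = \<mu> z * ((\<Sum>a\<in>UNIV. dy a (W a) z) + 2 * (\<Sum>a\<in>UNIV. dy a \<sigma> z * W a z))"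
  using z W by (simp add: leibniz sm_\<mu> dy_\<mu> sum.distrib sum_distrib_left algebra_simps)

text \<open>\<open>Div (f \<theta>\<^sup>#) = \<theta>\<^sup># f + f g\<^sup>a\<^sup>b \<theta>\<^sub>b\<^sub>\<cdot>\<^sub>a\<close>, since raising the index with \<open>g\<^sup>-\<^sup>1\<close> causes no extra term.\<close>

lemma raised_divergence:
  assumes z: "z \<in> \<Omega>" and \<theta>: "\<And>a. sm (\<theta> a)" and f: "sm f"
  shows "(\<Sum>a\<in>UNIV. dy a (\<lambda>z. f z * (\<Sum>b\<in>UNIV. h a b z * \<theta> b z)) z)
      + 2 * (\<Sum>a\<in>UNIV. dy a \<sigma> z * (f z * (\<Sum>b\<in>UNIV. h a b z * \<theta> b z))) =
    (\<Sum>a\<in>UNIV. dy a f z * (\<Sum>b\<in>UNIV. h a b z * \<theta> b z)) + f z * (\<Sum>a\<in>UNIV. \<Sum>b\<in>UNIV. h a b z * dy a (\<theta> b) z)"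
proof -
  have "(\<Sum>a\<in>UNIV. dy a (\<lambda>z. f z * (\<Sum>b\<in>UNIV. h a b z * \<theta> b z)) z) =
     (\<Sum>a\<in>UNIV. dy a f z * (\<Sum>b\<in>UNIV. h a b z * \<theta> b z)) + f z * (\<Sum>a\<in>UNIV. \<Sum>b\<in>UNIV. h a b z * dy a (\<theta> b) z)
     + f z * (\<Sum>a\<in>UNIV. \<Sum>b\<in>UNIV. dy a (h a b) z * \<theta> b z)"
    using z \<theta> f by (simp add: leibniz smooth_fin sum.distrib sum_distrib_left algebra_simps)
  moreover have "(\<Sum>a\<in>UNIV. \<Sum>b\<in>UNIV. dy a (h a b) z * \<theta> b z) = - 2 * (\<Sum>a\<in>UNIV. dy a \<sigma> z * (\<Sum>b\<in>UNIV. h a b z * \<theta> b z))"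
  proof -
    have "(\<Sum>a\<in>UNIV. \<Sum>b\<in>UNIV. dy a (h a b) z * \<theta> b z) = (\<Sum>b\<in>UNIV. (\<Sum>a\<in>UNIV. dy a (h a b) z) * \<theta> b z)"
      unfolding sum_distrib_right by (rule sum.swap)
    also have "\<dots> = - 2 * (\<Sum>b\<in>UNIV. \<Sum>a\<in>UNIV. dy a \<sigma> z * h a b z * \<theta> b z)"
      unfolding dy_fund_inv_trace[OF z] sum_distrib_left sum_distrib_right mult.assoc by (rule refl)
    also have "(\<Sum>b\<in>UNIV. \<Sum>a\<in>UNIV. dy a \<sigma> z * h a b z * \<theta> b z) = (\<Sum>a\<in>UNIV. \<Sum>b\<in>UNIV. dy a \<sigma> z * h a b z * \<theta> b z)"
      by (rule sum.swap)
    finally show ?thesis by (simp add: sum_distrib_left mult.assoc)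
  qed
  moreover have "(\<Sum>a\<in>UNIV. dy a \<sigma> z * (f z * (\<Sum>b\<in>UNIV. h a b z * \<theta> b z))) = f z * (\<Sum>a\<in>UNIV. dy a \<sigma> z * (\<Sum>b\<in>UNIV. h a b z * \<theta> b z))"
    by (simp add: sum_distrib_left mult_ac)
  ultimately show ?thesis by simp
qed

lemma dy_dy_E_raised:
  assumes z: "z \<in> \<Omega>"
  shows "(\<Sum>a\<in>UNIV. dy a (dy k E) z * (\<Sum>b\<in>UNIV. h a b z * \<theta> b)) = 2 * \<theta> k"
  using raise_lower(2)[OF z, of k \<theta>] 
  by (simp add: dy_dy_E fund_sym[OF z, of _ k] mult.assoc sum_distrib_left[symmetric])

lemma dy_E_raised:
  assumes z: "z \<in> \<Omega>"
  shows "(\<Sum>a\<in>UNIV. dy a E z * (\<Sum>b\<in>UNIV. h a b z * \<theta> b)) = 2 * (\<Sum>b\<in>UNIV. snd z $ b * \<theta> b)"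
proof -
  have "(\<Sum>a\<in>UNIV. dy a E z * (\<Sum>b\<in>UNIV. h a b z * \<theta> b)) = (\<Sum>b\<in>UNIV. (\<Sum>a\<in>UNIV. h b a z * dy a E z) * \<theta> b)"
    unfolding sum_distrib_left sum_distrib_right
    by (subst sum.swap) (simp add: mult_ac fund_inv_sym[OF z, of a b for a b])
  then show ?thesis by (simp add: fund_inv_dy_E[OF z] sum_distrib_left mult.assoc)
qed

lemma dyn1_y:
  assumes \<theta>: "\<And>k. sm (\<theta> k)" "\<And>w. w \<in> \<Omega> \<Longrightarrow> (\<Sum>k\<in>UNIV. snd w $ k * \<theta> k w) = 0" and z: "z \<in> \<Omega>"
  shows "(\<Sum>k\<in>UNIV. snd z $ k * dyn1 G \<theta> k z) = 0"
proof -
  have "S (\<lambda>z. \<Sum>k\<in>UNIV. snd z $ k * \<theta> k z) z = S (\<lambda>z. 0) z"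
    by (rule sder_cong[OF \<theta>(2) z])
  then have 1: "(\<Sum>k\<in>UNIV. snd z $ k * S (\<theta> k) z) = (\<Sum>j\<in>UNIV. 2 * G j z * \<theta> j z)"
    using z \<theta>(1) by (simp add: deriv_rules smooth sum.distrib sum_negf sum_subtractf)
  have "(\<Sum>k\<in>UNIV. snd z $ k * (\<Sum>j\<in>UNIV. N j k z * \<theta> j z)) = (\<Sum>j\<in>UNIV. 2 * G j z * \<theta> j z)"
    unfolding N_y[OF z, symmetric] sum_distrib_left sum_distrib_right
    by (subst sum.swap) (simp add: mult_ac)
  then show ?thesis using 1 by (simp add: dyn1_def right_diff_distrib sum_subtractf)
qed

lemma P_y: "z \<in> \<Omega> \<Longrightarrow> (\<Sum>k\<in>UNIV. snd z $ k * P k z) = 0"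
proof -
  assume z: "z \<in> \<Omega>"
  have e: "eul \<tau> z = \<tau> z" unfolding \<tau>_def[abs_def] by (subst eul_rules(4)[OF z]) (simp_all add: smooth eul_N z)
  show ?thesis using e hder_y[OF z, of \<sigma>] sder_\<sigma>[OF z]
    by (simp add: mean_landsberg_eq[OF z] right_diff_distrib sum_subtractf eul_def)
qed

lemma jacobi_P_y: "z \<in> \<Omega> \<Longrightarrow> (\<Sum>k\<in>UNIV. snd z $ k * jacobi_P k z) = 0"
proof -
  assume z: "z \<in> \<Omega>"
  have Q: "(\<Sum>k\<in>UNIV. snd w $ k * Q k w) = 0" if "w \<in> \<Omega>" for w
    by (rule dyn1_y[OF sm_P P_y that])
  have "(\<Sum>k\<in>UNIV. snd z $ k * dyn1 G Q k z) = 0"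
    by (rule dyn1_y[OF sm_dyn1[OF sm_P] Q z])
  moreover have "(\<Sum>k\<in>UNIV. snd z $ k * (\<Sum>a\<in>UNIV. R a k z * P a z)) = (\<Sum>a\<in>UNIV. (\<Sum>k\<in>UNIV. R a k z * snd z $ k) * P a z)"
    unfolding sum_distrib_left sum_distrib_right by (subst sum.swap) (simp add: mult_ac)
  ultimately show ?thesis
    by (simp add: jacobi_P_def distrib_left sum.distrib jacobi_y[OF z])
qed

lemma dyn_jacobi_dy_E: "z \<in> \<Omega> \<Longrightarrow> (\<Sum>a\<in>UNIV. dy a E z * dyn2 G R a k z) = 0"
proof -
  assume z: "z \<in> \<Omega>"
  have "S (\<lambda>z. \<Sum>i\<in>UNIV. R i k z * dy i E z) z = S (\<lambda>z. 0) z"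
    by (rule sder_cong[OF jacobi_dy_E z])
  then have 1: "(\<Sum>i\<in>UNIV. S (R i k) z * dy i E z) + (\<Sum>i\<in>UNIV. R i k z * (\<Sum>a\<in>UNIV. N a i z * dy a E z)) = 0"
    using z by (simp add: deriv_rules smooth_fin sum.distrib sder_dy_E)
  have 2: "(\<Sum>i\<in>UNIV. R i k z * (\<Sum>a\<in>UNIV. N a i z * dy a E z)) = (\<Sum>a\<in>UNIV. dy a E z * (\<Sum>b\<in>UNIV. N a b z * R b k z))"
    unfolding sum_distrib_left by (subst sum.swap) (simp add: mult_ac)
  have 3: "(\<Sum>a\<in>UNIV. dy a E z * (\<Sum>b\<in>UNIV. N b k z * R a b z)) = 0"
  proof -
    have "(\<Sum>a\<in>UNIV. dy a E z * (\<Sum>b\<in>UNIV. N b k z * R a b z)) = (\<Sum>b\<in>UNIV. N b k z * (\<Sum>a\<in>UNIV. R a b z * dy a E z))"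
      unfolding sum_distrib_left by (subst sum.swap) (simp add: mult_ac)
    then show ?thesis by (simp only: jacobi_dy_E[OF z]) simp
  qed
  show ?thesis using 1 unfolding 2
    by (simp add: dyn2_def distrib_left right_diff_distrib sum.distrib sum_subtractf 3 mult.commute)
qed

end

locale local_einstein = local_finsler U L for U :: "(real^'n::finite) set" and L +
  fixes r :: "real^'n \<Rightarrow> real"
  assumes smooth_r: "smooth_on U r"
    and einstein: "\<And>z. z \<in> U \<times> (UNIV - {0}) \<Longrightarrow> ricci L z = r (fst z) * (L z)\<^sup>2"
    and landsberg: "\<And>z. z \<in> U \<times> (UNIV - {0}) \<Longrightarrow> mean_landsberg_expr L z = 0"
begin

definition \<rho> :: "'n cfun" where "\<rho> z = r (fst z)"

lemma sm_\<rho>: "sm \<rho>"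
  unfolding \<rho>_def[abs_def] by (intro smooth_on_fst open_U smooth_r) auto

lemma dx_\<rho>: "z \<in> \<Omega> \<Longrightarrow> dx k \<rho> z = frechet_derivative r (at (fst z)) (axis k 1)"
  unfolding \<rho>_def[abs_def] dx_def
  by (intro fderiv_fst(2) smooth_on_differentiable[OF smooth_r]) auto

lemma dy_\<rho>: "z \<in> \<Omega> \<Longrightarrow> dy k \<rho> z = 0"
proof -
  assume z: "z \<in> \<Omega>"
  have d: "r differentiable (at (fst z))" by (intro smooth_on_differentiable[OF smooth_r]) (use z in auto)
  have "dy k \<rho> z = frechet_derivative r (at (fst z)) 0"
    unfolding \<rho>_def[abs_def] dy_def by (rule fderiv_fst(2)[OF d])
  then show ?thesis using linear_0[OF linear_frechet_derivative[OF d]] by simp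
qed

lemma dy_dx_\<rho>: "z \<in> \<Omega> \<Longrightarrow> dy k (dx l \<rho>) z = 0"
  using dx_cong[of "dy k \<rho>" "\<lambda>z. 0" z l] dy_\<rho> by (simp add: dy_dx_commute[OF sm_\<rho>] leibniz)

definition \<rho>0 :: "'n cfun" where "\<rho>0 z = (\<Sum>i\<in>UNIV. snd z $ i * dx i \<rho> z)"

lemma einstein_identity:
  assumes z: "z \<in> \<Omega>"
  shows "(\<Sum>a\<in>UNIV. dy a (dyn2 G R a k) z) + 2 * (\<Sum>a\<in>UNIV. dyn2 G R a k z * dy a \<sigma> z) + 2 * jacobi_P k z
    + \<rho>0 z * dy k E z - E z * dx k \<rho> z = 0"
proof -
  have Ric: "Ric w = \<rho> w * E w" if "w \<in> \<Omega>" for w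
    using einstein[OF that] by (simp add: ricci_eq \<rho>_def E_def)
  have dRic: "dy k Ric w = \<rho> w * dy k E w" if "w \<in> \<Omega>" for w k
    using dy_cong[of Ric "\<lambda>w. \<rho> w * E w" w k] Ric that by (simp add: leibniz sm_\<rho> sm_E dy_\<rho>)
  have S\<rho>: "S \<rho> z = \<rho>0 z" using z by (simp add: sder_def dy_\<rho> \<rho>0_def)
  have "S (dy k Ric) z = S (\<lambda>w. \<rho> w * dy k E w) z" by (rule sder_cong[OF dRic z])
  then have "S (dy k Ric) z = \<rho>0 z * dy k E z + \<rho> z * (\<Sum>a\<in>UNIV. N a k z * dy a E z)"
    using z by (simp add: deriv_rules smooth_fin sm_\<rho> S\<rho> sder_dy_E)
  then have 1: "dyn1 G (\<lambda>k. dy k Ric) k z = \<rho>0 z * dy k E z"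
    by (simp add: dyn1_def dRic[OF z] sum_distrib_left mult.left_commute)
  have "\<delta> k Ric z = \<delta> k (\<lambda>w. \<rho> w * E w) z" by (rule hder_cong[OF Ric z])
  moreover have "\<delta> k \<rho> z = dx k \<rho> z" using z by (simp add: hder_def dy_\<rho>)
  ultimately have 2: "\<delta> k Ric z = E z * dx k \<rho> z"
    using z by (simp add: deriv_rules sm_\<rho> sm_E hder_E)
  show ?thesis using weighted_identity[OF z, of k] unfolding 1 2 by simp
qed

text \<open>For each \<open>k\<close> a vertical vector field with index \<open>a\<close>, namely \<open>Z\<^sub>k = V\<^sub>k + 2 y\<^sub>k T\<^sup>#\<close>; note that
\<open>E\<^sub>\<cdot>\<^sub>k = 2 y\<^sub>k\<close>.\<close>

definition curvature_field :: "'n \<Rightarrow> 'n \<Rightarrow> 'n cfun" where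
  "curvature_field k a z = dyn2 G R a k z + dy k E z * (\<Sum>b\<in>UNIV. h a b z * jacobi_P b z)"

text \<open>The field \<open>Y\<^sub>k\<close>. The radial part \<open>- \<rho>\<^sub>k y\<^sup>a\<close> is what makes the divergence proportional to \<open>2 - n\<close> and
\<open>Y\<^sub>k E\<close> proportional to the divergence of the curvature field.\<close>

definition gradient_field :: "'n \<Rightarrow> 'n \<Rightarrow> 'n cfun" where
  "gradient_field k a z = dy k E z * (\<Sum>b\<in>UNIV. h a b z * dx b \<rho> z) - dx k \<rho> z * snd z $ a"

lemma sm_curvature_field: "sm (curvature_field k a)"
  unfolding curvature_field_def[abs_def] by (simp add: smooth_fin sm_jacobi_P)

lemma sm_gradient_field: "sm (gradient_field k a)"
  unfolding gradient_field_def[abs_def] by (simp add: smooth_fin sm_\<rho>)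

lemma divergence_curvature_field:
  assumes z: "z \<in> \<Omega>"
  shows "(\<Sum>a\<in>UNIV. dy a (\<lambda>z. \<mu> z * curvature_field k a z) z) = \<mu> z * (E z * dx k \<rho> z - \<rho>0 z * dy k E z)"
proof -
  have 0: "(\<Sum>a\<in>UNIV. \<Sum>b\<in>UNIV. h a b z * dy a (jacobi_P b) z) = 0"
  proof -
    have "(\<Sum>a\<in>UNIV. \<Sum>b\<in>UNIV. h a b z * dy a (jacobi_P b) z) = (\<Sum>b\<in>UNIV. \<Sum>a\<in>UNIV. h b a z * dy a (jacobi_P b) z)"
      by (subst sum.swap) (simp add: fund_inv_sym[OF z, of a b for a b])
    then show ?thesis using landsberg[OF z] jacobi_P_divergence[OF z] by simp
  qed
  have "(\<Sum>a\<in>UNIV. dy a (curvature_field k a) z) + 2 * (\<Sum>a\<in>UNIV. dy a \<sigma> z * curvature_field k a z) =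
     (\<Sum>a\<in>UNIV. dy a (dyn2 G R a k) z) + 2 * (\<Sum>a\<in>UNIV. dyn2 G R a k z * dy a \<sigma> z) +
     ((\<Sum>a\<in>UNIV. dy a (\<lambda>z. dy k E z * (\<Sum>b\<in>UNIV. h a b z * jacobi_P b z)) z)
      + 2 * (\<Sum>a\<in>UNIV. dy a \<sigma> z * (dy k E z * (\<Sum>b\<in>UNIV. h a b z * jacobi_P b z))))"
    unfolding curvature_field_def[abs_def] using z
    by (simp add: dx_dy_add smooth_fin sm_jacobi_P distrib_left sum.distrib mult.commute[of "dy _ \<sigma> z" "dyn2 G R _ k z"])
  also have "\<dots> = E z * dx k \<rho> z - \<rho>0 z * dy k E z"
    unfolding raised_divergence[OF z sm_jacobi_P sm_dy[OF sm_E]] dy_dy_E_raised[OF z] 0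
    using einstein_identity[OF z, of k] by simp
  finally show ?thesis by (simp add: mu_divergence[OF z sm_curvature_field])
qed

lemma dy_E_curvature_field: "z \<in> \<Omega> \<Longrightarrow> (\<Sum>a\<in>UNIV. dy a E z * curvature_field k a z) = 0"
  using dyn_jacobi_dy_E[of z k] dy_E_raised[of z "\<lambda>b. jacobi_P b z"] jacobi_P_y[of z]
  by (simp add: curvature_field_def distrib_left sum.distrib mult.left_commute[of _ "dy k E z"] sum_distrib_left[symmetric])

lemma divergence_gradient_field:
  assumes z: "z \<in> \<Omega>"
  shows "(\<Sum>a\<in>UNIV. dy a (\<lambda>z. \<mu> z * gradient_field k a z) z) = \<mu> z * ((2 - real CARD('n)) * dx k \<rho> z)"
proof -
  have 0: "(\<Sum>a\<in>UNIV. \<Sum>b\<in>UNIV. h a b z * dy a (dx b \<rho>) z) = 0"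
    using z by (simp add: dy_dx_\<rho>)
  have 1: "(\<Sum>a\<in>UNIV. dy a (\<lambda>z. dx k \<rho> z * snd z $ a) z) = real CARD('n) * dx k \<rho> z"
    using z by (simp add: leibniz smooth sm_\<rho> dy_dx_\<rho> axis_def)
  have 2: "(\<Sum>a\<in>UNIV. dy a \<sigma> z * (dx k \<rho> z * snd z $ a)) = 0"
  proof -
    have "(\<Sum>a\<in>UNIV. dy a \<sigma> z * (dx k \<rho> z * snd z $ a)) = dx k \<rho> z * eul \<sigma> z"
      by (simp add: eul_def sum_distrib_left mult_ac)
    then show ?thesis by (simp add: eul_\<sigma>[OF z])
  qed
  have "(\<Sum>a\<in>UNIV. dy a (gradient_field k a) z) + 2 * (\<Sum>a\<in>UNIV. dy a \<sigma> z * gradient_field k a z) =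
     ((\<Sum>a\<in>UNIV. dy a (\<lambda>z. dy k E z * (\<Sum>b\<in>UNIV. h a b z * dx b \<rho> z)) z)
      + 2 * (\<Sum>a\<in>UNIV. dy a \<sigma> z * (dy k E z * (\<Sum>b\<in>UNIV. h a b z * dx b \<rho> z))))
     - (\<Sum>a\<in>UNIV. dy a (\<lambda>z. dx k \<rho> z * snd z $ a) z)
     - 2 * (\<Sum>a\<in>UNIV. dy a \<sigma> z * (dx k \<rho> z * snd z $ a))"
    unfolding gradient_field_def[abs_def] using z
    by (simp add: dx_dy_diff smooth_fin sm_\<rho> right_diff_distrib sum_subtractf)
  also have "\<dots> = (2 - real CARD('n)) * dx k \<rho> z"
    unfolding raised_divergence[OF z sm_dx[OF sm_\<rho>] sm_dy[OF sm_E]] dy_dy_E_raised[OF z] 0 1 2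
    by (simp add: algebra_simps)
  finally show ?thesis by (simp add: mu_divergence[OF z sm_gradient_field])
qed

lemma dy_E_gradient_field: "z \<in> \<Omega> \<Longrightarrow> (\<Sum>a\<in>UNIV. dy a E z * gradient_field k a z) = 2 * (\<rho>0 z * dy k E z - E z * dx k \<rho> z)"
proof -
  assume z: "z \<in> \<Omega>"
  have "(\<Sum>a\<in>UNIV. dy a E z * (dx k \<rho> z * snd z $ a)) = 2 * E z * dx k \<rho> z"
  proof -
    have "(\<Sum>a\<in>UNIV. dy a E z * (dx k \<rho> z * snd z $ a)) = dx k \<rho> z * eul E z"
      by (simp add: eul_def sum_distrib_left mult_ac)
    then show ?thesis by (simp add: eul_E[OF z])
  qed
  moreover have "(\<Sum>a\<in>UNIV. dy a E z * (dy k E z * (\<Sum>b\<in>UNIV. h a b z * dx b \<rho> z))) = 2 * \<rho>0 z * dy k E z"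
    using dy_E_raised[OF z, of "\<lambda>b. dx b \<rho> z"]
    by (simp add: mult.left_commute[of _ "dy k E z"] sum_distrib_left[symmetric] \<rho>0_def)
  ultimately show ?thesis
    by (simp add: gradient_field_def right_diff_distrib sum_subtractf)
qed

end

section \<open>Integration over a fibre\<close>

context local_finsler
begin

lemma E_scale: "x \<in> U \<Longrightarrow> y \<noteq> 0 \<Longrightarrow> t > 0 \<Longrightarrow> E (x, t *\<^sub>R y) = t\<^sup>2 * E (x, y)"
  by (simp add: E_def homogeneous power_mult_distrib)

lemma E_bounds:
  assumes x: "x \<in> U"
  obtains m M where "0 < m" "\<And>y. y \<noteq> 0 \<Longrightarrow> m * (norm y)\<^sup>2 \<le> E (x, y)"
    "\<And>y. y \<noteq> 0 \<Longrightarrow> E (x, y) \<le> M * (norm y)\<^sup>2"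
proof -
  let ?S = "sphere (0 :: real^'n) 1"
  have ne: "?S \<noteq> {}" by (simp add: sphere_eq_empty)
  have cont: "continuous_on ?S (\<lambda>y. E (x, y))"
    using x by (intro continuous_on_compose2[OF smooth_on_continuous_on[OF sm_E]] continuous_intros) auto
  obtain y1 where y1: "y1 \<in> ?S" "\<And>y. y \<in> ?S \<Longrightarrow> E (x, y1) \<le> E (x, y)"
    using continuous_attains_inf[OF compact_sphere ne cont] by blast
  obtain y2 where y2: "y2 \<in> ?S" "\<And>y. y \<in> ?S \<Longrightarrow> E (x, y) \<le> E (x, y2)"
    using continuous_attains_sup[OF compact_sphere ne cont] by blast
  have scale: "E (x, y) = E (x, y /\<^sub>R norm y) * (norm y)\<^sup>2" "y /\<^sub>R norm y \<in> ?S" if "y \<noteq> 0" for y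
    using E_scale[OF x, of y "inverse (norm y)"] that by (simp_all add: power_inverse field_simps)
  show ?thesis
  proof (rule that[of "E (x, y1)" "E (x, y2)"])
    show "0 < E (x, y1)" using y1(1) x by (intro E_pos) auto
    show "E (x, y1) * (norm y)\<^sup>2 \<le> E (x, y)" if "y \<noteq> 0" for y
      using y1(2)[OF scale(2)[OF that]] scale(1)[OF that] by (metis mult_right_mono zero_le_power2)
    show "E (x, y) \<le> E (x, y2) * (norm y)\<^sup>2" if "y \<noteq> 0" for y
      using y2(2)[OF scale(2)[OF that]] scale(1)[OF that] by (metis mult_right_mono zero_le_power2)
  qed
qed

text \<open>The bounds on \<open>E\<close> show that a function of \<open>y\<close> supported in \<open>1 \<le> E \<le> 2\<close> vanishes near \<open>0\<close> and far away.
Extended by \<open>0\<close> at the origin, where \<open>H\<close> has no meaningful value, it is differentiable on the whole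
tangent space and its partial derivatives integrate to \<open>0\<close>.\<close>

lemma fibre_integral_dy:
  assumes x: "x \<in> U"
    and diff: "\<And>z. z \<in> \<Omega> \<Longrightarrow> H differentiable (at z)"
    and cont: "continuous_on \<Omega> (dy a H)"
    and supp: "\<And>y. y \<noteq> 0 \<Longrightarrow> E (x, y) \<notin> {1..2} \<Longrightarrow> H (x, y) = 0"
  shows "((\<lambda>y. if y = 0 then 0 else dy a H (x, y)) has_integral 0) UNIV"
proof -
  obtain m M where mM: "0 < m" "\<And>y. y \<noteq> 0 \<Longrightarrow> m * (norm y)\<^sup>2 \<le> E (x, y)"
    "\<And>y. y \<noteq> 0 \<Longrightarrow> E (x, y) \<le> M * (norm y)\<^sup>2"
    using E_bounds[OF x] by blast
  have "M > 0"
    using mM(1) mM(2)[of "axis a 1"] mM(3)[of "axis a 1"] by (simp add: axis_eq_0_iff)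
  define d where "d = 1 / (M + 1)"
  have d: "d > 0" using \<open>M > 0\<close> by (simp add: d_def)
  define f where "f y = (if y = 0 then 0 else H (x, y))" for y
  have small: "f y = 0" if "norm y < d" for y
  proof (cases "y = 0")
    case False
    have "norm y < 1" using that \<open>M > 0\<close> by (simp add: d_def field_simps) (smt (verit) mult_nonneg_nonneg norm_ge_zero)
    then have "M * (norm y)\<^sup>2 \<le> M * norm y"
      using \<open>M > 0\<close> by (simp add: power2_eq_square mult_left_le_one_le)
    also have "\<dots> < 1"
      using that \<open>M > 0\<close> by (simp add: d_def field_simps) (smt (verit) norm_ge_zero)
    finally show ?thesis using supp[OF False] mM(3)[OF False] by (simp add: f_def)
  qed (simp add: f_def)
  have large: "f y = 0" if "norm y > 2 / m + 1" for y
  proof (cases "y = 0")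
    case False
    have "1 < norm y" using that mM(1) by (smt (verit) divide_nonneg_pos)
    then have "m * norm y \<le> m * (norm y)\<^sup>2"
      using mM(1) by (intro mult_left_mono self_le_power) auto
    moreover have "2 < m * norm y"
    proof -
      have "2 / m < norm y" using that by simp
      then show ?thesis using mM(1) by (simp add: pos_divide_less_eq mult.commute)
    qed
    ultimately show ?thesis using supp[OF False] mM(2)[OF False] by (simp add: f_def)
  qed (simp add: f_def)
  have der0: "(f has_derivative (\<lambda>v. 0)) (at y)" if "norm y < d" for y
  proof (rule has_derivative_transform_within_open[of "\<lambda>_. 0" _ _ _ "ball 0 d"])
    show "0 = f w" if "w \<in> ball 0 d" for w using small[of w] that by simp
  qed (use that in auto)
  have der1: "(f has_derivative (\<lambda>v. frechet_derivative H (at (x, y)) (0, v))) (at y)" if "y \<noteq> 0" for y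
  proof (rule has_derivative_transform_within_open[of "\<lambda>y. H (x, y)" _ _ _ "- {0}"])
    show "((\<lambda>y. H (x, y)) has_derivative (\<lambda>v. frechet_derivative H (at (x, y)) (0, v))) (at y)"
      by (rule has_derivative_compose[of "\<lambda>y. (x, y)" "\<lambda>v. (0, v)" y UNIV H])
        (use x that in \<open>auto intro!: derivative_eq_intros has_derivative_frechet diff\<close>)
  qed (use that in \<open>auto simp: f_def\<close>)
  define f' where "f' y v = (if norm y < d then 0 else frechet_derivative H (at (x, y)) (0, v))" for y v
  have der: "(f has_derivative f' y) (at y)" for y
  proof (cases "norm y < d")
    case False
    then have "y \<noteq> 0" using d by auto
    then show ?thesis using der1[of y] False by (simp add: f'_def[abs_def])
  qed (use der0 in \<open>simp add: f'_def[abs_def]\<close>)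
  have dy0: "dy a H (x, y) = 0" if "norm y < d" "y \<noteq> 0" for y
    using has_derivative_unique[OF der0[OF that(1)] der1[OF that(2)]] unfolding dy_def by metis
  have f'_eq: "f' y (axis a 1) = (if y = 0 then 0 else dy a H (x, y))" for y
    using dy0[of y] d by (auto simp: f'_def dy_def)
  have "continuous_on (ball 0 d \<union> - {0}) (\<lambda>y. if y = 0 then 0 else dy a H (x, y))"
  proof (rule continuous_on_open_Un)
    show "continuous_on (ball 0 d) (\<lambda>y. if y = 0 then 0 else dy a H (x, y))"
      by (rule continuous_on_eq[of _ "\<lambda>_. 0"]) (auto simp: dy0)
    have "continuous_on (- {0}) (\<lambda>y. dy a H (x, y))"
      using x by (intro continuous_on_compose2[OF cont] continuous_intros) auto
    then show "continuous_on (- {0}) (\<lambda>y. if y = 0 then 0 else dy a H (x, y))"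
      by (rule continuous_on_eq) auto
  qed auto
  moreover have "ball 0 d \<union> - {0} = (UNIV :: (real^'n) set)" using d by auto
  ultimately have "continuous_on UNIV (\<lambda>y. f' y (axis a 1))" by (simp add: f'_eq)
  from has_integral_directional_derivative_0[OF der this large]
  show ?thesis by (simp add: f'_eq)
qed

lemma fibre_divergence:
  fixes c c' :: "real \<Rightarrow> real"
  assumes x: "x \<in> U" and A: "\<And>a. sm (A a)"
    and c: "\<And>s. (c has_real_derivative c' s) (at s)" "continuous_on UNIV c'"
    and supp: "\<And>s. s \<notin> {1..2} \<Longrightarrow> c s = 0"
  shows "((\<lambda>y. if y = 0 then 0 else c' (E (x, y)) * (\<Sum>a\<in>UNIV. dy a E (x, y) * A a (x, y))
      + c (E (x, y)) * (\<Sum>a\<in>UNIV. dy a (A a) (x, y))) has_integral 0) UNIV"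
proof -
  have cE: "((\<lambda>z. c (E z)) has_derivative (\<lambda>v. c' (E z) * frechet_derivative E (at z) v)) (at z)" if "z \<in> \<Omega>" for z
    by (rule has_derivative_compose[OF has_derivative_frechet[OF smooth_on_differentiable[OF sm_E that]]
        c(1)[unfolded has_field_derivative_def]])
  have cc: "continuous_on UNIV c" using c(1) by (meson DERIV_isCont continuous_at_imp_continuous_on)
  have dH: "(\<lambda>z. c (E z) * A a z) differentiable (at z)"
    and dyH: "dy a (\<lambda>z. c (E z) * A a z) z = c' (E z) * dy a E z * A a z + c (E z) * dy a (A a) z"
    if "z \<in> \<Omega>" for z a
  proof -
    have 1: "(\<lambda>z. c (E z)) differentiable (at z)" by (rule differentiableI[OF cE[OF that]])
    have 2: "A a differentiable (at z)" by (rule smooth_on_differentiable[OF A that])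
    show "(\<lambda>z. c (E z) * A a z) differentiable (at z)" by (rule differentiable_mult[OF 1 2])
    show "dy a (\<lambda>z. c (E z) * A a z) z = c' (E z) * dy a E z * A a z + c (E z) * dy a (A a) z"
      unfolding dy_def fderiv_mult[OF 1 2] frechet_derivative_eqI[OF cE[OF that]] by simp
  qed
  have "((\<lambda>y. if y = 0 then 0 else dy a (\<lambda>z. c (E z) * A a z) (x, y)) has_integral 0) UNIV" for a
  proof (rule fibre_integral_dy[OF x dH])
    have "continuous_on \<Omega> (\<lambda>z. c' (E z) * dy a E z * A a z + c (E z) * dy a (A a) z)"
      using smooth_on_continuous_on[OF sm_E] smooth_on_continuous_on[OF sm_dy[OF sm_E, of a]]
        smooth_on_continuous_on[OF A[of a]] smooth_on_continuous_on[OF sm_dy[OF A, of a a]]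
      by (intro continuous_intros continuous_on_compose2[OF c(2)] continuous_on_compose2[OF cc]) auto
    then show "continuous_on \<Omega> (dy a (\<lambda>z. c (E z) * A a z))"
      by (rule continuous_on_eq) (simp add: dyH)
  qed (use supp in auto)
  then have "((\<lambda>y. \<Sum>a\<in>UNIV. if y = 0 then 0 else dy a (\<lambda>z. c (E z) * A a z) (x, y)) has_integral (\<Sum>a\<in>(UNIV::'n set). 0)) UNIV"
    by (intro has_integral_sum) auto
  moreover have "(\<Sum>a\<in>UNIV. if y = 0 then 0 else dy a (\<lambda>z. c (E z) * A a z) (x, y)) =
     (if y = 0 then 0 else c' (E (x, y)) * (\<Sum>a\<in>UNIV. dy a E (x, y) * A a (x, y))
      + c (E (x, y)) * (\<Sum>a\<in>UNIV. dy a (A a) (x, y)))" for y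
    using x by (simp add: dyH sum.distrib sum_distrib_left mult.assoc)
  ultimately show ?thesis by simp
qed

end

text \<open>A bump function supported in \<open>[1, 2]\<close>, of class \<open>C\<^sup>n\<^sup>-\<^sup>1\<close> for \<open>n > 0\<close>. The third power is used below, since the
fibre integrals involve its first two derivatives.\<close>

definition bump :: "nat \<Rightarrow> real \<Rightarrow> real" where "bump n s = (max 0 ((s - 1) * (2 - s))) ^ n"

lemma bump_nonneg: "bump n s \<ge> 0"
  by (simp add: bump_def)

lemma bump_support: "n > 0 \<Longrightarrow> s \<notin> {1..2} \<Longrightarrow> bump n s = 0"
proof -
  assume "n > 0" "s \<notin> {1..2}"
  then have "(s - 1) * (2 - s) < 0" by (auto simp: not_le intro: mult_neg_pos mult_pos_neg)
  then show ?thesis using \<open>n > 0\<close> by (simp add: bump_def max_def)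
qed

lemma DERIV_max_power:
  fixes t :: real
  shows "((\<lambda>t. max 0 t ^ (Suc (Suc n))) has_real_derivative real (Suc (Suc n)) * max 0 t ^ Suc n) (at t)"
proof (cases t "0::real" rule: linorder_cases)
  case less
  show ?thesis
    by (rule has_field_derivative_transform_within_open[of "\<lambda>_. 0" _ _ "{..<0}"]) (use less in auto)
next
  case greater
  have "((\<lambda>t. t ^ Suc (Suc n)) has_real_derivative real (Suc (Suc n)) * max 0 t ^ Suc n) (at t)"
    using DERIV_pow[of "Suc (Suc n)" t UNIV] greater by simp
  then show ?thesis
    by (rule has_field_derivative_transform_within_open[of _ _ _ "{0<..}"]) (use greater in auto)
next
  case equal
  have "((\<lambda>s. max 0 s ^ Suc n) \<longlongrightarrow> max 0 0 ^ Suc n) (at (0::real))"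
    by (intro tendsto_intros)
  moreover have "(max 0 s ^ Suc (Suc n) - max 0 0 ^ Suc (Suc n)) / (s - 0) = max 0 s ^ Suc n" if "s \<noteq> 0" for s :: real
    using that by (auto simp: max_def)
  ultimately have "((\<lambda>s. (max 0 s ^ Suc (Suc n) - max 0 0 ^ Suc (Suc n)) / (s - 0)) \<longlongrightarrow> 0) (at (0::real))"
    by (subst tendsto_cong[of _ "\<lambda>s. max 0 s ^ Suc n"]) (auto simp: eventually_at_filter)
  then show ?thesis using equal by (simp add: has_field_derivative_iff)
qed

lemma DERIV_bump:
  "(bump (Suc (Suc n)) has_real_derivative real (Suc (Suc n)) * bump (Suc n) s * (3 - 2 * s)) (at s)"
proof -
  have "((\<lambda>s. (s - 1) * (2 - s)) has_real_derivative (3 - 2 * s)) (at s)"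
    by (auto intro!: derivative_eq_intros)
  from DERIV_chain2[OF DERIV_max_power this]
  show ?thesis by (simp add: bump_def[abs_def])
qed

lemma continuous_on_bump: "continuous_on A (bump n)"
  unfolding bump_def[abs_def] by (intro continuous_intros)

context local_einstein
begin

text \<open>The field \<open>2 \<phi>'(E) Z\<^sub>k + \<phi>(E) Y\<^sub>k\<close> has divergence \<open>(2 - n) \<rho>\<^sub>k \<phi>(E)\<close>: the terms with \<open>\<phi>'\<close> cancel and the
term with \<open>\<phi>''\<close> vanishes because \<open>Z\<^sub>k\<close> is tangent to the level sets of \<open>E\<close>. Here \<open>\<rho>\<^sub>k\<close> is constant on the fibre.\<close>

theorem dx_\<rho>_0:
  assumes x: "x \<in> U" and dim: "CARD('n) \<ge> 3" and y0: "y0 \<noteq> 0"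
  shows "dx k \<rho> (x, y0) = 0"
proof (rule ccontr)
  assume "dx k \<rho> (x, y0) \<noteq> 0"
  moreover have \<rho>k: "dx k \<rho> (x, y) = dx k \<rho> (x, y0)" if "y \<noteq> 0" for y
    using x that y0 by (simp add: dx_\<rho>)
  ultimately have nz: "(2 - real CARD('n)) * dx k \<rho> (x, y0) \<noteq> 0" using dim by simp
  let ?\<phi> = "bump 3" and ?\<phi>' = "\<lambda>s. 3 * bump 2 s * (3 - 2 * s)"
    and ?\<phi>'' = "\<lambda>s. 6 * bump 1 s * (3 - 2 * s)\<^sup>2 - 6 * bump 2 s"
  have \<phi>: "(?\<phi> has_real_derivative ?\<phi>' s) (at s)" for s
    using DERIV_bump[of 1 s] by (simp add: numeral_eq_Suc)
  have b2: "(bump 2 has_real_derivative 2 * bump 1 s * (3 - 2 * s)) (at s)" for s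
    using DERIV_bump[of 0 s] by (simp add: numeral_eq_Suc)
  have \<phi>': "(?\<phi>' has_real_derivative ?\<phi>'' s) (at s)" for s
    by (rule derivative_eq_intros b2 refl)+ (simp add: power2_eq_square algebra_simps)
  let ?I = "\<lambda>y. if y = 0 then 0 else ?\<phi> (E (x, y)) * \<mu> (x, y)"
  have 1: "((\<lambda>y. if y = 0 then 0 else ?\<phi>'' (E (x, y)) * (\<Sum>a\<in>UNIV. dy a E (x, y) * (\<mu> (x, y) * curvature_field k a (x, y)))
      + ?\<phi>' (E (x, y)) * (\<Sum>a\<in>UNIV. dy a (\<lambda>z. \<mu> z * curvature_field k a z) (x, y))) has_integral 0) UNIV"
    by (rule fibre_divergence[OF x]) (use \<phi>' in \<open>auto intro!: continuous_intros continuous_on_bump simp: smooth sm_\<mu> sm_curvature_field bump_support\<close>)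
  have 2: "((\<lambda>y. if y = 0 then 0 else ?\<phi>' (E (x, y)) * (\<Sum>a\<in>UNIV. dy a E (x, y) * (\<mu> (x, y) * gradient_field k a (x, y)))
      + ?\<phi> (E (x, y)) * (\<Sum>a\<in>UNIV. dy a (\<lambda>z. \<mu> z * gradient_field k a z) (x, y))) has_integral 0) UNIV"
    by (rule fibre_divergence[OF x]) (use \<phi> in \<open>auto intro!: continuous_intros continuous_on_bump simp: smooth sm_\<mu> sm_gradient_field bump_support\<close>)
  have eq: "2 * (if y = 0 then 0 else ?\<phi>'' (E (x, y)) * (\<Sum>a\<in>UNIV. dy a E (x, y) * (\<mu> (x, y) * curvature_field k a (x, y)))
      + ?\<phi>' (E (x, y)) * (\<Sum>a\<in>UNIV. dy a (\<lambda>z. \<mu> z * curvature_field k a z) (x, y))) +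
      (if y = 0 then 0 else ?\<phi>' (E (x, y)) * (\<Sum>a\<in>UNIV. dy a E (x, y) * (\<mu> (x, y) * gradient_field k a (x, y)))
      + ?\<phi> (E (x, y)) * (\<Sum>a\<in>UNIV. dy a (\<lambda>z. \<mu> z * gradient_field k a z) (x, y))) =
      (2 - real CARD('n)) * dx k \<rho> (x, y0) * ?I y" for y
  proof (cases "y = 0")
    case False
    then have z: "(x, y) \<in> \<Omega>" using x by simp
    have m: "(\<Sum>a\<in>UNIV. dy a E (x, y) * (\<mu> (x, y) * W a (x, y))) = \<mu> (x, y) * (\<Sum>a\<in>UNIV. dy a E (x, y) * W a (x, y))" for W :: "'n \<Rightarrow> 'n cfun"
      by (simp add: sum_distrib_left mult_ac)
    show ?thesis
      using False unfolding m dy_E_curvature_field[OF z] dy_E_gradient_field[OF z] divergence_curvature_field[OF z] divergence_gradient_field[OF z] \<rho>k[OF False]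
      by (simp add: algebra_simps)
  qed simp
  have "((\<lambda>y. (2 - real CARD('n)) * dx k \<rho> (x, y0) * ?I y) has_integral (2 * 0 + 0)) UNIV"
    unfolding eq[symmetric] by (intro has_integral_add has_integral_mult_right 1 2)
  from has_integral_mult_right[OF this, of "inverse ((2 - real CARD('n)) * dx k \<rho> (x, y0))"]
  have "((\<lambda>y. inverse ((2 - real CARD('n)) * dx k \<rho> (x, y0)) * ((2 - real CARD('n)) * dx k \<rho> (x, y0) * ?I y)) has_integral 0) UNIV"
    by (simp only: add_0_right mult_zero_right)
  moreover have "inverse C * (C * s) = s" if "C \<noteq> 0" for C s :: real
    using that by (simp add: mult.assoc[symmetric])
  ultimately have I0: "(?I has_integral 0) UNIV" using nz by (simp only: not_False_eq_True simp_thms)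
  \<comment> \<open>The integrand is positive where \<open>E = 3/2\<close>, a level that every ray meets.\<close>
  define y1 where "y1 = sqrt (3 / 2 / E (x, y0)) *\<^sub>R y0"
  have Ey0: "E (x, y0) > 0" using x y0 by (intro E_pos) auto
  have y1: "y1 \<noteq> 0" "E (x, y1) = 3 / 2"
    using Ey0 y0 x by (simp_all add: y1_def E_scale)
  have cont: "continuous_on (- {0}) ?I"
  proof -
    have "continuous_on (- {0}) (\<lambda>y. ?\<phi> (E (x, y)) * \<mu> (x, y))"
      using x by (intro continuous_intros continuous_on_compose2[OF continuous_on_bump[of UNIV]]
          continuous_on_compose2[OF smooth_on_continuous_on[OF sm_E]]
          continuous_on_compose2[OF smooth_on_continuous_on[OF sm_\<mu>]]) auto
    then show ?thesis by (rule continuous_on_eq) auto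
  qed
  have "open (- {0 :: real^'n})" "y1 \<in> - {0}" using y1(1) by auto
  then obtain a b where "cbox a b \<subseteq> - {0}" "y1 \<in> box a b" "\<forall>i\<in>Basis. a \<bullet> i < b \<bullet> i"
    by (rule open_contains_cbox)
  then have ab: "cbox a b \<subseteq> - {0}" "y1 \<in> box a b" by auto
  have I_nn: "?I y \<ge> 0" for y by (simp add: bump_nonneg \<mu>_def)
  have int: "?I integrable_on cbox a b"
    by (intro integrable_continuous continuous_on_subset[OF cont ab(1)])
  have "integral (cbox a b) ?I \<le> integral UNIV ?I"
    by (rule integral_subset_le) (use int I0 I_nn in \<open>auto simp: has_integral_integrable\<close>)
  moreover have "integral (cbox a b) ?I \<ge> 0"
    by (rule integral_nonneg[OF int]) (rule I_nn)
  ultimately have "integral (cbox a b) ?I = 0"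
    unfolding integral_unique[OF I0] by (rule antisym)
  with integrable_integral[OF int] have "(?I has_integral 0) (cbox a b)" by (simp only:)
  then have "?I y1 = 0"
  proof (rule has_integral_0_cbox_imp_0[OF continuous_on_subset[OF cont ab(1)] I_nn])
    show "box a b \<noteq> {}" "y1 \<in> cbox a b" using ab(2) box_subset_cbox by auto
  qed
  then show False using y1 by (simp add: bump_def \<mu>_def)
qed

end

context local_finsler
begin

lemma weakly_landsberg_expr:
  assumes P0: "\<And>z i. z \<in> \<Omega> \<Longrightarrow> P i z = 0" and z: "z \<in> \<Omega>"
  shows "mean_landsberg_expr L z = 0"
proof -
  have Q0: "Q k w = 0" if "w \<in> \<Omega>" for k w
    using sder_cong[of "P k" "\<lambda>_. 0" w G] P0 that by (simp add: dyn1_def sder_leibniz)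
  have "jacobi_P k w = 0" if "w \<in> \<Omega>" for k w
    using sder_cong[of "Q k" "\<lambda>_. 0" w G] Q0 P0 that
    by (simp add: jacobi_P_def dyn1_def[of G Q] sder_leibniz)
  then have "dy j (jacobi_P i) z = 0" for i j
    using dy_cong[of "jacobi_P i" "\<lambda>_. 0" z j] z by (simp add: leibniz)
  then show ?thesis by (simp add: jacobi_P_divergence[OF z])
qed

end

theorem (in local_einstein) local_schur:
  assumes dim: "CARD('n) \<ge> 3" and x: "x \<in> U"
  shows "(r has_derivative (\<lambda>_. 0)) (at x)"
proof -
  have d: "(r has_derivative frechet_derivative r (at x)) (at x)"
    by (rule has_derivative_frechet[OF smooth_on_differentiable[OF smooth_r x]])
  interpret linear "frechet_derivative r (at x)"
    using d by (rule has_derivative_linear)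
  have k: "frechet_derivative r (at x) (axis k 1) = 0" for k
  proof -
    have y0: "axis k (1::real) \<noteq> (0 :: real^'n)" by (simp add: axis_eq_0_iff)
    show ?thesis using dx_\<rho>_0[OF x dim y0, of k] dx_\<rho>[of "(x, axis k 1)" k] x y0 by simp
  qed
  have "frechet_derivative r (at x) v = 0" for v
  proof -
    have "v = (\<Sum>k\<in>UNIV. v $ k *\<^sub>R axis k 1)"
      by (simp add: vec_eq_iff axis_def if_distrib cong: if_cong)
    then have "frechet_derivative r (at x) v = frechet_derivative r (at x) (\<Sum>k\<in>UNIV. v $ k *\<^sub>R axis k 1)"
      by simp
    also have "\<dots> = 0" by (simp add: sum scale k)
    finally show ?thesis .
  qed
  then have "frechet_derivative r (at x) = (\<lambda>_. 0)" by (rule ext)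
  with d show ?thesis by simp
qed


section \<open>From charts to the manifold\<close>

lemma chart_inv_in:
  assumes "is_chart X c"
  shows "inj_on (chart_map c) (chart_dom c)"
    and "x \<in> chart_image c \<Longrightarrow> chart_inv c x \<in> chart_dom c"
    and "x \<in> chart_image c \<Longrightarrow> chart_map c (chart_inv c x) = x"
    and "p \<in> chart_dom c \<Longrightarrow> chart_inv c (chart_map c p) = p"
    and "chart_dom c \<subseteq> topspace X"
proof -
  have sub: "chart_dom c \<subseteq> topspace X"
    using assms openin_subset by (auto simp: is_chart_def)
  have hm: "homeomorphic_map (subtopology X (chart_dom c)) (top_of_set (chart_image c)) (chart_map c)"
    using assms by (simp add: is_chart_def)
  then have inj: "inj_on (chart_map c) (chart_dom c)"
    using homeomorphic_imp_injective_map[OF hm] sub by (simp add: topspace_subtopology Int_absorb1)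
  show "inj_on (chart_map c) (chart_dom c)" by (rule inj)
  show "chart_dom c \<subseteq> topspace X" by (rule sub)
  show "x \<in> chart_image c \<Longrightarrow> chart_inv c x \<in> chart_dom c"
    unfolding chart_inv_def chart_image_def by (intro the_inv_into_into[OF inj]) auto
  show "x \<in> chart_image c \<Longrightarrow> chart_map c (chart_inv c x) = x"
    unfolding chart_inv_def chart_image_def by (rule f_the_inv_into_f[OF inj])
  show "p \<in> chart_dom c \<Longrightarrow> chart_inv c (chart_map c p) = p"
    unfolding chart_inv_def by (rule the_inv_into_f_f[OF inj])
qed

lemma open_chart_map_image:
  assumes c: "is_chart X c" and V: "openin X V" "V \<subseteq> chart_dom c"
  shows "open (chart_map c ` V)"
proof -
  have "open_map (subtopology X (chart_dom c)) (top_of_set (chart_image c)) (chart_map c)"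
    using c homeomorphic_imp_open_map by (auto simp: is_chart_def)
  moreover have "openin (subtopology X (chart_dom c)) V"
    using V by (auto simp: openin_subtopology)
  ultimately have "openin (top_of_set (chart_image c)) (chart_map c ` V)"
    by (simp add: open_map_def)
  moreover have "open (chart_image c)" using c by (simp add: is_chart_def)
  ultimately show ?thesis using openin_open_eq by blast
qed

lemma openin_chart_preimage:
  assumes c: "is_chart X c" and B: "open B"
  shows "openin X {p \<in> chart_dom c. chart_map c p \<in> B}"
proof -
  have dom: "openin X (chart_dom c)" using c by (simp add: is_chart_def)
  have "continuous_map (subtopology X (chart_dom c)) (top_of_set (chart_image c)) (chart_map c)"
    using c homeomorphic_imp_continuous_map by (auto simp: is_chart_def)
  then have "continuous_map (subtopology X (chart_dom c)) euclidean (chart_map c)"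
    by (simp add: continuous_map_in_subtopology)
  then have "openin (subtopology X (chart_dom c)) {p \<in> topspace (subtopology X (chart_dom c)). chart_map c p \<in> B}"
    using B by (intro openin_continuous_map_preimage) auto
  moreover have "topspace (subtopology X (chart_dom c)) = chart_dom c"
    using openin_subset[OF dom] by (rule topspace_subtopology_subset)
  ultimately have "openin (subtopology X (chart_dom c)) {p \<in> chart_dom c. chart_map c p \<in> B}" by (simp only:)
  then show ?thesis using openin_trans_full dom by blast
qed

lemma transition_has_derivative:
  assumes M: "smooth_manifold X A" and cd: "c \<in> A" "d \<in> A" and x: "x \<in> chart_image c" "chart_inv c x \<in> chart_dom d"
  shows "(transition c d has_derivative frechet_derivative (transition c d) (at x)) (at x)"
proof -
  have c: "is_chart X c" using M cd by (simp add: smooth_manifold_def)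
  have "x \<in> chart_map c ` (chart_dom c \<inter> chart_dom d)"
    using chart_inv_in(2,3)[OF c x(1)] x(2) by force
  moreover have "smooth_on (chart_map c ` (chart_dom c \<inter> chart_dom d)) (transition c d)"
    using M cd by (simp add: smooth_manifold_def)
  ultimately show ?thesis
    by (intro has_derivative_frechet smooth_on_differentiable)
qed

lemma transition_compose:
  assumes M: "smooth_manifold X A" and cde: "c \<in> A" "d \<in> A" "e \<in> A"
    and x: "x \<in> chart_image c" "chart_inv c x \<in> chart_dom d" "chart_inv c x \<in> chart_dom e"
  shows "frechet_derivative (transition c e) (at x) y =
    frechet_derivative (transition d e) (at (chart_map d (chart_inv c x))) (frechet_derivative (transition c d) (at x) y)"
proof -
  have c: "is_chart X c" and d: "is_chart X d" and e: "is_chart X e"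
    using M cde by (auto simp: smooth_manifold_def)
  let ?p = "chart_inv c x"
  have xd: "chart_map d ?p \<in> chart_image d" using x(2) by (auto simp: chart_image_def)
  have dp: "chart_inv d (chart_map d ?p) = ?p" by (rule chart_inv_in(4)[OF d x(2)])
  have D1: "(transition c d has_derivative frechet_derivative (transition c d) (at x)) (at x)"
    by (rule transition_has_derivative[OF M cde(1,2) x(1,2)])
  have D2: "(transition d e has_derivative frechet_derivative (transition d e) (at (chart_map d ?p))) (at (transition c d x))"
    using transition_has_derivative[OF M cde(2,3) xd] x(3) by (simp add: dp transition_def)
  have op: "openin X (chart_dom c \<inter> chart_dom d)"
    using c d by (intro openin_Int) (auto simp: is_chart_def)
  have "(transition c e has_derivative (\<lambda>y. frechet_derivative (transition d e) (at (chart_map d ?p))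
      (frechet_derivative (transition c d) (at x) y))) (at x)"
  proof (rule has_derivative_transform_within_open[OF has_derivative_compose[OF D1 D2]])
    show "open (chart_map c ` (chart_dom c \<inter> chart_dom d))"
      by (rule open_chart_map_image[OF c op]) auto
    show "x \<in> chart_map c ` (chart_dom c \<inter> chart_dom d)"
      using chart_inv_in(2,3)[OF c x(1)] x(2) by force
    show "transition d e (transition c d w) = transition c e w"
      if "w \<in> chart_map c ` (chart_dom c \<inter> chart_dom d)" for w
      using that chart_inv_in(4)[OF c] chart_inv_in(4)[OF d] by (auto simp: transition_def)
  qed
  then show ?thesis by (rule frechet_derivative_eqI)
qed

text \<open>The chain rule for transition maps shows that the components belong to one tangent vector; it is
nonzero because its component in the chart \<open>c\<close> itself is \<open>y\<close>.\<close>

lemma of_natural_coords_slit: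
  assumes M: "smooth_manifold X A" and cA: "c \<in> A" and x: "x \<in> chart_image c" and y: "y \<noteq> 0"
  shows "of_natural_coords A c (x, y) \<in> slit_tangent_bundle X A"
proof -
  have c: "is_chart X c" using M cA by (simp add: smooth_manifold_def)
  let ?p = "chart_inv c x"
  let ?v = "\<lambda>d. if d \<in> charts_at A ?p then frechet_derivative (transition c d) (at x) y else 0"
  have p: "?p \<in> chart_dom c" by (rule chart_inv_in(2)[OF c x])
  have "?v \<in> tangent_space A ?p"
    unfolding tangent_space_def
  proof (intro CollectI conjI ballI allI impI)
    fix d e assume "d \<in> charts_at A ?p" "e \<in> charts_at A ?p"
    then show "?v e = frechet_derivative (transition d e) (at (chart_map d ?p)) (?v d)"
      using transition_compose[OF M cA, of d e x y] x by (simp add: charts_at_def)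
  qed simp
  moreover have "?v c \<noteq> 0"
  proof -
    have "(transition c c has_derivative (\<lambda>y. y)) (at x)"
    proof (rule has_derivative_transform_within_open[OF has_derivative_ident])
      show "open (chart_image c)" using c by (simp add: is_chart_def)
      show "w = transition c c w" if "w \<in> chart_image c" for w
        using chart_inv_in(3)[OF c that] by (simp add: transition_def)
    qed (rule x)
    then have "frechet_derivative (transition c c) (at x) y = y" by (rule frechet_derivative_eqI)
    then show ?thesis using p cA y by (simp add: charts_at_def)
  qed
  then have "?v \<noteq> (\<lambda>_. 0)" by metis
  moreover have "?p \<in> topspace X" using p chart_inv_in(5)[OF c] by auto
  ultimately show ?thesis
    by (simp add: of_natural_coords_def slit_tangent_bundle_def)
qed

lemma of_natural_coords_scale:
  assumes M: "smooth_manifold X A" and cA: "c \<in> A" and x: "x \<in> chart_image c"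
  shows "of_natural_coords A c (x, t *\<^sub>R y) =
    (fst (of_natural_coords A c (x, y)), \<lambda>d. t *\<^sub>R snd (of_natural_coords A c (x, y)) d)"
proof -
  have "frechet_derivative (transition c d) (at x) (t *\<^sub>R y) = t *\<^sub>R frechet_derivative (transition c d) (at x) y"
    if "d \<in> charts_at A (chart_inv c x)" for d
    using that transition_has_derivative[OF M cA _ x, of d]
    by (intro linear_cmul) (auto simp: charts_at_def intro: has_derivative_linear)
  then show ?thesis by (auto simp: of_natural_coords_def)
qed

lemma finsler_metric_local:
  assumes M: "smooth_manifold X A" and F: "finsler_metric X A F" and cA: "c \<in> A"
  shows "local_finsler (chart_image c) (in_coords A c F)"
proof
  show "open (chart_image c)" using M cA by (auto simp: smooth_manifold_def is_chart_def)
  show "smooth_on (chart_image c \<times> (UNIV - {0})) (in_coords A c F)"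
    using F cA by (simp add: finsler_metric_def slit_coords_def)
  show "0 < (\<Sum>i\<in>UNIV. \<Sum>j\<in>UNIV. fund (in_coords A c F) i j z * w $ i * w $ j)"
    if "z \<in> chart_image c \<times> (UNIV - {0})" "w \<noteq> 0" for z w
    using F cA that unfolding finsler_metric_def slit_coords_def by blast
  fix x y :: "real^'b" and t :: real
  assume x: "x \<in> chart_image c" and y: "y \<noteq> 0" and t: "t > 0"
  obtain p v where pv: "of_natural_coords A c (x, y) = (p, v)" by fastforce
  then have "F (p, \<lambda>d. t *\<^sub>R v d) = t * F (p, v)"
    using F of_natural_coords_slit[OF M cA x y] t unfolding finsler_metric_def by auto
  then show "in_coords A c F (x, t *\<^sub>R y) = t * in_coords A c F (x, y)"
    using of_natural_coords_scale[OF M cA x, of t y] by (simp add: in_coords_def pv)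
qed

lemma locally_constant_imp_constant:
  assumes conn: "connected_space X"
    and loc: "\<And>p. p \<in> topspace X \<Longrightarrow> \<exists>V. openin X V \<and> p \<in> V \<and> (\<forall>q\<in>V. f q = f p)"
  shows "f constant_on topspace X"
proof (cases "topspace X = {}")
  case False
  then obtain p0 where p0: "p0 \<in> topspace X" by blast
  have op: "openin X {q \<in> topspace X. Q (f q)}" for Q
  proof (subst openin_subopen, safe)
    fix p assume p: "p \<in> topspace X" "Q (f p)"
    obtain V where "openin X V" "p \<in> V" "\<forall>q\<in>V. f q = f p" using loc[OF p(1)] by blast
    then show "\<exists>T. openin X T \<and> p \<in> T \<and> T \<subseteq> {q \<in> topspace X. Q (f q)}"
      using p openin_subset by (intro exI[of _ V]) fastforce
  qed
  let ?S = "{q \<in> topspace X. f q = f p0}"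
  have "topspace X - ?S = {q \<in> topspace X. f q \<noteq> f p0}" by auto
  then have "closedin X ?S" using op[of "\<lambda>s. s \<noteq> f p0"] by (simp add: closedin_def)
  then have "?S = topspace X"
    using conn op[of "\<lambda>s. s = f p0"] p0 unfolding connected_space_clopen_in by blast
  then show ?thesis unfolding constant_on_def by blast
qed (simp add: constant_on_def)

theorem corollary4p2:
  fixes X :: "'m topology"
    and A :: "('m, 'n::finite) chart set"
    and F :: "'m \<times> ('m, 'n) tvec \<Rightarrow> real"
    and \<rho> :: "'m \<Rightarrow> real"
  assumes manifold: "smooth_manifold X A"
    and connected: "connected_space X"
    and dim: "CARD('n) \<ge> 3"
    and finsler: "finsler_metric X A F"
    and landsberg:
      "(\<forall>c\<in>A. \<forall>z\<in>slit_coords c. \<forall>i. mean_landsberg (in_coords A c F) i z = 0) \<or>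
       (\<forall>c\<in>A. \<forall>z\<in>slit_coords c. mean_landsberg_expr (in_coords A c F) z = 0)"
    and smooth: "smooth_scalar A \<rho>"
    and einstein:
      "\<forall>c\<in>A. \<forall>z\<in>slit_coords c.
         ricci (in_coords A c F) z = \<rho> (chart_inv c (fst z)) * (in_coords A c F z)\<^sup>2"
  shows "\<rho> constant_on topspace X"
proof (rule locally_constant_imp_constant[OF connected])
  fix p assume "p \<in> topspace X"
  then obtain c where cA: "c \<in> A" and pc: "p \<in> chart_dom c"
    using manifold unfolding smooth_manifold_def by blast
  have c: "is_chart X c" using manifold cA by (simp add: smooth_manifold_def)
  have lf: "local_finsler (chart_image c) (in_coords A c F)"
    by (rule finsler_metric_local[OF manifold finsler cA])
  have le: "local_einstein (chart_image c) (in_coords A c F) (\<rho> \<circ> chart_inv c)"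
  proof (intro local_einstein.intro lf local_einstein_axioms.intro)
    show "smooth_on (chart_image c) (\<rho> \<circ> chart_inv c)"
      using smooth cA by (simp add: smooth_scalar_def)
    fix z :: "(real^'n) \<times> (real^'n)" assume z: "z \<in> chart_image c \<times> (UNIV - {0})"
    then have zs: "z \<in> slit_coords c" by (simp add: slit_coords_def)
    show "ricci (in_coords A c F) z = (\<rho> \<circ> chart_inv c) (fst z) * (in_coords A c F z)\<^sup>2"
      using einstein cA zs by simp
    show "mean_landsberg_expr (in_coords A c F) z = 0"
      using landsberg
    proof
      assume "\<forall>c\<in>A. \<forall>z\<in>slit_coords c. \<forall>i. mean_landsberg (in_coords A c F) i z = 0"
      then show ?thesis
        using cA unfolding slit_coords_def
        by (intro local_finsler.weakly_landsberg_expr[OF lf _ z]) blast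
    qed (use cA zs in auto)
  qed
  let ?x = "chart_map c p"
  have "?x \<in> chart_image c" using pc by (auto simp: chart_image_def)
  then obtain e where e: "e > 0" "ball ?x e \<subseteq> chart_image c"
    using local_finsler.open_U[OF lf] open_contains_ball by blast
  have const: "(\<rho> \<circ> chart_inv c) w = (\<rho> \<circ> chart_inv c) ?x" if "w \<in> ball ?x e" for w
  proof (rule has_derivative_zero_unique[OF convex_ball _ that])
    show "((\<rho> \<circ> chart_inv c) has_derivative (\<lambda>h. 0)) (at w within ball ?x e)" if "w \<in> ball ?x e" for w
      by (rule has_derivative_at_withinI[OF local_einstein.local_schur[OF le dim subsetD[OF e(2) that]]])
  qed (use e in simp)
  let ?V = "{q \<in> chart_dom c. chart_map c q \<in> ball ?x e}"
  have "\<rho> q = \<rho> p" if "q \<in> ?V" for q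
    using const[of "chart_map c q"] that pc by (simp add: chart_inv_in(4)[OF c])
  moreover have "openin X ?V" by (rule openin_chart_preimage[OF c open_ball])
  moreover have "p \<in> ?V" using pc e by simp
  ultimately show "\<exists>V. openin X V \<and> p \<in> V \<and> (\<forall>q\<in>V. \<rho> q = \<rho> p)" by blast
qed

end
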